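(* Let $m,n$ be coprime integers with $2\le m<n$, and let $p,q$ be coprime integers with $2\le p$ and $1\le q$. Regard $A_{m,n}=K_1\cup K_2$ (respectively $B_{p,q}=K_1\cup K_2$) as a knot $K_1$ in $S^1\times S^2$, where $S^1\times S^2$ is the result of $0$-surgery along the unknotted component $K_2$. Then no knot $A_{m,n}$ is isotopic in $S^1\times S^2$ to any knot $B_{p,q}$.
   Context: For coprime positive integers $m,n$, $A_{m,n}=K_1\cup K_2\subset S^3$ is the following 2-component link. $K_1$ is the closure of the braid on $m+n$ strands $(\sigma_m\sigma_{m+1}\cdots\sigma_{m+n-1})(\sigma_{m-1}\sigma_m\cdots\sigma_{m+n-2})\cdots(\sigma_1\sigma_2\cdots\sigma_n)$, with all $mn$ crossings positive, and $K_2$ is the braid axis. $K_1$ is the (positive) torus knot $T_{m,n}$, $K_2$ is an unknot, and the linking number of $K_1$ and $K_2$ is $m+n$. $B_{p,q}=K_1\cup K_2\subset S^3$ is the 2-component link in which $K_1$ is the closure of the $(p,q)$-torus braid $(\sigma_1\sigma_2\cdots\sigma_{p-1})^q$ on $p$ strands (positive crossings) and $K_2$ is the braid axis (an unknot); the linking number of $K_1$ and $K_2$ is $p$. *)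

theory Defs
  imports "HOL-Analysis.Analysis" "HOL-Homology.Homology"
begin

section \<open>Spaces\<close>

text \<open>
  The three-sphere is the unit sphere of \<open>\<complex>\<^sup>2\<close>, oriented as the boundary of the unit ball.
\<close>

definition circle :: "complex set" where
  "circle = sphere 0 1"

definition S3 :: "(complex \<times> complex) set" where
  "S3 = sphere 0 1"

definition S1xS2 :: "(complex \<times> complex \<times> real) topology" where
  "S1xS2 = top_of_set (circle \<times> sphere 0 1)"

definition open_disc :: "complex set" where
  "open_disc = ball 0 1"


section \<open>Ambient isotopy\<close>

text \<open>
  Knots are treated as unoriented subsets.  For the knots considered here this loses nothing
  with respect to oriented ones: they are oriented as closed braids, so their classes in
  \<open>H\<^sub>1(S\<^sup>1 \<times> S\<^sup>2) = \<int>\<close> are positive, and an isotopy preserves homology classes.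
\<close>

definition ambient_isotopic :: "'a topology \<Rightarrow> 'a set \<Rightarrow> 'a set \<Rightarrow> bool" where
  "ambient_isotopic X K L \<longleftrightarrow>
     K \<subseteq> topspace X \<and> L \<subseteq> topspace X \<and>
     (\<exists>H :: real \<Rightarrow> 'a \<Rightarrow> 'a.
        continuous_map (prod_topology (top_of_set {0..1}) X) X (\<lambda>(t, x). H t x) \<and>
        (\<forall>t\<in>{0..1}. homeomorphic_map X X (H t)) \<and>
        (\<forall>x\<in>topspace X. H 0 x = x) \<and>
        H 1 ` K = L)"


section \<open>Zero-surgery on a knot in the three-sphere\<close>

definition open_embedding :: "'a topology \<Rightarrow> 'b topology \<Rightarrow> ('a \<Rightarrow> 'b) \<Rightarrow> bool" where
  "open_embedding X Y f \<longleftrightarrow> embedding_map X Y f \<and> openin Y (f ` topspace X)"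

definition null_homologous :: "'a topology \<Rightarrow> (complex \<Rightarrow> 'a) \<Rightarrow> bool" where
  "null_homologous X f \<longleftrightarrow>
     continuous_map (top_of_set circle) X f \<and>
     trivial_homomorphism (homology_group 1 (top_of_set circle)) (homology_group 1 X)
       (hom_induced 1 (top_of_set circle) {} X {} f)"

text \<open>
  A tubular neighbourhood of \<open>K\<close> whose framing is the zero-framing: the push-off of \<open>K\<close> along
  the framing is null-homologous in the complement of \<open>K\<close>.
\<close>

definition zero_framing :: "(complex \<times> complex) set \<Rightarrow> (complex \<times> complex \<Rightarrow> complex \<times> complex) \<Rightarrow> bool"
  where
  "zero_framing K \<nu> \<longleftrightarrow>
     open_embedding (top_of_set (circle \<times> open_disc)) (top_of_set S3) \<nu> \<and>
     (\<lambda>a. \<nu> (a, 0)) ` circle = K \<and>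
     null_homologous (top_of_set (S3 - K)) (\<lambda>a. \<nu> (a, 1/2))"

text \<open>
  \<open>zero_surgery K M \<iota>\<close>: the space \<open>M\<close> is the result of 0-surgery along \<open>K\<close>, with \<open>\<iota>\<close> the inclusion
  of \<open>S\<^sup>3 - K\<close> into it.  This is Milnor's description of surgery along a framed sphere:
  \<open>M\<close> is \<open>S\<^sup>3 - K\<close> glued to an open solid torus \<open>D\<^sup>2 \<times> S\<^sup>1\<close> by identifying \<open>\<nu> (a, r b)\<close> with
  \<open>(r a, b)\<close> for \<open>a, b \<in> S\<^sup>1\<close> and \<open>0 < r < 1\<close>.  Thus the meridian disc \<open>D\<^sup>2 \<times> {b}\<close> of the new solid
  torus is bounded by the longitude \<open>\<nu> (\<cdot>, r b)\<close>, and \<open>{0} \<times> S\<^sup>1\<close> is its core.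
\<close>

definition zero_surgery ::
  "(complex \<times> complex) set \<Rightarrow> 'a topology \<Rightarrow> (complex \<times> complex \<Rightarrow> 'a) \<Rightarrow> bool" where
  "zero_surgery K M \<iota> \<longleftrightarrow>
     open_embedding (top_of_set (S3 - K)) M \<iota> \<and>
     (\<exists>\<nu> g. zero_framing K \<nu> \<and>
        open_embedding (top_of_set (open_disc \<times> circle)) M g \<and>
        topspace M = \<iota> ` (S3 - K) \<union> g ` (open_disc \<times> circle) \<and>
        (\<forall>b\<in>circle. g (0, b) \<notin> \<iota> ` (S3 - K)) \<and>
        (\<forall>a\<in>circle. \<forall>b\<in>circle. \<forall>r\<in>{0<..<1}.
           g (of_real r * a, b) = \<iota> (\<nu> (a, of_real r * b))))"


section \<open>Closed braids around their axis\<close>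

definition braid_axis :: "(complex \<times> complex) set" where
  "braid_axis = {(z, w) \<in> S3. z = 0}"

text \<open>
  The homeomorphism from the open solid torus \<open>S\<^sup>1 \<times> \<complex>\<close> onto the complement of the axis.
  It is untwisted: the curve \<open>S\<^sup>1 \<times> {t}\<close> has linking number 0 with the core \<open>S\<^sup>1 \<times> {0}\<close>
  for \<open>t \<noteq> 0\<close>, and linking number 1 with the axis.
\<close>

definition solid_torus_map :: "complex \<times> complex \<Rightarrow> complex \<times> complex" where
  "solid_torus_map = (\<lambda>(u, t). (1 / sqrt (1 + (cmod t)\<^sup>2)) *\<^sub>R (u, t))"

text \<open>
  The positions at time \<open>s \<in> [0, 1]\<close> of the strands of the positive generator \<open>\<sigma>\<^sub>i\<close> on \<open>k\<close> strands,
  \<open>1 \<le> i < k\<close>.  The strands start and end at the points \<open>1, \<dots>, k\<close> of the real line, and those at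
  \<open>i\<close> and \<open>i + 1\<close> make a counterclockwise half-turn about their midpoint.  Counterclockwise is
  the positive crossing for the above orientation of the three-sphere: after a full turn, the two
  strands close up to a pair of curves with linking number \<open>+1\<close>.
\<close>

definition sigma_strands :: "nat \<Rightarrow> nat \<Rightarrow> real \<Rightarrow> complex set" where
  "sigma_strands k i s =
     of_nat ` ({1..k} - {i, i + 1}) \<union>
     {of_nat i + 1/2 - cis (pi * s) / 2, of_nat i + 1/2 + cis (pi * s) / 2}"

text \<open>
  A positive braid word is the list of the indices of its generators; the \<open>j\<close>-th letter takes
  place over the \<open>j\<close>-th of \<open>length w\<close> equal arcs of \<open>S\<^sup>1\<close> (only nonempty words occur).
\<close>

definition closed_braid :: "nat \<Rightarrow> nat list \<Rightarrow> (complex \<times> complex) set" where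
  "closed_braid k w =
     {solid_torus_map (cis (2 * pi * (real j + s) / real (length w)), t) | j s t.
        j < length w \<and> s \<in> {0..1} \<and> t \<in> sigma_strands k (w ! j) s}"

definition A_word :: "nat \<Rightarrow> nat \<Rightarrow> nat list" where
  "A_word m n = concat (map (\<lambda>j. [j..<j + n]) (rev [1..<m + 1]))"

definition B_word :: "nat \<Rightarrow> nat \<Rightarrow> nat list" where
  "B_word p q = concat (replicate q [1..<p])"

text \<open>The links, as pairs \<open>(K\<^sub>1, K\<^sub>2)\<close> of components.\<close>

definition A_link :: "nat \<Rightarrow> nat \<Rightarrow> (complex \<times> complex) set \<times> (complex \<times> complex) set" where
  "A_link m n = (closed_braid (m + n) (A_word m n), braid_axis)"

definition B_link :: "nat \<Rightarrow> nat \<Rightarrow> (complex \<times> complex) set \<times> (complex \<times> complex) set" where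
  "B_link p q = (closed_braid p (B_word p q), braid_axis)"


section \<open>The product of the circle and the sphere as a result of the surgery\<close>

text \<open>
  The standard identification: under \<open>solid_torus_map\<close>, the point \<open>(u, t)\<close> of \<open>S\<^sup>1 \<times> \<complex>\<close> goes to
  \<open>(u, [t])\<close>, with \<open>[t]\<close> the inverse stereographic projection of \<open>t\<close>.
\<close>

definition standard_inclusion :: "complex \<times> complex \<Rightarrow> complex \<times> complex \<times> real" where
  "standard_inclusion = (\<lambda>(z, w). (sgn z, 2 * of_real (cmod z) * w, (cmod w)\<^sup>2 - (cmod z)\<^sup>2))"

lemma mem_S3: "(z, w) \<in> S3 \<longleftrightarrow> (cmod z)\<^sup>2 + (cmod w)\<^sup>2 = 1"
  by (simp add: S3_def norm_Pair)

lemma mem_circle: "a \<in> circle \<longleftrightarrow> cmod a = 1"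
  by (simp add: circle_def)

lemma mem_open_disc: "a \<in> open_disc \<longleftrightarrow> cmod a < 1"
  by (simp add: open_disc_def)

lemma mem_braid_axis: "(z, w) \<in> braid_axis \<longleftrightarrow> (z, w) \<in> S3 \<and> z = 0"
  by (auto simp: braid_axis_def)

lemma one_plus_pos: "1 + (cmod t)\<^sup>2 > 0"
  by (simp add: add_pos_nonneg)

lemma solid_torus_map_in: 
  assumes "u \<in> circle" shows "solid_torus_map (u, t) \<in> S3 - braid_axis"
proof -
  have "norm (u, t) = sqrt (1 + (cmod t)\<^sup>2)"
    using assms by (simp add: norm_Pair mem_circle)
  then have "solid_torus_map (u, t) \<in> S3"
    using one_plus_pos[of t] by (simp add: solid_torus_map_def S3_def del: scaleR_Pair)
  moreover have "fst (solid_torus_map (u, t)) \<noteq> 0"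
    using assms one_plus_pos[of t] by (auto simp: solid_torus_map_def mem_circle)
  ultimately show ?thesis by (auto simp: braid_axis_def)
qed

lemma closed_braid_subset: "closed_braid k w \<subseteq> S3 - braid_axis"
  unfolding closed_braid_def using solid_torus_map_in by (auto simp: mem_circle)

lemma open_embedding_top_of_set:
  assumes "continuous_on S f" "f ` S = U" "openin (top_of_set T) U"
    and "continuous_on U h" "\<And>x. x \<in> S \<Longrightarrow> h (f x) = x"
  shows "open_embedding (top_of_set S) (top_of_set T) f"
proof -
  have "U \<subseteq> T" using assms(3) by (meson openin_imp_subset)
  have "homeomorphic_maps (top_of_set S) (top_of_set U) f h"
    unfolding homeomorphic_maps_def using assms by auto
  then have "homeomorphic_map (top_of_set S) (top_of_set U) f"
    using homeomorphic_maps_map by blast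
  moreover have "subtopology (top_of_set T) (f ` topspace (top_of_set S)) = top_of_set U"
    using \<open>U \<subseteq> T\<close> assms(2) by (simp add: subtopology_subtopology inf.absorb2)
  ultimately show ?thesis
    using assms by (simp add: open_embedding_def embedding_map_def)
qed

lemma null_homologous_homotopic_const:
  assumes "homotopic_with (\<lambda>_. True) (top_of_set circle) X f (\<lambda>_. c)"
  shows "null_homologous X f"
proof -
  let ?C = "top_of_set circle" let ?P = "subtopology X {c}"
  let ?G = "homology_group 1 ?C" let ?H = "homology_group 1 X"
  have cont: "continuous_map ?C X f" "continuous_map ?C X (\<lambda>_. c)"
    using homotopic_with_imp_continuous_maps[OF assms] by auto
  have "(1::complex) \<in> circle" by (simp add: mem_circle)
  then have c: "c \<in> topspace X"
    using continuous_map_image_subset_topspace[OF cont(2)] by auto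
  have contP: "continuous_map ?C ?P (\<lambda>_. c)" using c by simp
  have tP: "trivial_group (homology_group 1 ?P)"
    using homology_dimension_axiom[of ?P c 1] c by simp
  have eq: "hom_induced 1 ?C {} X {} f = hom_induced 1 ?C {} X {} (\<lambda>_. c)"
    using homology_homotopy_axiom[of "{}" "{}" ?C X f "\<lambda>_. c" 1] assms by simp
  have comp: "hom_induced 1 ?C {} X {} (\<lambda>_. c) x
      = hom_induced 1 ?P {} X {} id (hom_induced 1 ?C {} ?P {} (\<lambda>_. c) x)" for x
    using hom_induced_compose'[of ?C ?P "\<lambda>_. c" "{}" "{}" X id "{}" 1 x] contP
    by (simp add: comp_def continuous_map_from_subtopology)
  have one: "hom_induced 1 ?P {} X {} id \<one>\<^bsub>homology_group 1 ?P\<^esub> = \<one>\<^bsub>?H\<^esub>"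
    by (rule hom_one[OF hom_induced_hom]) auto
  have "hom_induced 1 ?C {} X {} f x = \<one>\<^bsub>?H\<^esub>" for x
  proof -
    have "hom_induced 1 ?C {} ?P {} (\<lambda>_. c) x \<in> carrier (homology_group 1 ?P)"
      by (rule hom_induced_carrier)
    then have "hom_induced 1 ?C {} ?P {} (\<lambda>_. c) x = \<one>\<^bsub>homology_group 1 ?P\<^esub>"
      using tP by (simp add: trivial_group_def)
    then show ?thesis by (simp add: eq comp one)
  qed
  then show ?thesis
    using cont(1) by (simp add: null_homologous_def trivial_homomorphism_def hom_induced_hom)
qed

definition axis_framing :: "complex \<times> complex \<Rightarrow> complex \<times> complex" where
  "axis_framing = (\<lambda>(a, d). (1 / sqrt (1 + (cmod d)\<^sup>2)) *\<^sub>R (d, a))"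

definition new_torus :: "complex \<times> complex \<Rightarrow> complex \<times> complex \<times> real" where
  "new_torus = (\<lambda>(c, b). (b, (2 / (1 + (cmod c)\<^sup>2)) *\<^sub>R c, (1 - (cmod c)\<^sup>2) / (1 + (cmod c)\<^sup>2)))"

lemma axis_framing_in:
  assumes "cmod a = 1"
  shows "axis_framing (a, d) \<in> S3"
proof -
  have "norm (d, a) = sqrt (1 + (cmod d)\<^sup>2)"
    using assms by (simp add: norm_Pair add.commute)
  then show ?thesis
    using one_plus_pos[of d] by (simp add: axis_framing_def S3_def del: scaleR_Pair)
qed

lemma axis_framing_open_embedding:
  "open_embedding (top_of_set (circle \<times> open_disc)) (top_of_set S3) axis_framing"
proof (rule open_embedding_top_of_set[where U = "S3 \<inter> {p. cmod (fst p) < cmod (snd p)}"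
        and h = "\<lambda>(z, w). (sgn w, (1 / cmod w) *\<^sub>R z)"])
  show "continuous_on (circle \<times> open_disc) axis_framing"
    unfolding axis_framing_def case_prod_unfold
    by (intro continuous_intros) (use one_plus_pos less_irrefl in \<open>metis real_sqrt_eq_zero_cancel_iff\<close>)
  show "openin (top_of_set S3) (S3 \<inter> {p. cmod (fst p) < cmod (snd p)})"
    by (intro openin_open_Int open_Collect_less continuous_intros)
  show "continuous_on (S3 \<inter> {p. cmod (fst p) < cmod (snd p)}) (\<lambda>(z, w). (sgn w, (1 / cmod w) *\<^sub>R z))"
    unfolding case_prod_unfold sgn_div_norm
    by (intro continuous_intros) auto
  show inv: "(case axis_framing x of (z, w) \<Rightarrow> (sgn w, (1 / cmod w) *\<^sub>R z)) = x"
    if "x \<in> circle \<times> open_disc" for x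
  proof -
    from that obtain a d where x: "x = (a, d)" "cmod a = 1"
      by (auto simp: mem_circle)
    have "sqrt (1 + (cmod d)\<^sup>2) > 0" using one_plus_pos[of d] by simp
    then show ?thesis
      by (simp add: x axis_framing_def sgn_scaleR sgn_div_norm)
  qed
  show "axis_framing ` (circle \<times> open_disc) = S3 \<inter> {p. cmod (fst p) < cmod (snd p)}"
  proof (intro equalityI subsetI)
    fix p assume "p \<in> axis_framing ` (circle \<times> open_disc)"
    then obtain a d where p: "p = axis_framing (a, d)" "cmod a = 1" "cmod d < 1"
      by (auto simp: mem_circle mem_open_disc)
    have "sqrt (1 + (cmod d)\<^sup>2) > 0" using one_plus_pos[of d] by simp
    then have "cmod (fst p) < cmod (snd p)"
      using p by (simp add: axis_framing_def divide_strict_right_mono)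
    then show "p \<in> S3 \<inter> {p. cmod (fst p) < cmod (snd p)}"
      using p axis_framing_in by simp
  next
    fix p assume "p \<in> S3 \<inter> {p. cmod (fst p) < cmod (snd p)}"
    then obtain z w where p: "p = (z, w)" "(cmod z)\<^sup>2 + (cmod w)\<^sup>2 = 1" "cmod z < cmod w"
      by (cases p) (auto simp: mem_S3)
    have w: "cmod w > 0" using p(3) norm_ge_zero[of z] by linarith
    define d where "d = (1 / cmod w) *\<^sub>R z"
    have "1 + (cmod d)\<^sup>2 = (1 / cmod w)\<^sup>2"
      using p(2) w by (simp add: d_def power_divide field_simps)
    then have "sqrt (1 + (cmod d)\<^sup>2) = 1 / cmod w"
      using w by (metis less_eq_real_def divide_nonneg_nonneg zero_le_one real_sqrt_abs abs_of_nonneg)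
    then have "axis_framing (sgn w, d) = p"
      using w by (simp add: axis_framing_def p d_def sgn_div_norm)
    moreover have "cmod (sgn w) = 1" using w by (simp add: norm_sgn)
    moreover have "cmod d < 1" using p(3) w by (simp add: d_def divide_simps)
    ultimately show "p \<in> axis_framing ` (circle \<times> open_disc)"
      by (force simp: mem_circle mem_open_disc)
  qed
qed

lemma zero_framing_axis: "zero_framing braid_axis axis_framing"
proof -
  have core: "(\<lambda>a. axis_framing (a, 0)) ` circle = braid_axis"
  proof -
    have "cmod b = 1" if "(cmod b)\<^sup>2 = 1" for b
      using that by (simp add: power2_eq_1_iff) (metis norm_ge_zero not_one_le_zero neg_0_le_iff_le)
    then show ?thesis
      by (auto simp: axis_framing_def mem_circle braid_axis_def mem_S3 image_iff)
  qed
  define f where "f = (\<lambda>a. axis_framing (a, 1/2))"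
  define c where "c = 1 / sqrt (1 + (1/2)\<^sup>2)"
  have c: "0 < c" by (simp add: c_def power2_eq_square)
  have cS: "c * c * (5/4) = 1"
    by (simp add: c_def field_simps power2_eq_square)
  have f: "f a = (of_real (c / 2), of_real c * a)" for a
    by (simp add: f_def axis_framing_def c_def scaleR_conv_of_real norm_divide)
  text \<open>The push-off bounds a disc, over which it is contracted to the centre.\<close>
  define H :: "real \<times> complex \<Rightarrow> complex \<times> complex"
    where "H = (\<lambda>(t, a). (of_real (sqrt (1 - ((1 - t) * c)\<^sup>2)), of_real ((1 - t) * c) * a))"
  have cle: "c * c < 1" using cS by linarith
  have pos: "1 - ((1 - t) * c)\<^sup>2 > 0" if "0 \<le> t" "t \<le> 1" for t
  proof -
    have "(1 - t)\<^sup>2 \<le> 1" using that by (simp add: power_le_one)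
    then have "(1 - t)\<^sup>2 * (c * c) \<le> 1 * (c * c)" using c by (intro mult_right_mono) auto
    then show ?thesis using cle by (simp add: power2_eq_square algebra_simps)
  qed
  have "homotopic_with (\<lambda>_. True) (top_of_set circle) (top_of_set (S3 - braid_axis)) f (\<lambda>_. (1, 0))"
  unfolding homotopic_with_def
  proof (intro exI[of _ H] conjI)
    have "continuous_on ({0..1} \<times> circle) H"
      unfolding H_def case_prod_unfold by (intro continuous_intros)
    moreover have "H ` ({0..1} \<times> circle) \<subseteq> S3 - braid_axis"
    proof (rule image_subsetI)
      fix x assume "x \<in> {0..1::real} \<times> circle"
      then obtain t a where x: "x = (t, a)" and t: "t \<in> {0..1}" and a: "a \<in> circle" by blast
      have p: "1 - ((1 - t) * c)\<^sup>2 > 0" using pos t by simp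
      then have "H (t, a) \<in> S3"
        using a by (simp add: H_def mem_S3 mem_circle norm_mult del: of_real_mult of_real_diff)
      moreover have "fst (H (t, a)) \<noteq> 0" using p by (simp add: H_def)
      ultimately show "H x \<in> S3 - braid_axis" by (auto simp: x braid_axis_def)
    qed
    ultimately show "continuous_map (prod_topology (top_of_set {0..1}) (top_of_set circle))
        (top_of_set (S3 - braid_axis)) H"
      by (simp add: prod_topology_subtopology_eu image_subset_iff_funcset)
    have "sqrt (1 - c\<^sup>2) = c / 2"
    proof (rule real_sqrt_unique)
      show "(c / 2)\<^sup>2 = 1 - c\<^sup>2" using cS by (simp add: power2_eq_square)
    qed (use c in simp)
    then show "\<forall>x. H (0, x) = f x"
      unfolding H_def f by (simp only: prod.case diff_zero mult_1_left simp_thms)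
    show "\<forall>x. H (1, x) = (1, 0)" by (simp add: H_def)
  qed auto
  then have "null_homologous (top_of_set (S3 - braid_axis)) f"
    by (rule null_homologous_homotopic_const)
  then show ?thesis
    using core axis_framing_open_embedding by (simp add: zero_framing_def f_def)
qed

lemma standard_inclusion_in: 
  assumes "(z, w) \<in> S3 - braid_axis"
  shows "standard_inclusion (z, w) \<in> circle \<times> sphere 0 1"
proof -
  have z: "z \<noteq> 0" and n: "(cmod z)\<^sup>2 + (cmod w)\<^sup>2 = 1"
    using assms by (auto simp: mem_braid_axis mem_S3)
  have "(2 * cmod z * cmod w)\<^sup>2 + ((cmod w)\<^sup>2 - (cmod z)\<^sup>2)\<^sup>2 = ((cmod z)\<^sup>2 + (cmod w)\<^sup>2)\<^sup>2"
    by (simp add: power2_eq_square algebra_simps)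
  then show ?thesis
    using z n by (simp add: standard_inclusion_def mem_circle norm_sgn norm_Pair norm_mult)
qed

lemma sphere_split: "(u, v, h) \<in> circle \<times> (sphere 0 1 :: (complex \<times> real) set)
    \<longleftrightarrow> cmod u = 1 \<and> (cmod v)\<^sup>2 + h\<^sup>2 = 1"
  by (simp add: mem_circle norm_Pair)

lemma standard_inclusion_image:
  "standard_inclusion ` (S3 - braid_axis) = circle \<times> sphere 0 1 \<inter> {p. snd (snd p) < 1}"
proof (intro equalityI subsetI)
  fix p assume "p \<in> standard_inclusion ` (S3 - braid_axis)"
  then obtain z w where p: "p = standard_inclusion (z, w)" "(z, w) \<in> S3 - braid_axis" by auto
  then have "z \<noteq> 0" and n: "(cmod z)\<^sup>2 + (cmod w)\<^sup>2 = 1"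
    by (auto simp: mem_braid_axis mem_S3)
  then have "(cmod z)\<^sup>2 > 0" by simp
  then have "(cmod w)\<^sup>2 - (cmod z)\<^sup>2 < 1" using n by linarith
  then show "p \<in> circle \<times> sphere 0 1 \<inter> {p. snd (snd p) < 1}"
    using standard_inclusion_in[OF p(2)] p(1) by (simp add: standard_inclusion_def)
next
  fix p assume "p \<in> circle \<times> sphere 0 1 \<inter> {p :: complex \<times> complex \<times> real. snd (snd p) < 1}"
  then obtain u v h where p: "p = (u, v, h)" "cmod u = 1" "(cmod v)\<^sup>2 + h\<^sup>2 = 1" "h < 1"
    by (cases p) (auto simp: mem_circle norm_Pair)
  define r where "r = sqrt ((1 - h) / 2)"
  have r: "r > 0" "r\<^sup>2 = (1 - h) / 2" using p(4) by (auto simp: r_def)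
  define z w where "z = of_real r * u" and "w = (1 / (2 * r)) *\<^sub>R v"
  have z: "cmod z = r" using r p by (simp add: z_def norm_mult)
  have "(cmod w)\<^sup>2 = (cmod v)\<^sup>2 / (4 * r\<^sup>2)"
    using r(1) by (simp add: w_def power_divide power_mult_distrib)
  also have "\<dots> = (1 - h\<^sup>2) / (2 * (1 - h))"
  proof -
    have "(cmod v)\<^sup>2 = 1 - h\<^sup>2" "4 * r\<^sup>2 = 2 * (1 - h)" using p(3) r(2) by simp_all
    then show ?thesis by (simp only:)
  qed
  also have "\<dots> = (1 + h) / 2" using p(4) by (simp add: field_simps power2_eq_square)
  finally have w: "(cmod w)\<^sup>2 = (1 + h) / 2" .
  have "(z, w) \<in> S3 - braid_axis"
    using z w r by (auto simp: mem_S3 mem_braid_axis field_simps)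
  moreover have "standard_inclusion (z, w) = p"
  proof -
    have "sgn z = u" using z r p(2) by (simp add: sgn_div_norm z_def scaleR_conv_of_real)
    moreover have "2 * of_real (cmod z) * w = v"
      using z r by (simp add: w_def scaleR_conv_of_real)
    moreover have "(cmod w)\<^sup>2 - (cmod z)\<^sup>2 = h" unfolding w z r(2) by (simp add: field_simps)
    ultimately show ?thesis by (simp add: standard_inclusion_def p)
  qed
  ultimately show "p \<in> standard_inclusion ` (S3 - braid_axis)" by force
qed

lemma standard_inclusion_open_embedding:
  "open_embedding (top_of_set (S3 - braid_axis)) S1xS2 standard_inclusion"
  unfolding S1xS2_def
proof (rule open_embedding_top_of_set[OF _ standard_inclusion_image,
      where h = "\<lambda>(u, v, h). (of_real (sqrt ((1 - h) / 2)) * u, (1 / (2 * sqrt ((1 - h) / 2))) *\<^sub>R v)"])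
  show "continuous_on (S3 - braid_axis) standard_inclusion"
    unfolding standard_inclusion_def case_prod_unfold sgn_div_norm
    by (intro continuous_intros) (auto simp: braid_axis_def)
  show "openin (top_of_set (circle \<times> sphere 0 1))
     (circle \<times> sphere 0 1 \<inter> {p :: complex \<times> complex \<times> real. snd (snd p) < 1})"
    by (intro openin_open_Int open_Collect_less continuous_intros)
  show "continuous_on (circle \<times> sphere 0 1 \<inter> {p :: complex \<times> complex \<times> real. snd (snd p) < 1})
     (\<lambda>(u, v, h). (of_real (sqrt ((1 - h) / 2)) * u, (1 / (2 * sqrt ((1 - h) / 2))) *\<^sub>R v))"
    unfolding case_prod_unfold by (intro continuous_intros) auto
  fix x assume "x \<in> S3 - braid_axis"
  then obtain z w where x: "x = (z, w)" "z \<noteq> 0" "(cmod z)\<^sup>2 + (cmod w)\<^sup>2 = 1"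
    by (cases x) (auto simp: mem_braid_axis mem_S3)
  have "(1 - ((cmod w)\<^sup>2 - (cmod z)\<^sup>2)) / 2 = (cmod z)\<^sup>2"
    using x(3) by (simp add: field_simps)
  then have "sqrt ((1 - ((cmod w)\<^sup>2 - (cmod z)\<^sup>2)) / 2) = cmod z"
    by (simp only: real_sqrt_abs abs_norm_cancel)
  then show "(case standard_inclusion x of (u, v, h) \<Rightarrow>
      (of_real (sqrt ((1 - h) / 2)) * u, (1 / (2 * sqrt ((1 - h) / 2))) *\<^sub>R v)) = x"
    using x(2) unfolding x(1) standard_inclusion_def prod.case
    by (simp only:) (simp add: sgn_div_norm scaleR_conv_of_real)
qed

lemma new_torus_image:
  "new_torus ` (open_disc \<times> circle) = circle \<times> sphere 0 1 \<inter> {p. snd (snd p) > 0}"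
proof (intro equalityI subsetI)
  fix p assume "p \<in> new_torus ` (open_disc \<times> circle)"
  then obtain c b where p: "p = new_torus (c, b)" "cmod c < 1" "cmod b = 1"
    by (auto simp: mem_circle mem_open_disc)
  define s where "s = (cmod c)\<^sup>2"
  have s: "0 \<le> s" "s < 1" using p(2) by (auto simp: s_def power_less_one_iff abs_square_less_1)
  have "(2 / (1 + s))\<^sup>2 * s + ((1 - s) / (1 + s))\<^sup>2 = (4 * s + (1 - s)\<^sup>2) / (1 + s)\<^sup>2"
    by (simp add: power_divide add_divide_distrib)
  also have "4 * s + (1 - s)\<^sup>2 = (1 + s)\<^sup>2" by (simp add: power2_eq_square algebra_simps)
  finally have "(2 / (1 + s))\<^sup>2 * s + ((1 - s) / (1 + s))\<^sup>2 = 1" using s by simp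
  then show "p \<in> circle \<times> sphere 0 1 \<inter> {p. snd (snd p) > 0}"
    using s p by (simp add: new_torus_def norm_Pair mem_circle power_mult_distrib flip: s_def)
      (simp add: s_def power_divide power_mult_distrib)
next
  fix p assume "p \<in> circle \<times> sphere 0 1 \<inter> {p :: complex \<times> complex \<times> real. snd (snd p) > 0}"
  then obtain u v h where p: "p = (u, v, h)" "cmod u = 1" "(cmod v)\<^sup>2 + h\<^sup>2 = 1" "h > 0"
    by (cases p) (auto simp: mem_circle norm_Pair)
  define c where "c = (1 / (1 + h)) *\<^sub>R v"
  have v2: "(cmod v)\<^sup>2 = (1 - h) * (1 + h)" using p(3) by (simp add: power2_eq_square algebra_simps)
  have "(cmod c)\<^sup>2 = (cmod v)\<^sup>2 / (1 + h)\<^sup>2" using p(4) by (simp add: c_def power_divide)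
  also have "\<dots> = (1 - h) / (1 + h)" unfolding v2 using p(4) by (simp add: power2_eq_square)
  finally have c: "(cmod c)\<^sup>2 = (1 - h) / (1 + h)" .
  then have "(cmod c)\<^sup>2 < 1" using p(4) by simp
  then have "cmod c < 1" by (simp add: abs_square_less_1)
  moreover have "new_torus (c, u) = p"
  proof -
    have e: "1 + (cmod c)\<^sup>2 = 2 / (1 + h)" unfolding c using p(4) by (simp add: field_simps)
    have e2: "1 - (cmod c)\<^sup>2 = 2 * h / (1 + h)" unfolding c using p(4) by (simp add: field_simps)
    show ?thesis using p(4) unfolding new_torus_def by (simp add: e e2 p(1)) (simp add: c_def)
  qed
  ultimately show "p \<in> new_torus ` (open_disc \<times> circle)"
    using p(2) by (force simp: mem_circle mem_open_disc)
qed

lemma new_torus_open_embedding: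
  "open_embedding (top_of_set (open_disc \<times> circle)) S1xS2 new_torus"
  unfolding S1xS2_def
proof (rule open_embedding_top_of_set[OF _ new_torus_image,
      where h = "\<lambda>(u, v, h). ((1 / (1 + h)) *\<^sub>R v, u)"])
  have ne: "1 + (cmod t)\<^sup>2 \<noteq> 0" for t using one_plus_pos[of t] by simp
  show "continuous_on (open_disc \<times> circle) new_torus"
    unfolding new_torus_def case_prod_unfold by (intro continuous_intros) (auto simp: ne)
  show "openin (top_of_set (circle \<times> sphere 0 1))
     (circle \<times> sphere 0 1 \<inter> {p :: complex \<times> complex \<times> real. snd (snd p) > 0})"
    by (intro openin_open_Int open_Collect_less continuous_intros)
  show "continuous_on (circle \<times> sphere 0 1 \<inter> {p :: complex \<times> complex \<times> real. snd (snd p) > 0})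
     (\<lambda>(u, v, h). ((1 / (1 + h)) *\<^sub>R v, u))"
    unfolding case_prod_unfold by (intro continuous_intros) auto
  fix x assume "x \<in> open_disc \<times> circle"
  obtain c b where x: "x = (c, b)" by (cases x)
  have "1 + (1 - (cmod c)\<^sup>2) / (1 + (cmod c)\<^sup>2) = 2 / (1 + (cmod c)\<^sup>2)"
    using ne[of c] by (simp add: field_simps)
  then show "(case new_torus x of (u, v, h) \<Rightarrow> ((1 / (1 + h)) *\<^sub>R v, u)) = x"
    using ne[of c] by (simp add: x new_torus_def)
qed

proposition zero_surgery_S1xS2: "zero_surgery braid_axis S1xS2 standard_inclusion"
proof -
  have cover: "topspace S1xS2 =
      standard_inclusion ` (S3 - braid_axis) \<union> new_torus ` (open_disc \<times> circle)"
    by (auto simp: S1xS2_def standard_inclusion_image new_torus_image)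
  have core: "new_torus (0, b) \<notin> standard_inclusion ` (S3 - braid_axis)" for b
    by (simp add: standard_inclusion_image new_torus_def)
  have glue: "new_torus (of_real r * a, b) = standard_inclusion (axis_framing (a, of_real r * b))"
    if "cmod a = 1" "cmod b = 1" "0 < r" for a b r
  proof -
    define k where "k = 1 / sqrt (1 + r\<^sup>2)"
    have k: "k > 0" by (simp add: k_def add_pos_nonneg)
    have k2: "k\<^sup>2 = 1 / (1 + r\<^sup>2)" by (simp add: k_def power_divide)
    have F: "axis_framing (a, of_real r * b) = (of_real (k * r) * b, of_real k * a)"
      using that by (simp add: axis_framing_def norm_mult k_def scaleR_conv_of_real)
    have n: "cmod (of_real (k * r) * b) = k * r" "cmod (of_real k * a) = k"
      using that k by (simp_all add: norm_mult)
    have 1: "sgn (of_real (k * r) * b) = b"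
      using that k unfolding sgn_div_norm n(1) by (simp add: scaleR_conv_of_real field_simps)
    have 2: "2 * of_real (k * r) * (of_real k * a) = (2 / (1 + r\<^sup>2)) *\<^sub>R (of_real r * a)"
    proof -
      have "2 * of_real (k * r) * (of_real k * a) = of_real (2 * k\<^sup>2 * r) * a"
        by (simp add: power2_eq_square)
      then show ?thesis unfolding k2 by (simp add: scaleR_conv_of_real)
    qed
    have 3: "k\<^sup>2 - (k * r)\<^sup>2 = (1 - r\<^sup>2) / (1 + r\<^sup>2)"
      by (simp add: power_mult_distrib k2 diff_divide_distrib)
    have "standard_inclusion (axis_framing (a, of_real r * b)) =
        (b, (2 / (1 + r\<^sup>2)) *\<^sub>R (of_real r * a), (1 - r\<^sup>2) / (1 + r\<^sup>2))"
      unfolding F standard_inclusion_def prod.case n 1 2 3 ..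
    then show ?thesis using that by (simp add: new_torus_def norm_mult)
  qed
  show ?thesis
    unfolding zero_surgery_def
    using standard_inclusion_open_embedding zero_framing_axis new_torus_open_embedding cover core glue
    by (intro conjI exI[of _ axis_framing] exI[of _ new_torus]) (auto simp: mem_circle)
qed

end

theory Submission
  imports Defs "HOL-Number_Theory.Cong"
begin

text \<open>
  The knots are told apart by linking numbers of their lifts to a cyclic cover. Let \<open>M\<close> be
  \<open>S\<^sup>1 \<times> S\<^sup>2\<close>, obtained from the solid torus \<open>S\<^sup>1 \<times> \<complex>\<close> around which the braids are closed by gluing in
  a second solid torus. In the infinite cyclic cover \<open>X\<close> of \<open>M\<close>, a closed braid on \<open>k\<close> strands unrolls
  into \<open>k\<close> disjoint lines, the graphs of functions \<open>z\<^sub>a : \<real> \<rightarrow> \<complex>\<close>, which have a common period because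
  some power of the braid is pure. Over this period the difference \<open>z\<^sub>a - z\<^sub>b\<close> makes half as many turns as there are
  crossings \<open>w(a,b)\<close> between the two strands. An isotopy in \<open>M\<close> may pull a strand across the core of
  the second solid torus, which changes single numbers \<open>w(a,b)\<close>, but whether
  \<open>w(c,a) - w(c,b) - w(d,a) + w(d,b)\<close> is zero does not change: up to a factor this is the linking number
  of the null-homologous links \<open>z\<^sub>a - z\<^sub>b\<close> and \<open>z\<^sub>c - z\<^sub>d\<close> in a finite cyclic cover.

  For \<open>B\<^sub>p\<^sub>,\<^sub>q\<close> any two strands cross \<open>2q\<close> times in \<open>p\<close> turns, so all these combinations vanish
  (\<open>B_crossings\<close>). For \<open>A\<^sub>m\<^sub>,\<^sub>n\<close> strands at neighbouring positions cross twice in \<open>m + n\<close> turns, and strands at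
  distance two cross four times (\<open>A_crossings_1\<close>, \<open>A_crossings_2\<close>). For the four strands at
  positions \<open>a, b, c, d = 1, 4, 2, 3\<close> the combination is \<open>2 - 4 - 4 + 2\<close>.

  Invariance is proved with continuous logarithms in place of homology. The final map of an isotopy is
  homotopic to the identity, hence lifts to a homeomorphism \<open>\<Theta>\<close> of \<open>X\<close>, and it carries lines to lines
  (\<open>homeo_matches_graphs\<close>); counting them gives \<open>p = m + n\<close>. On the complement of the lines \<open>z\<^sub>a\<close> and
  \<open>z\<^sub>b\<close>, every nonvanishing function is the exponential of a continuous function times a power of
  \<open>(x - z\<^sub>a) / (x - z\<^sub>b)\<close> (\<open>map_on_complement_is_ratio_power\<close>). This applies to the function of the same form for
  the image lines, composed with \<open>\<Theta>\<close>. Comparing the changes of its logarithm along \<open>z\<^sub>c\<close> and along \<open>z\<^sub>d\<close>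
  gives the invariance (\<open>homeo_preserves_linking_difference\<close>).

  The surgery is only known through its gluing data, with an arbitrary framed neighbourhood of
  the axis. Two facts are extracted from these data: the longitude of the axis does not wind in the
  \<open>S\<^sup>1\<close>-direction of the first solid torus, by a direct argument with singular chains
  (\<open>null_homologous_has_log\<close>), so that the angle can be adjusted to extend over the second solid torus
  (\<open>theta_exists\<close>); and the longitude bounds a disc there while it winds around
  all the strands (\<open>zero_surgery_is_torus_filling\<close>).
\<close>

section \<open>Continuous logarithms\<close>

text \<open>
  Two maps into the punctured plane are homotopic iff their quotient has a continuous logarithm. The
  first cohomology of a space is thus handled through the predicate below.
\<close>

definition has_log :: "'a::topological_space set \<Rightarrow> ('a \<Rightarrow> complex) \<Rightarrow> bool" where
  "has_log S E \<longleftrightarrow> (\<exists>h. continuous_on S h \<and> (\<forall>x\<in>S. E x = exp (h x)))"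

lemma has_logI: "continuous_on S h \<Longrightarrow> (\<And>x. x \<in> S \<Longrightarrow> E x = exp (h x)) \<Longrightarrow> has_log S E"
  unfolding has_log_def by blast

lemma has_logE:
  assumes "has_log S E"
  obtains h where "continuous_on S h" "\<And>x. x \<in> S \<Longrightarrow> E x = exp (h x)"
  using assms unfolding has_log_def by blast

lemma has_log_subset: "has_log S E \<Longrightarrow> T \<subseteq> S \<Longrightarrow> has_log T E"
  unfolding has_log_def by (meson continuous_on_subset subsetD)

lemma has_log_cong: "(\<And>x. x \<in> S \<Longrightarrow> E x = E' x) \<Longrightarrow> has_log S E = has_log S E'"
  unfolding has_log_def by (metis (no_types, lifting))

lemma has_log_mult:
  assumes "has_log S E" "has_log S E'" shows "has_log S (\<lambda>x. E x * E' x)"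
proof -
  obtain h where h: "continuous_on S h" "\<And>x. x \<in> S \<Longrightarrow> E x = exp (h x)"
    using assms(1) unfolding has_log_def by blast
  obtain h' where h': "continuous_on S h'" "\<And>x. x \<in> S \<Longrightarrow> E' x = exp (h' x)"
    using assms(2) unfolding has_log_def by blast
  show ?thesis
    by (rule has_logI[of _ "\<lambda>x. h x + h' x"]) (auto intro!: continuous_intros h h' simp: h h' exp_add)
qed

lemma has_log_powi:
  assumes "has_log S E" shows "has_log S (\<lambda>x. E x powi a)"
proof -
  obtain h where h: "continuous_on S h" "\<And>x. x \<in> S \<Longrightarrow> E x = exp (h x)"
    using assms(1) unfolding has_log_def by blast
  show ?thesis
    by (rule has_logI[of _ "\<lambda>x. of_int a * h x"]) (auto intro!: continuous_intros h simp: h exp_power_int)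
qed

lemma has_log_inverse: "has_log S E \<Longrightarrow> has_log S (\<lambda>x. inverse (E x))"
  using has_log_powi[of S E "-1"] by (simp add: power_int_minus)

lemma has_log_divide: "has_log S E \<Longrightarrow> has_log S E' \<Longrightarrow> has_log S (\<lambda>x. E x / E' x)"
  using has_log_mult[OF _ has_log_inverse] by (simp add: divide_inverse)

lemma has_log_compose:
  assumes "has_log S E" "continuous_on T f" "\<And>x. x \<in> T \<Longrightarrow> f x \<in> S"
  shows "has_log T (\<lambda>x. E (f x))"
proof -
  obtain h where h: "continuous_on S h" "\<And>x. x \<in> S \<Longrightarrow> E x = exp (h x)"
    using assms(1) unfolding has_log_def by blast
  show ?thesis
  proof (rule has_logI[of _ "\<lambda>x. h (f x)"])
    show "continuous_on T (\<lambda>x. h (f x))"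
      using continuous_on_compose2[OF h(1) assms(2)] assms(3) by blast
  qed (use h assms in auto)
qed

lemma has_log_const: "c \<noteq> 0 \<Longrightarrow> has_log S (\<lambda>_. c)"
  by (rule has_logI[of _ "\<lambda>_. Ln c"]) auto

lemma has_log_slit_plane:
  assumes "continuous_on S E" "\<And>x. x \<in> S \<Longrightarrow> E x \<notin> \<real>\<^sub>\<le>\<^sub>0"
  shows "has_log S E"
proof (rule has_logI[of _ "\<lambda>x. Ln (E x)"])
  show "E x = exp (Ln (E x))" if "x \<in> S" for x
    using assms(2)[OF that] by (metis exp_Ln nonpos_Reals_zero_I)
qed (use assms in \<open>auto intro!: continuous_intros\<close>)

lemma has_log_near_one:
  assumes "continuous_on S E" "\<And>x. x \<in> S \<Longrightarrow> cmod (E x - 1) < 1"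
  shows "has_log S E"
proof (rule has_log_slit_plane[OF assms(1)])
  fix x assume "x \<in> S"
  have "\<bar>Re (E x - 1)\<bar> < 1"
    using assms(2)[OF \<open>x \<in> S\<close>] abs_Re_le_cmod[of "E x - 1"] by linarith
  then show "E x \<notin> \<real>\<^sub>\<le>\<^sub>0" by (auto simp: complex_nonpos_Reals_iff)
qed

lemma has_log_contractible:
  fixes E :: "'a::real_normed_vector \<Rightarrow> complex"
  assumes "continuous_on S E" "contractible S" "\<And>x. x \<in> S \<Longrightarrow> E x \<noteq> 0"
  shows "has_log S E"
  using continuous_logarithm_on_contractible[OF assms] by (metis has_log_def)

text \<open>
  The difference of two logarithms takes values in a discrete set, so it is constant on a connected
  set. All winding numbers in this file are obtained by comparing logarithms in this way.
\<close>

lemma logs_differ_by_period: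
  fixes h h' :: "'a::topological_space \<Rightarrow> complex"
  assumes "connected S" "continuous_on S h" "continuous_on S h'"
    and eq: "\<And>x. x \<in> S \<Longrightarrow> exp (h x) = exp (h' x)"
  obtains n :: int where "\<And>x. x \<in> S \<Longrightarrow> h x = h' x + 2 * pi * \<i> * n"
proof (cases "S = {}")
  case True then show ?thesis using that by simp
next
  case False
  have ex: "\<exists>n::int. h x - h' x = 2 * pi * \<i> * n" if xS: "x \<in> S" for x
  proof -
    obtain n :: int where "h x = h' x + (of_int (2 * n) * pi) * \<i>"
      using eq[OF xS] exp_eq[of "h x" "h' x"] by blast
    then show ?thesis by (intro exI[of _ n]) (simp add: algebra_simps)
  qed
  have "(\<lambda>x. h x - h' x) constant_on S"
  proof (rule continuous_discrete_range_constant[OF assms(1)])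
    show "continuous_on S (\<lambda>x. h x - h' x)" by (intro continuous_intros assms)
    fix x assume x: "x \<in> S"
    show "\<exists>e>0. \<forall>y. y \<in> S \<and> h y - h' y \<noteq> h x - h' x \<longrightarrow> e \<le> norm (h y - h' y - (h x - h' x))"
    proof (intro exI[of _ 1] conjI allI impI)
      fix y assume y: "y \<in> S \<and> h y - h' y \<noteq> h x - h' x"
      obtain n n' :: int where n: "h x - h' x = 2 * pi * \<i> * n" "h y - h' y = 2 * pi * \<i> * n'"
        using ex x y by metis
      then have "n' \<noteq> n" using y by auto
      then have 1: "\<bar>real_of_int (n' - n)\<bar> \<ge> 1" by linarith
      have "h y - h' y - (h x - h' x) = 2 * pi * \<i> * of_int (n' - n)"
        unfolding n by (simp add: algebra_simps)
      then have "norm (h y - h' y - (h x - h' x)) = 2 * pi * \<bar>real_of_int (n' - n)\<bar>"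
        by (simp add: norm_mult del: of_int_diff)
      also have "\<dots> \<ge> 1 * 1" by (rule mult_mono[OF _ 1]) (use pi_gt3 in auto)
      finally show "1 \<le> norm (h y - h' y - (h x - h' x))" by simp
    qed simp
  qed
  then obtain c where c: "\<And>x. x \<in> S \<Longrightarrow> h x - h' x = c" unfolding constant_on_def by blast
  from False obtain x0 where x0: "x0 \<in> S" by blast
  obtain n :: int where n: "h x0 - h' x0 = 2 * pi * \<i> * n" using ex[OF x0] by blast
  have "h x = h' x + 2 * pi * \<i> * n" if "x \<in> S" for x
    using c[OF that] c[OF x0] n by (simp add: algebra_simps)
  then show ?thesis by (rule that)
qed

lemma exp_2pi_int [simp]: "exp (2 * complex_of_real pi * \<i> * of_int n) = 1"
  using exp_integer_2pi[of "of_int n"] by (simp add: mult_ac)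

text \<open>
  This is the Mayer--Vietoris step: connectedness of the intersection makes the two logarithms
  differ by one constant, which can be subtracted.
\<close>

lemma has_log_Un:
  assumes op: "openin (top_of_set (S \<union> T)) S" "openin (top_of_set (S \<union> T)) T"
    and con: "connected (S \<inter> T)" and "has_log S E" "has_log T E"
  shows "has_log (S \<union> T) E"
proof -
  obtain h where h: "continuous_on S h" "\<And>x. x \<in> S \<Longrightarrow> E x = exp (h x)"
    using assms(4) unfolding has_log_def by blast
  obtain h' where h': "continuous_on T h'" "\<And>x. x \<in> T \<Longrightarrow> E x = exp (h' x)"
    using assms(5) unfolding has_log_def by blast
  obtain n :: int where n: "\<And>x. x \<in> S \<inter> T \<Longrightarrow> h x = h' x + 2 * pi * \<i> * n"
    by (rule logs_differ_by_period[OF con, of h h'])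
      (use h h' in \<open>auto intro: continuous_on_subset simp flip: h(2) h'(2)\<close>)
  show ?thesis
  proof (rule has_logI[of _ "\<lambda>x. if x \<in> S then h x else h' x + 2 * pi * \<i> * n"])
    show "continuous_on (S \<union> T) (\<lambda>x. if x \<in> S then h x else h' x + 2 * pi * \<i> * n)"
      by (rule continuous_on_cases_local_open) (use op h h' n in \<open>auto intro!: continuous_intros\<close>)
    show "E x = exp (if x \<in> S then h x else h' x + 2 * pi * \<i> * n)" if "x \<in> S \<union> T" for x
      using that h h' by (auto simp: exp_add)
  qed
qed

text \<open>
  The exponential map is a quotient map onto the punctured plane. It is inverted by \<open>Ln\<close> off the
  negative axis and by \<open>Ln (- x) + pi * \<i>\<close> off the positive axis, and periodicity makes the two
  resulting formulas agree. The parameter \<open>y\<close> is carried along.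
\<close>

lemma continuous_periodic_descends:
  fixes l :: "'a::real_normed_vector \<times> complex \<Rightarrow> 'b::topological_space"
  assumes con: "continuous_on {(y, \<zeta>). (y, exp \<zeta>) \<in> Q} l"
    and nz: "\<And>y x. (y, x) \<in> Q \<Longrightarrow> x \<noteq> 0"
    and per: "\<And>y \<zeta>. (y, exp \<zeta>) \<in> Q \<Longrightarrow> l (y, \<zeta> + 2 * pi * \<i>) = l (y, \<zeta>)"
  obtains h where "continuous_on Q h" "\<And>y \<zeta>. (y, exp \<zeta>) \<in> Q \<Longrightarrow> h (y, exp \<zeta>) = l (y, \<zeta>)"
proof -
  have shift: "exp (\<zeta> + 2 * pi * \<i> * of_nat n) = exp \<zeta>" for \<zeta> and n :: nat
    using exp_2pi_int[of "int n"] by (simp add: exp_add del: exp_2pi_int)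
  have pern: "l (y, \<zeta> + 2 * pi * \<i> * of_nat n) = l (y, \<zeta>)" if Q: "(y, exp \<zeta>) \<in> Q" for y \<zeta> and n :: nat
  proof (induction n)
    case (Suc n)
    have "l (y, \<zeta> + 2 * pi * \<i> * of_nat (Suc n)) = l (y, (\<zeta> + 2 * pi * \<i> * of_nat n) + 2 * pi * \<i>)"
      by (simp add: algebra_simps)
    also have "\<dots> = l (y, \<zeta> + 2 * pi * \<i> * of_nat n)"
      by (rule per) (simp only: shift Q)
    finally show ?case using Suc by simp
  qed simp
  have eq: "l (y, \<zeta>) = l (y, \<zeta>')" if Q: "(y, exp \<zeta>) \<in> Q" and e: "exp \<zeta> = exp \<zeta>'" for y \<zeta> \<zeta>'
  proof -
    obtain n :: int where n: "\<zeta> = \<zeta>' + (of_int (2 * n) * pi) * \<i>" using e exp_eq by blast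
    show ?thesis
    proof (cases "n \<ge> 0")
      case True
      then have "\<zeta> = \<zeta>' + 2 * pi * \<i> * of_nat (nat n)" using n by (simp add: algebra_simps)
      then show ?thesis using pern Q e by metis
    next
      case False
      then have "\<zeta>' = \<zeta> + 2 * pi * \<i> * of_nat (nat (- n))" using n by (simp add: algebra_simps)
      then show ?thesis using pern Q e by metis
    qed
  qed
  define h where "h = (\<lambda>(y, x). l (y, Ln x))"
  have h: "h (y, exp \<zeta>) = l (y, \<zeta>)" if "(y, exp \<zeta>) \<in> Q" for y \<zeta>
    unfolding h_def prod.case by (rule eq) (use that in auto)
  let ?Q1 = "Q \<inter> {p. snd p \<notin> \<real>\<^sub>\<le>\<^sub>0}" and ?Q2 = "Q \<inter> {p. - snd p \<notin> \<real>\<^sub>\<le>\<^sub>0}"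
  have o1: "open {p::'a \<times> complex. snd p \<notin> \<real>\<^sub>\<le>\<^sub>0}"
  proof -
    have "{p::'a \<times> complex. snd p \<notin> \<real>\<^sub>\<le>\<^sub>0} = snd -` (- \<real>\<^sub>\<le>\<^sub>0)" by auto
    then show ?thesis by (auto intro!: open_vimage continuous_intros simp: open_Compl)
  qed
  have o2: "open {p::'a \<times> complex. - snd p \<notin> \<real>\<^sub>\<le>\<^sub>0}"
  proof -
    have "{p::'a \<times> complex. - snd p \<notin> \<real>\<^sub>\<le>\<^sub>0} = (\<lambda>p. - snd p) -` (- \<real>\<^sub>\<le>\<^sub>0)" by auto
    then show ?thesis by (auto intro!: open_vimage continuous_intros simp: open_Compl)
  qed
  have Q: "Q = ?Q1 \<union> ?Q2" using nz by (auto simp: complex_nonpos_Reals_iff complex_eq_iff)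
  have c1: "continuous_on ?Q1 h"
  proof (rule continuous_on_eq)
    show "continuous_on ?Q1 (\<lambda>p. l (fst p, Ln (snd p)))"
      by (rule continuous_on_compose2[OF con]) (auto intro!: continuous_intros simp: nz)
  qed (auto simp: h_def)
  have c2: "continuous_on ?Q2 h"
  proof (rule continuous_on_eq)
    have ex: "exp (Ln (- x) + pi * \<i>) = x" if "(y, x) \<in> Q" for y x
      using nz[OF that] by (simp add: exp_add)
    show "continuous_on ?Q2 (\<lambda>p. l (fst p, Ln (- snd p) + pi * \<i>))"
      by (rule continuous_on_compose2[OF con]) (auto intro!: continuous_intros simp: ex)
    fix p assume "p \<in> ?Q2"
    then show "l (fst p, Ln (- snd p) + complex_of_real pi * \<i>) = h p"
      using ex h by (cases p) (metis (no_types, lifting) Int_iff fst_conv snd_conv)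
  qed
  have "continuous_on (?Q1 \<union> ?Q2) h"
  proof (rule continuous_on_Un_local_open[OF _ _ c1 c2])
    show "openin (top_of_set (?Q1 \<union> ?Q2)) ?Q1" "openin (top_of_set (?Q1 \<union> ?Q2)) ?Q2"
      using Q o1 o2 by (metis openin_open_Int)+
  qed
  then show ?thesis using that h Q by metis
qed

text \<open>
  After pulling back along the exponential map, \<open>G\<close> has a logarithm because the domain is convex.
  Translation by the period changes it by a constant, the winding number of \<open>G\<close> around the puncture;
  dividing by the corresponding power of the coordinate makes the logarithm periodic.
\<close>

proposition punctured_map_is_power:
  fixes G :: "'a::real_normed_vector \<times> complex \<Rightarrow> complex"
  assumes con: "continuous_on Q G" and nz: "\<And>p. p \<in> Q \<Longrightarrow> G p \<noteq> 0 \<and> snd p \<noteq> 0"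
    and cx: "convex {(y, \<zeta>). (y, exp \<zeta>) \<in> Q}"
  obtains a :: int where "has_log Q (\<lambda>p. G p * snd p powi a)"
proof -
  let ?P = "{(y, \<zeta>). (y, exp \<zeta>) \<in> Q}"
  have c: "continuous_on ?P (\<lambda>p. G (fst p, exp (snd p)))"
    by (rule continuous_on_compose2[OF con]) (auto intro!: continuous_intros)
  obtain l where l: "continuous_on ?P l" "\<And>p. p \<in> ?P \<Longrightarrow> G (fst p, exp (snd p)) = exp (l p)"
    using has_log_contractible[OF c convex_imp_contractible[OF cx]] nz by (force elim: has_logE)
  have c': "continuous_on ?P (\<lambda>p. l (fst p, snd p + 2 * pi * \<i>))"
    by (rule continuous_on_compose2[OF l(1)]) (auto intro!: continuous_intros simp: exp_add)
  obtain n :: int where n: "\<And>p. p \<in> ?P \<Longrightarrow> l (fst p, snd p + 2 * pi * \<i>) = l p + 2 * pi * \<i> * n"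
  proof (rule logs_differ_by_period[OF convex_connected[OF cx] c' l(1)])
    fix p assume p: "p \<in> ?P"
    then have p': "(fst p, snd p + 2 * pi * \<i>) \<in> ?P" by (auto simp: exp_add)
    show "exp (l (fst p, snd p + 2 * pi * \<i>)) = exp (l p)"
      using l(2)[OF p'] l(2)[OF p] by (simp add: exp_add)
  qed (use that in blast)
  have cl': "continuous_on ?P (\<lambda>p. l p - of_int n * snd p)"
    by (intro continuous_intros l)
  obtain h where h: "continuous_on Q h"
      "\<And>y \<zeta>. (y, exp \<zeta>) \<in> Q \<Longrightarrow> h (y, exp \<zeta>) = l (y, \<zeta>) - of_int n * \<zeta>"
  proof (rule continuous_periodic_descends[OF cl'])
    show "l (y, \<zeta> + 2 * pi * \<i>) - of_int n * snd (y, \<zeta> + 2 * pi * \<i>) = l (y, \<zeta>) - of_int n * snd (y, \<zeta>)"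
      if "(y, exp \<zeta>) \<in> Q" for y \<zeta>
      using n[of "(y, \<zeta>)"] that by (simp add: algebra_simps)
  qed (use nz in force)+
  have "has_log Q (\<lambda>p. G p * snd p powi (- n))"
  proof (rule has_logI[OF h(1)])
    fix p assume p: "p \<in> Q"
    obtain y x where yx: "p = (y, x)" by (cases p)
    have x: "x \<noteq> 0" using nz p yx by force
    then obtain \<zeta> where z: "x = exp \<zeta>" by (metis exp_Ln)
    have "G p = exp (l (y, \<zeta>))" using l(2)[of "(y, \<zeta>)"] p yx z by simp
    moreover have "exp (h p) = exp (l (y, \<zeta>)) / exp (of_int n * \<zeta>)"
      using h(2)[of y \<zeta>] p yx z by (simp add: exp_diff)
    ultimately show "G p * snd p powi (- n) = exp (h p)"
      by (simp add: yx z power_int_minus exp_power_int divide_inverse)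
  qed
  then show ?thesis by (rule that)
qed

section \<open>Nonvanishing functions on the thrice-punctured sphere\<close>

lemma slit_sector_connected:
  assumes "convex I"
  shows "connected {y :: complex. - y \<notin> \<real>\<^sub>\<le>\<^sub>0 \<and> ln (cmod y) \<in> I}"
proof -
  have "{y :: complex. - y \<notin> \<real>\<^sub>\<le>\<^sub>0 \<and> ln (cmod y) \<in> I}
      = (\<lambda>\<zeta>. - exp \<zeta>) ` {\<zeta>. Re \<zeta> \<in> I \<and> - pi < Im \<zeta> \<and> Im \<zeta> < pi}"
  proof (intro equalityI subsetI)
    fix y :: complex assume y: "y \<in> {y. - y \<notin> \<real>\<^sub>\<le>\<^sub>0 \<and> ln (cmod y) \<in> I}"
    then have "y \<noteq> 0" by auto
    then have "y = - exp (Ln (- y))" "Re (Ln (- y)) = ln (cmod y)" by auto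
    moreover have "- pi < Im (Ln (- y))" "Im (Ln (- y)) < pi"
      using y \<open>y \<noteq> 0\<close> Im_Ln_less_pi[of "- y"] mpi_less_Im_Ln[of "- y"] by auto
    ultimately show "y \<in> (\<lambda>\<zeta>. - exp \<zeta>) ` {\<zeta>. Re \<zeta> \<in> I \<and> - pi < Im \<zeta> \<and> Im \<zeta> < pi}"
      using y by (intro image_eqI[of _ _ "Ln (- y)"]) auto
  next
    fix y assume "y \<in> (\<lambda>\<zeta>. - exp \<zeta>) ` {\<zeta>. Re \<zeta> \<in> I \<and> - pi < Im \<zeta> \<and> Im \<zeta> < pi}"
    then obtain \<zeta> where z: "y = - exp \<zeta>" "Re \<zeta> \<in> I" "- pi < Im \<zeta>" "Im \<zeta> < pi" by auto
    then have "Ln (- y) = \<zeta>" by simp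
    then have "- y \<notin> \<real>\<^sub>\<le>\<^sub>0"
    proof -
      have ne: "- y \<noteq> 0" using z by simp
      have "Im (Ln (- y)) \<noteq> pi" using z by simp
      then have "\<not> (Re (- y) < 0 \<and> Im (- y) = 0)" using Im_Ln_eq_pi[OF ne] by simp
      then show ?thesis using ne by (simp only: complex_nonpos_Reals_iff complex_eq_iff) auto
    qed
    then show "y \<in> {y. - y \<notin> \<real>\<^sub>\<le>\<^sub>0 \<and> ln (cmod y) \<in> I}" using z by simp
  qed
  moreover have "convex {\<zeta>. Re \<zeta> \<in> I \<and> - pi < Im \<zeta> \<and> Im \<zeta> < pi}"
  proof -
    have "{\<zeta>. Re \<zeta> \<in> I \<and> - pi < Im \<zeta> \<and> Im \<zeta> < pi} = Re -` I \<inter> {\<zeta>. Im \<zeta> > - pi} \<inter> {\<zeta>. Im \<zeta> < pi}"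
      by auto
    then show ?thesis
      using assms by (auto intro!: convex_Int convex_linear_vimage convex_halfspace_Im_lt
          convex_halfspace_Im_gt bounded_linear.linear bounded_linear_Re)
  qed
  ultimately show ?thesis
    by (simp only:) (intro connected_continuous_image continuous_intros convex_connected)
qed

text \<open>
  The first cohomology of a sphere with three punctures is generated by \<open>y\<close> and \<open>y - 1\<close>. The unit
  circle without \<open>1\<close> separates the region inside, which is a punctured disc around \<open>0\<close>, from the region
  outside, a punctured disc around \<open>\<infinity>\<close>. The two exponents are chosen so that the quotient has a
  logarithm on both regions; the plane slit along the positive axis is contractible and joins them.
\<close>

proposition thrice_punctured_map_is_product_of_powers:
  fixes G :: "real \<times> complex \<Rightarrow> complex"
  assumes con: "continuous_on (UNIV \<times> - {0, 1}) G" and nz: "\<And>p. p \<in> UNIV \<times> - {0, 1} \<Longrightarrow> G p \<noteq> 0"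
  obtains a c :: int where
    "has_log (UNIV \<times> - {0, 1}) (\<lambda>p. G p * snd p powi a * (snd p - 1) powi c)"
proof -
  define Q1 Q2 Q3 :: "(real \<times> complex) set"
    where "Q1 = {p. snd p \<noteq> 0 \<and> cmod (snd p) < 1}"
      and "Q2 = {p. - snd p \<notin> \<real>\<^sub>\<le>\<^sub>0}"
      and "Q3 = {p. cmod (snd p) > 1}"
  have sub: "Q1 \<subseteq> UNIV \<times> - {0, 1}" "Q2 \<subseteq> UNIV \<times> - {0, 1}" "Q3 \<subseteq> UNIV \<times> - {0, 1}"
    by (auto simp: Q1_def Q2_def Q3_def complex_nonpos_Reals_iff)
  have nz': "G p \<noteq> 0 \<and> snd p \<noteq> 0 \<and> snd p - 1 \<noteq> 0" if "p \<in> UNIV \<times> - {0, 1}" for p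
    using nz[OF that] that by auto
  obtain a :: int where a: "has_log Q1 (\<lambda>p. G p * snd p powi a)"
  proof (rule punctured_map_is_power[of Q1 G])
    have "{(y, \<zeta>). (y, exp \<zeta>) \<in> Q1} = UNIV \<times> {\<zeta>. Re \<zeta> < 0}" by (auto simp: Q1_def)
    then show "convex {(y, \<zeta>). (y, exp \<zeta>) \<in> Q1}" by (simp add: convex_Times convex_halfspace_Re_lt)
  qed (use con sub nz' continuous_on_subset in blast)+
  obtain a' :: int where a': "has_log Q3 (\<lambda>p. G p * snd p powi a')"
  proof (rule punctured_map_is_power[of Q3 G])
    have "{(y, \<zeta>). (y, exp \<zeta>) \<in> Q3} = UNIV \<times> {\<zeta>. Re \<zeta> > 0}" by (auto simp: Q3_def)
    then show "convex {(y, \<zeta>). (y, exp \<zeta>) \<in> Q3}" by (simp add: convex_Times convex_halfspace_Re_gt)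
  qed (use con sub nz' continuous_on_subset in blast)+
  define c where "c = a' - a"
  define E where "E = (\<lambda>p. G p * snd p powi a * (snd p - 1) powi c)"
  have E1: "has_log Q1 E"
  proof -
    have "has_log Q1 (\<lambda>p. (-1) * (1 - snd p))"
      by (intro has_log_mult has_log_const has_log_near_one continuous_intros) (auto simp: Q1_def)
    then have "has_log Q1 (\<lambda>p. snd p - 1)" by simp
    then show ?thesis unfolding E_def by (intro has_log_mult[OF a] has_log_powi)
  qed
  \<comment> \<open>Outside the unit circle \<open>y - 1\<close> behaves like \<open>y\<close>, so the total exponent there is \<open>a + c = a'\<close>.\<close>
  have E3: "has_log Q3 E"
  proof -
    have "has_log Q3 (\<lambda>p. 1 - inverse (snd p))"
      by (rule has_log_near_one)
        (auto simp: Q3_def norm_inverse inverse_less_1_iff intro!: continuous_intros)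
    then have "has_log Q3 (\<lambda>p. (G p * snd p powi a') * (1 - inverse (snd p)) powi c)"
      by (intro has_log_mult[OF a'] has_log_powi)
    moreover have "(G p * snd p powi a') * (1 - inverse (snd p)) powi c = E p" if "p \<in> Q3" for p
    proof -
      have y: "snd p \<noteq> 0" using that by (auto simp: Q3_def)
      then have "1 - inverse (snd p) = (snd p - 1) / snd p" by (simp add: field_simps)
      moreover have "snd p powi a' = snd p powi a * snd p powi c"
        using y by (simp add: c_def flip: power_int_add)
      ultimately show ?thesis using y by (simp add: E_def power_int_divide_distrib)
    qed
    ultimately show ?thesis by (simp cong: has_log_cong)
  qed
  have cE: "continuous_on (UNIV \<times> - {0, 1}) E"
    unfolding E_def by (intro continuous_intros con) auto
  have E2: "has_log Q2 E"
  proof -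
    let ?S = "(UNIV :: real set) \<times> (- \<real>\<^sub>\<le>\<^sub>0 :: complex set)"
    have "has_log ?S (\<lambda>p. E (fst p, - snd p))"
    proof (rule has_log_contractible)
      show "continuous_on ?S (\<lambda>p. E (fst p, - snd p))"
        by (rule continuous_on_compose2[OF cE])
          (auto intro!: continuous_intros simp: complex_nonpos_Reals_iff minus_equation_iff[of _ 1])
      show "contractible ?S"
      proof -
        have eq: "(\<real>\<^sub>\<le>\<^sub>0 :: complex set) = of_real ` {..0}" by (auto simp: nonpos_Reals_def)
        show ?thesis
          unfolding eq by (intro contractible_Times contractible_UNIV
              starlike_imp_contractible starlike_slotted_complex_plane_left)
      qed
      show "E (fst p, - snd p) \<noteq> 0" if "p \<in> ?S" for p
      proof -
        have "(fst p, - snd p) \<in> Q2" using that by (auto simp: Q2_def)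
        from nz'[OF subsetD[OF sub(2) this]] show ?thesis by (simp add: E_def power_int_eq_0_iff)
      qed
    qed
    then have "has_log Q2 (\<lambda>p. E (fst (fst p, - snd p), - snd (fst p, - snd p)))"
      by (rule has_log_compose) (auto simp: Q2_def intro!: continuous_intros)
    then show ?thesis by simp
  qed
  have op: "open Q1" "open Q2" "open Q3"
  proof -
    have "Q2 = (\<lambda>p. - snd p) -` (- \<real>\<^sub>\<le>\<^sub>0)" by (auto simp: Q2_def)
    then show "open Q2" by (auto intro!: open_vimage continuous_intros simp: open_Compl)
    have "Q1 = {p. snd p \<noteq> 0} \<inter> {p. cmod (snd p) < 1}" by (auto simp: Q1_def)
    then show "open Q1" by (auto intro!: open_Int open_Collect_neq open_Collect_less continuous_intros)
    show "open Q3" unfolding Q3_def by (intro open_Collect_less continuous_intros)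
  qed
  have pos: "(ln (cmod y) < 0 \<longleftrightarrow> cmod y < 1) \<and> (0 < ln (cmod y) \<longleftrightarrow> 1 < cmod y)"
    if "y \<notin> \<real>\<^sub>\<ge>\<^sub>0" for y :: complex
  proof -
    have "y \<noteq> 0" using that by auto
    then show ?thesis by simp
  qed
  have c12: "connected (Q1 \<inter> Q2)"
  proof -
    have "Q1 \<inter> Q2 = UNIV \<times> {y. - y \<notin> \<real>\<^sub>\<le>\<^sub>0 \<and> ln (cmod y) \<in> {..<0}}"
      by (auto simp: Q1_def Q2_def pos)
    then show ?thesis by (simp only: connected_Times connected_UNIV slit_sector_connected convex_real_interval)
  qed
  have c23: "connected ((Q1 \<union> Q2) \<inter> Q3)"
  proof -
    have "(Q1 \<union> Q2) \<inter> Q3 = UNIV \<times> {y. - y \<notin> \<real>\<^sub>\<le>\<^sub>0 \<and> ln (cmod y) \<in> {0<..}}"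
      by (auto simp: Q1_def Q2_def Q3_def pos)
    then show ?thesis by (simp only: connected_Times connected_UNIV slit_sector_connected convex_real_interval)
  qed
  have E12: "has_log (Q1 \<union> Q2) E"
    by (rule has_log_Un[OF _ _ c12 E1 E2]) (use op in \<open>auto simp: openin_open_eq open_Un\<close>)
  have "has_log ((Q1 \<union> Q2) \<union> Q3) E"
    by (rule has_log_Un[OF _ _ c23 E12 E3]) (use op in \<open>auto simp: openin_open_eq open_Un\<close>)
  moreover have "UNIV \<times> - {0, 1} \<subseteq> (Q1 \<union> Q2) \<union> Q3"
  proof
    fix p :: "real \<times> complex" assume p: "p \<in> UNIV \<times> - {0, 1}"
    have "cmod (snd p) \<noteq> 1" if "- snd p \<in> \<real>\<^sub>\<le>\<^sub>0"
      using that p by (auto simp: complex_nonpos_Reals_iff cmod_def complex_eq_iff)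
    then show "p \<in> (Q1 \<union> Q2) \<union> Q3"
      using p by (auto simp: Q1_def Q2_def Q3_def)
  qed
  ultimately have "has_log (UNIV \<times> - {0, 1}) E" by (rule has_log_subset)
  then show ?thesis using that unfolding E_def by blast
qed

section \<open>The complement of two lines in a cyclic cover\<close>

text \<open>
  A logarithm extends over a subset that is locally too thin to separate: near a missing point there is
  a local logarithm, and it differs from the given one by a single constant since the rest of the
  neighbourhood is connected. It is applied to the core circle of the glued-in solid torus.
\<close>

lemma has_log_extends:
  fixes E :: "'a::metric_space \<Rightarrow> complex"
  assumes con: "continuous_on S E" and nz: "\<And>q. q \<in> S \<Longrightarrow> E q \<noteq> 0"
    and D: "openin (top_of_set S) D" "has_log D E"
    and loc: "\<And>p U. p \<in> S - D \<Longrightarrow> openin (top_of_set S) U \<Longrightarrow> p \<in> U \<Longrightarrow>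
      \<exists>V. openin (top_of_set S) V \<and> p \<in> V \<and> V \<subseteq> U \<and> connected (V \<inter> D) \<and> V \<inter> D \<noteq> {}"
  shows "has_log S E"
proof -
  obtain h where h: "continuous_on D h" "\<And>q. q \<in> D \<Longrightarrow> E q = exp (h q)"
    using D(2) unfolding has_log_def by blast
  have "\<exists>V L. openin (top_of_set S) V \<and> p \<in> V \<and> continuous_on V L \<and>
      (\<forall>q\<in>V. E q = exp (L q)) \<and> (\<forall>q\<in>V \<inter> D. L q = h q)" if p: "p \<in> S - D" for p
  proof -
    define U where "U = S \<inter> (\<lambda>q. E q / E p) -` ball 1 1"
    have cp: "continuous_on S (\<lambda>q. E q / E p)" using nz p by (auto intro!: continuous_intros con)
    have U: "openin (top_of_set S) U" unfolding U_def
      by (rule continuous_openin_preimage_gen[OF cp open_ball])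
    have pU: "p \<in> U" using nz p by (simp add: U_def)
    obtain V where V: "openin (top_of_set S) V" "p \<in> V" "V \<subseteq> U" "connected (V \<inter> D)"
      using loc[OF p U pU] by blast
    have VS: "V \<subseteq> S" using V(1) by (rule openin_imp_subset)
    have "has_log V (\<lambda>q. E p * (E q / E p))"
      by (intro has_log_mult has_log_const has_log_near_one continuous_on_subset[OF cp VS])
        (use nz p V(3) in \<open>auto simp: U_def dist_norm norm_minus_commute\<close>)
    then have "has_log V E" using nz p by simp
    then obtain L where L: "continuous_on V L" "\<And>q. q \<in> V \<Longrightarrow> E q = exp (L q)"
      unfolding has_log_def by blast
    obtain n :: int where n: "\<And>q. q \<in> V \<inter> D \<Longrightarrow> h q = L q + 2 * pi * \<i> * n"
      by (rule logs_differ_by_period[OF V(4), of h L])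
        (use h L in \<open>auto intro: continuous_on_subset simp flip: h(2) L(2)\<close>)
    show ?thesis
      by (intro exI[of _ V] exI[of _ "\<lambda>q. L q + 2 * pi * \<i> * n"])
        (use V L n in \<open>auto intro!: continuous_intros simp: exp_add\<close>)
  qed
  then obtain V L where VL: "\<And>p. p \<in> S - D \<Longrightarrow> openin (top_of_set S) (V p) \<and> p \<in> V p \<and>
      continuous_on (V p) (L p) \<and> (\<forall>q\<in>V p. E q = exp (L p q)) \<and> (\<forall>q\<in>V p \<inter> D. L p q = h q)"
    by metis
  define H where "H q = (if q \<in> D then h q else L q q)" for q
  \<comment> \<open>At a further missing point \<open>q\<close> the two local logarithms agree, because \<open>D\<close> accumulates there.\<close>
  have agree: "L p q = L q q" if p: "p \<in> S - D" and q: "q \<in> V p" "q \<in> S - D" for p q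
  proof (rule ccontr)
    assume ne: "L p q \<noteq> L q q"
    let ?W = "V p \<inter> V q"
    have W: "openin (top_of_set S) ?W" "q \<in> ?W" using VL p q by auto
    have c: "continuous_on ?W (\<lambda>r. L p r - L q r)"
      using VL[OF p] VL[OF q(2)] by (auto intro!: continuous_intros intro: continuous_on_subset)
    have "openin (top_of_set ?W) (?W \<inter> (\<lambda>r. L p r - L q r) -` (- {0}))"
      by (rule continuous_openin_preimage_gen[OF c]) auto
    then have o: "openin (top_of_set S) (?W \<inter> (\<lambda>r. L p r - L q r) -` (- {0}))"
      using W(1) openin_trans by blast
    have "q \<in> ?W \<inter> (\<lambda>r. L p r - L q r) -` (- {0})" using W(2) ne by simp
    from loc[OF q(2) o this] obtain r where
      "r \<in> ?W \<inter> (\<lambda>r. L p r - L q r) -` (- {0})" "r \<in> D" by blast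
    then show False using VL[OF p] VL[OF q(2)] by auto
  qed
  show ?thesis
  proof (rule has_logI[of _ H])
    show "E q = exp (H q)" if "q \<in> S" for q
      using that h VL[of q] by (auto simp: H_def)
    have *: "\<exists>T. openin (top_of_set S) T \<and> p \<in> T \<and> continuous_on T H" if "p \<in> S" for p
    proof (cases "p \<in> D")
      case True
      have "continuous_on D H"
        by (rule continuous_on_eq[OF h(1)]) (simp add: H_def)
      then show ?thesis using True D(1) by blast
    next
      case False
      then have p: "p \<in> S - D" using that by simp
      have VS: "V p \<subseteq> S" using VL[OF p] openin_imp_subset by blast
      have "continuous_on (V p) H"
      proof (rule continuous_on_eq)
        show "continuous_on (V p) (L p)" using VL[OF p] by blast
        show "L p q = H q" if "q \<in> V p" for q
          using that VL[OF p] agree[OF p that] VS by (auto simp: H_def)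
      qed
      then show ?thesis using VL[OF p] by blast
    qed
    show "continuous_on S H"
      unfolding continuous_on_eq_continuous_within
    proof
      fix p assume p: "p \<in> S"
      from *[OF p] obtain T where T: "openin (top_of_set S) T" "p \<in> T" "continuous_on T H" by blast
      obtain O' where O': "open O'" "T = S \<inter> O'" using T(1) by (auto simp: openin_open)
      have "continuous (at p within T) H"
        using T(2,3) by (simp add: continuous_on_eq_continuous_within)
      moreover have "at p within S = at p within T"
        using at_within_nhd[of p O' S T] O' T(2) by auto
      ultimately show "continuous (at p within S) H" by simp
    qed
  qed
qed

lemma circle_power_with_log_is_trivial:
  assumes "has_log (sphere 0 1) (\<lambda>t. t powi c)"
  shows "c = 0"
proof -
  obtain h where h: "continuous_on (sphere 0 1) h" "\<And>t::complex. t \<in> sphere 0 1 \<Longrightarrow> t powi c = exp (h t)"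
    using assms unfolding has_log_def by blast
  have ch: "continuous_on UNIV (\<lambda>s. h (cis s))"
    by (rule continuous_on_compose2[OF h(1)]) (auto intro!: continuous_intros)
  have cc: "continuous_on UNIV (\<lambda>s::real. \<i> * of_real (of_int c * s))"
    by (intro continuous_intros)
  obtain n :: int where n: "\<And>s. h (cis s) = \<i> * of_real (of_int c * s) + 2 * pi * \<i> * n"
  proof (rule logs_differ_by_period[OF connected_UNIV ch cc])
    show "exp (h (cis s)) = exp (\<i> * of_real (of_int c * s))" for s
      using h(2)[of "cis s"] by (simp add: cis_power_int) (simp add: cis_conv_exp)
  qed (use that in blast)
  have "h (cis 0) = h (cis (2 * pi))" by (simp add: cis_2pi)
  then show ?thesis using n[of 0] n[of "2 * pi"] by simp
qed

text \<open>
  The properties of the infinite cyclic cover \<open>X\<close> of the surgered manifold that the argument needs.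
  The map \<open>J\<close> embeds \<open>\<real> \<times> \<complex>\<close>, the universal cover of the open solid torus, as an open subset, and
  the other points of \<open>X\<close> lie over the core of the glued-in solid torus. Approaching
  the core means going to infinity in \<open>\<complex>\<close> (\<open>escape\<close>), the core does not separate its small neighbourhoods
  (\<open>local_end\<close>), and some loop that winds around infinity bounds a disc near the
  core (\<open>meridian_disc\<close>). The last property is what distinguishes the surgered manifold from the
  solid torus: around all the strands together, maps to the punctured plane do not wind.
\<close>

locale cyclic_cover =
  fixes X :: "'a::metric_space set" and J :: "real \<times> complex \<Rightarrow> 'a" and Ji :: "'a \<Rightarrow> real \<times> complex"
  assumes J_cont: "continuous_on UNIV J" and J_in: "\<And>p. J p \<in> X"
    and Ji_J [simp]: "\<And>p. Ji (J p) = p"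
    and Ji_cont: "continuous_on (range J) Ji" and J_open: "openin (top_of_set X) (range J)"
    and escape: "\<And>p R. p \<in> X - range J \<Longrightarrow>
      eventually (\<lambda>q. q \<in> range J \<longrightarrow> R < cmod (snd (Ji q))) (at p within X)"
    and local_end: "\<And>p U. p \<in> X - range J \<Longrightarrow> openin (top_of_set X) U \<Longrightarrow> p \<in> U \<Longrightarrow>
      \<exists>V. openin (top_of_set X) V \<and> p \<in> V \<and> V \<subseteq> U \<and> connected (V \<inter> range J) \<and> V \<inter> range J \<noteq> {}"
    and meridian_disc: "\<And>R. \<exists>f \<sigma> \<xi>. continuous_on (cball 0 1) f \<and> f ` cball 0 1 \<subseteq> X \<and>
      (\<forall>c\<in>cball 0 1. f c \<in> range J \<longrightarrow> R < cmod (snd (Ji (f c)))) \<and>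
      (\<forall>a\<in>sphere (0::complex) 1. f a = J (\<sigma> a, \<xi> a)) \<and>
      (\<forall>c::int. has_log (sphere 0 1) (\<lambda>a. \<xi> a powi c) \<longrightarrow> c = 0)"
begin

definition graph :: "(real \<Rightarrow> complex) \<Rightarrow> 'a set" where
  "graph z = range (\<lambda>s. J (s, z s))"

lemma J_eq_iff [simp]: "J p = J q \<longleftrightarrow> p = q"
  by (metis Ji_J)

lemma J_in_graph [simp]: "J (s, x) \<in> graph z \<longleftrightarrow> x = z s"
  by (auto simp: graph_def)

lemma graph_subset: "graph z \<subseteq> range J"
  by (auto simp: graph_def)

lemma continuous_J: "continuous_on S f \<Longrightarrow> continuous_on S (\<lambda>x. J (f x))"
  by (rule continuous_on_compose2[OF J_cont]) auto

lemma continuous_Ji: "continuous_on S f \<Longrightarrow> f ` S \<subseteq> range J \<Longrightarrow> continuous_on S (\<lambda>x. Ji (f x))"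
  by (rule continuous_on_compose2[OF Ji_cont])

lemma continuous_on_via_J:
  assumes "continuous_on W (\<lambda>p. g (J p))"
  shows "continuous_on (J ` W) g"
proof (rule continuous_on_eq)
  show "continuous_on (J ` W) (\<lambda>q. g (J (Ji q)))"
    by (rule continuous_on_compose2[OF assms]) (auto intro: continuous_on_subset[OF Ji_cont])
qed auto

text \<open>
  At the core, where \<open>x = \<infinity>\<close>, the quotient \<open>(x - z) / (x - z')\<close> has the limit \<open>1\<close>. For fixed \<open>s\<close> this
  is the Moebius coordinate of the sphere that sends \<open>z\<close> and \<open>z'\<close> to \<open>0\<close> and \<open>\<infinity>\<close>.
\<close>

definition ratio :: "(real \<Rightarrow> complex) \<Rightarrow> (real \<Rightarrow> complex) \<Rightarrow> 'a \<Rightarrow> complex" where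
  "ratio z z' q = (if q \<in> range J then (snd (Ji q) - z (fst (Ji q))) / (snd (Ji q) - z' (fst (Ji q))) else 1)"

lemma ratio_J: "ratio z z' (J (s, x)) = (x - z s) / (x - z' s)"
  by (simp add: ratio_def)

lemma openin_complement_graph:
  assumes "continuous_on UNIV z" "bounded (range z)"
  shows "openin (top_of_set X) (X - graph z)"
proof (subst openin_subopen, intro ballI)
  fix p assume p: "p \<in> X - graph z"
  show "\<exists>T. openin (top_of_set X) T \<and> p \<in> T \<and> T \<subseteq> X - graph z"
  proof (cases "p \<in> range J")
    case True
    have c: "continuous_on (range J) (\<lambda>q. snd (Ji q) - z (fst (Ji q)))"
      by (intro continuous_intros Ji_cont continuous_on_compose2[OF assms(1)]) auto
    have "openin (top_of_set (range J)) (range J \<inter> (\<lambda>q. snd (Ji q) - z (fst (Ji q))) -` (- {0}))"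
      by (rule continuous_openin_preimage_gen[OF c]) auto
    then have "openin (top_of_set X) (range J \<inter> (\<lambda>q. snd (Ji q) - z (fst (Ji q))) -` (- {0}))"
      using J_open openin_trans by blast
    then show ?thesis
    proof (intro exI conjI)
      obtain s x where "p = J (s, x)" using True by auto
      then show "p \<in> range J \<inter> (\<lambda>q. snd (Ji q) - z (fst (Ji q))) -` (- {0})" using p by simp
      show "range J \<inter> (\<lambda>q. snd (Ji q) - z (fst (Ji q))) -` (- {0}) \<subseteq> X - graph z"
        using J_in by (auto simp: graph_def)
    qed
  next
    case False
    obtain R where R: "\<And>s. cmod (z s) \<le> R" using assms(2) by (auto simp: bounded_iff)
    have "eventually (\<lambda>q. q \<in> range J \<longrightarrow> R < cmod (snd (Ji q))) (at p within X)"
      using escape False p by blast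
    then obtain O' where O': "open O'" "p \<in> O'"
        "\<And>q. q \<in> O' \<Longrightarrow> q \<noteq> p \<Longrightarrow> q \<in> X \<Longrightarrow> q \<in> range J \<Longrightarrow> R < cmod (snd (Ji q))"
      unfolding eventually_at_topological by blast
    have "X \<inter> O' \<subseteq> X - graph z"
    proof
      fix q assume q: "q \<in> X \<inter> O'"
      have "q \<notin> graph z"
      proof
        assume "q \<in> graph z"
        then obtain s where s: "q = J (s, z s)" by (auto simp: graph_def)
        then have "R < cmod (snd (Ji q))" using O'(3)[of q] q False by auto
        then show False using R[of s] s by simp
      qed
      then show "q \<in> X - graph z" using q by simp
    qed
    then show ?thesis using O' p by (intro exI[of _ "X \<inter> O'"]) auto
  qed
qed

lemma ratio_continuous:
  assumes z: "continuous_on UNIV z" "bounded (range z)" and z': "continuous_on UNIV z'" "bounded (range z')"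
  shows "continuous_on (X - graph z - graph z') (ratio z z')"
  unfolding continuous_on_eq_continuous_within
proof
  let ?S = "X - graph z - graph z'"
  fix p assume p: "p \<in> ?S"
  show "continuous (at p within ?S) (ratio z z')"
  proof (cases "p \<in> range J")
    case True
    have "continuous_on (?S \<inter> range J) (ratio z z')"
    proof (rule continuous_on_eq)
      show "continuous_on (?S \<inter> range J) (\<lambda>q. (snd (Ji q) - z (fst (Ji q))) / (snd (Ji q) - z' (fst (Ji q))))"
        by (intro continuous_intros continuous_on_compose2[OF z(1)] continuous_on_compose2[OF z'(1)]
            continuous_on_subset[OF Ji_cont]) auto
    qed (simp add: ratio_def)
    then have "continuous (at p within ?S \<inter> range J) (ratio z z')"
      using p True by (simp add: continuous_on_eq_continuous_within)
    moreover have "at p within ?S \<inter> range J = at p within ?S"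
    proof -
      obtain O' where "open O'" "range J = X \<inter> O'" using J_open by (auto simp: openin_open)
      then show ?thesis using at_within_nhd[of p O' "?S \<inter> range J" ?S] True by auto
    qed
    ultimately show ?thesis by simp
  next
    case False
    obtain B where B: "\<And>s. cmod (z s) \<le> B" using z(2) by (auto simp: bounded_iff)
    obtain B' where B': "\<And>s. cmod (z' s) \<le> B'" using z'(2) by (auto simp: bounded_iff)
    have pX: "p \<in> X - range J" using p False by blast
    have "(ratio z z' \<longlongrightarrow> ratio z z' p) (at p within ?S)"
    proof (rule tendstoI)
      fix e :: real assume e: "e > 0"
      define R where "R = B' + (B + B') / e"
      have "eventually (\<lambda>q. q \<in> range J \<longrightarrow> R < cmod (snd (Ji q))) (at p within ?S)"
        using escape[OF pX, of R] by (rule filter_leD[OF at_le, rotated]) auto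
      then show "eventually (\<lambda>q. dist (ratio z z' q) (ratio z z' p) < e) (at p within ?S)"
      proof (rule eventually_mono)
        fix q assume q: "q \<in> range J \<longrightarrow> R < cmod (snd (Ji q))"
        show "dist (ratio z z' q) (ratio z z' p) < e"
        proof (cases "q \<in> range J")
          case True
          then obtain s x where sx: "q = J (s, x)" by auto
          have x: "R < cmod x" using q sx by auto
          have BB: "B + B' \<ge> 0" using B[of 0] B'[of 0] norm_ge_zero by (meson add_nonneg_nonneg order_trans)
          have big: "cmod (x - z' s) > (B + B') / e"
            using x B'[of s] norm_triangle_ineq2[of x "z' s"] by (simp add: R_def)
          then have pos: "cmod (x - z' s) > 0" using BB e by (meson divide_nonneg_pos le_less_trans)
          have "(x - z s) / (x - z' s) - 1 = (z' s - z s) / (x - z' s)"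
            using pos by (simp add: diff_divide_distrib[symmetric] field_simps)
          then have "dist (ratio z z' q) (ratio z z' p) = cmod (z' s - z s) / cmod (x - z' s)"
            using sx False by (simp add: ratio_J dist_norm ratio_def norm_divide)
          also have "\<dots> \<le> (B + B') / cmod (x - z' s)"
            using pos B[of s] B'[of s] norm_triangle_ineq4[of "z' s" "z s"] by (intro divide_right_mono) auto
          also have "\<dots> < e" using big pos e by (simp add: field_simps)
          finally show ?thesis .
        next
          case F: False
          then show ?thesis using False e by (simp add: ratio_def)
        qed
      qed
    qed
    then show ?thesis by (simp add: continuous_within)
  qed
qed

lemma ratio_nonzero: "q \<in> X - graph z - graph z' \<Longrightarrow> ratio z z' q \<noteq> 0"
  by (auto simp: ratio_def graph_def)

end

context cyclic_cover begin

text \<open>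
  The inverse of \<open>ratio\<close> on each fibre: it solves \<open>y = (x - z s) / (x - z' s)\<close> for \<open>x\<close>.
\<close>

definition moebius_param :: "(real \<Rightarrow> complex) \<Rightarrow> (real \<Rightarrow> complex) \<Rightarrow> real \<times> complex \<Rightarrow> 'a" where
  "moebius_param z z' = (\<lambda>(s, y). J (s, (y * z' s - z s) / (y - 1)))"

lemma moebius_param_continuous:
  assumes "continuous_on UNIV z" "continuous_on UNIV z'"
  shows "continuous_on (UNIV \<times> - {0, 1}) (moebius_param z z')"
  unfolding moebius_param_def case_prod_unfold
  by (intro continuous_J continuous_intros continuous_on_compose2[OF assms(1)]
      continuous_on_compose2[OF assms(2)]) auto

lemma moebius_param_image:
  assumes ne: "\<And>s. z s \<noteq> z' s"
  shows "moebius_param z z' ` (UNIV \<times> - {0, 1}) = range J - graph z - graph z'" (is "?L = ?R")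
    and "\<And>s x. x \<noteq> z s \<Longrightarrow> x \<noteq> z' s \<Longrightarrow>
      moebius_param z z' (s, (x - z s) / (x - z' s)) = J (s, x) \<and> (x - z s) / (x - z' s) \<notin> {0, 1}"
proof -
  show *: "moebius_param z z' (s, (x - z s) / (x - z' s)) = J (s, x) \<and> (x - z s) / (x - z' s) \<notin> {0, 1}"
    if x: "x \<noteq> z s" "x \<noteq> z' s" for s x
  proof -
    have d: "(x - z s) / (x - z' s) - 1 = (z' s - z s) / (x - z' s)"
      using x by (simp add: field_simps)
    have n: "(x - z s) / (x - z' s) * z' s - z s = x * (z' s - z s) / (x - z' s)"
      using x by (simp add: field_simps)
    have "((x - z s) / (x - z' s) * z' s - z s) / ((x - z s) / (x - z' s) - 1) = x"
      unfolding d n using x ne[of s] by simp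
    moreover have "(x - z s) / (x - z' s) \<noteq> 1" using d ne[of s] x by auto
    ultimately show ?thesis using x by (simp add: moebius_param_def)
  qed
  show "?L = ?R"
  proof (intro equalityI subsetI)
    fix q assume "q \<in> ?L"
    then obtain s y where sy: "q = J (s, (y * z' s - z s) / (y - 1))" "y \<noteq> 0" "y \<noteq> 1"
      by (auto simp: moebius_param_def)
    have "(y * z' s - z s) / (y - 1) - z s = y * (z' s - z s) / (y - 1)"
         "(y * z' s - z s) / (y - 1) - z' s = (z' s - z s) / (y - 1)"
      using sy by (simp_all add: field_simps)
    then have "(y * z' s - z s) / (y - 1) \<noteq> z s \<and> (y * z' s - z s) / (y - 1) \<noteq> z' s"
      using sy ne[of s] by (metis divide_eq_0_iff eq_iff_diff_eq_0 mult_eq_0_iff)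
    then show "q \<in> ?R" using sy by simp
  next
    fix q assume "q \<in> ?R"
    then obtain s x where "q = J (s, x)" "x \<noteq> z s" "x \<noteq> z' s" by auto
    then show "q \<in> ?L" using *[of x s] by (intro image_eqI[of _ _ "(s, (x - z s) / (x - z' s))"]) auto
  qed
qed

lemma complement_graphs_connected:
  assumes "continuous_on UNIV z" "continuous_on UNIV z'" "\<And>s. z s \<noteq> z' s"
  shows "connected (range J - graph z - graph z')"
proof -
  have "connected (UNIV - {0, 1 :: complex})"
    by (rule connected_open_delete_finite) auto
  then have c: "connected (UNIV \<times> - {0, 1 :: complex} :: (real \<times> complex) set)"
    unfolding Compl_eq_Diff_UNIV connected_Times by simp
  show ?thesis
    using connected_continuous_image[OF moebius_param_continuous[OF assms(1,2)] c]
    unfolding moebius_param_image(1)[of z z', OF assms(3)] .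
qed

text \<open>
  A sphere without two points is homotopy equivalent to a circle, so one expects the first cohomology
  of the complement of two lines to be generated by \<open>ratio\<close>. The core is treated separately,
  as the assumptions say little about the local structure there. Off the core, \<open>F\<close> is up to an exponential a
  product of powers of \<open>ratio\<close> and of \<open>ratio - 1\<close>; the second exponent vanishes because \<open>F\<close> is defined on
  the meridian disc; and the resulting logarithm extends over the core.
\<close>

proposition map_on_complement_is_ratio_power:
  assumes z: "continuous_on UNIV z" "bounded (range z)" and z': "continuous_on UNIV z'" "bounded (range z')"
    and ne: "\<And>s. z s \<noteq> z' s"
    and F: "continuous_on (X - graph z - graph z') F" "\<And>q. q \<in> X - graph z - graph z' \<Longrightarrow> F q \<noteq> 0"
  obtains a :: int where "has_log (X - graph z - graph z') (\<lambda>q. F q * ratio z z' q powi a)"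
proof -
  let ?S = "X - graph z - graph z'" and ?D = "range J - graph z - graph z'"
  let ?Q = "UNIV \<times> - {0, 1} :: (real \<times> complex) set"
  have DS: "?D \<subseteq> ?S" using J_in by auto
  have D: "?D = ?S \<inter> range J" using J_in by auto
  have cG: "continuous_on ?Q (\<lambda>p. F (moebius_param z z' p))"
    by (rule continuous_on_compose2[OF F(1) moebius_param_continuous[OF z(1) z'(1)]])
      (use moebius_param_image(1)[of z z', OF ne] DS in blast)
  have nG: "F (moebius_param z z' p) \<noteq> 0" if "p \<in> ?Q" for p
    using F(2) moebius_param_image(1)[of z z', OF ne] DS that by blast
  obtain a c :: int where
    ac: "has_log ?Q (\<lambda>p. F (moebius_param z z' p) * snd p powi a * (snd p - 1) powi c)"
    using thrice_punctured_map_is_product_of_powers[OF cG nG] by blast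
  have cr: "continuous_on ?S (ratio z z')" by (rule ratio_continuous[OF z z'])
  let ?E = "\<lambda>q. F q * ratio z z' q powi a"
  have cE: "continuous_on ?S ?E" by (intro continuous_intros F(1) cr) (use ratio_nonzero in blast)
  have nE: "?E q \<noteq> 0" if "q \<in> ?S" for q using F(2)[OF that] ratio_nonzero[OF that] by (simp add: power_int_eq_0_iff)
  have inv: "moebius_param z z' (fst (Ji q), ratio z z' q) = q \<and> ratio z z' q \<notin> {0, 1}" if "q \<in> ?D" for q
    using that moebius_param_image(2)[of z z', OF ne] by (auto simp: ratio_J)
  have log_c: "has_log ?D (\<lambda>q. ?E q * (ratio z z' q - 1) powi c)"
  proof -
    have "has_log ?D (\<lambda>q. F (moebius_param z z' (fst (Ji q), ratio z z' q)) *
        snd (fst (Ji q), ratio z z' q) powi a * (snd (fst (Ji q), ratio z z' q) - 1) powi c)"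
      by (rule has_log_compose[OF ac])
        (use inv in \<open>auto intro!: continuous_intros continuous_on_subset[OF Ji_cont] continuous_on_subset[OF cr DS]\<close>)
    then show ?thesis
      by (rule has_log_cong[THEN iffD1, rotated]) (simp add: inv)
  qed
  \<comment> \<open>On the boundary of the meridian disc, \<open>ratio - 1 = (z' - z) / (\<xi> - z')\<close> winds like \<open>1 / \<xi>\<close>.\<close>
  have "c = 0"
  proof -
    obtain B where B: "\<And>s. cmod (z s) \<le> B" using z(2) by (auto simp: bounded_iff)
    obtain B' where B': "\<And>s. cmod (z' s) \<le> B'" using z'(2) by (auto simp: bounded_iff)
    obtain f \<sigma> \<xi> where f: "continuous_on (cball 0 1) f" "f ` cball 0 1 \<subseteq> X"
      and far: "\<And>t. t \<in> cball 0 1 \<Longrightarrow> f t \<in> range J \<Longrightarrow> max B B' < cmod (snd (Ji (f t)))"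
      and bd: "\<And>t::complex. t \<in> sphere 0 1 \<Longrightarrow> f t = J (\<sigma> t, \<xi> t)"
      and nolog: "\<And>c::int. has_log (sphere 0 1) (\<lambda>t. \<xi> t powi c) \<Longrightarrow> c = 0"
      using meridian_disc[of "max B B'"] by auto
    have off: "f t \<in> ?S" if t: "t \<in> cball 0 1" for t
    proof -
      have "f t \<noteq> J (s, z s) \<and> f t \<noteq> J (s, z' s)" for s
        using far[OF t] B[of s] B'[of s] by auto
      then show ?thesis using f(2) t by (auto simp: graph_def)
    qed
    have onD: "f t \<in> ?D" if t: "t \<in> sphere 0 1" for t
      using off[of t] bd[OF t] t D by auto
    have big: "cmod (z' (\<sigma> t)) < cmod (\<xi> t)" if t: "t \<in> sphere 0 1" for t
      using far[of t] bd[OF t] t B'[of "\<sigma> t"] by auto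
    have cf: "continuous_on (sphere 0 1) f" by (rule continuous_on_subset[OF f(1)]) auto
    have cJi: "continuous_on (sphere 0 1) (\<lambda>t. Ji (f t))"
      by (intro continuous_Ji cf) (use onD in blast)
    have c\<sigma>: "continuous_on (sphere 0 1) \<sigma>"
      by (rule continuous_on_eq[OF continuous_on_fst[OF cJi]]) (simp add: bd)
    have c\<xi>: "continuous_on (sphere 0 1) \<xi>"
      by (rule continuous_on_eq[OF continuous_on_snd[OF cJi]]) (simp add: bd)
    have "has_log (cball 0 1) (\<lambda>t. ?E (f t))"
    proof (rule has_log_contractible)
      show "continuous_on (cball 0 1) (\<lambda>t. ?E (f t))"
        by (rule continuous_on_compose2[OF cE f(1)]) (use off in blast)
    qed (use nE off in \<open>auto intro: convex_imp_contractible\<close>)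
    then have 1: "has_log (sphere 0 1) (\<lambda>t. ?E (f t))" by (rule has_log_subset) auto
    have 2: "has_log (sphere 0 1) (\<lambda>t. ?E (f t) * (ratio z z' (f t) - 1) powi c)"
      by (rule has_log_compose[OF log_c cf onD])
    have nef: "?E (f t) \<noteq> 0" if "t \<in> sphere 0 1" for t
      by (rule nE[OF off]) (use that in auto)
    have "?E (f t) * (ratio z z' (f t) - 1) powi c / ?E (f t) = (ratio z z' (f t) - 1) powi c"
      if "t \<in> sphere 0 1" for t
      by (rule nonzero_mult_div_cancel_left[OF nef[OF that]])
    from iffD1[OF has_log_cong[OF this] has_log_divide[OF 2 1]]
    have 3: "has_log (sphere 0 1) (\<lambda>t. (ratio z z' (f t) - 1) powi c)" .
    have "has_log UNIV (\<lambda>s. z' s - z s)"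
      by (rule has_log_contractible) (use z z' ne[symmetric] in \<open>auto intro!: continuous_intros contractible_UNIV\<close>)
    then have 4: "has_log (sphere 0 1) (\<lambda>t. z' (\<sigma> t) - z (\<sigma> t))"
      by (rule has_log_compose[OF _ c\<sigma>]) auto
    have 5: "has_log (sphere 0 1) (\<lambda>t. 1 - z' (\<sigma> t) / \<xi> t)"
    proof (rule has_log_near_one)
      have cz: "continuous_on (sphere 0 1) (\<lambda>t. z' (\<sigma> t))"
        by (rule continuous_on_compose2[OF z'(1) c\<sigma>]) auto
      show "continuous_on (sphere 0 1) (\<lambda>t. 1 - z' (\<sigma> t) / \<xi> t)"
        by (intro continuous_intros c\<xi> cz) (use big in force)
      show "cmod (1 - z' (\<sigma> t) / \<xi> t - 1) < 1" if "t \<in> sphere 0 1" for t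
        using big[OF that] by (simp add: norm_divide divide_simps)
    qed
    have "has_log (sphere 0 1) (\<lambda>t. ((z' (\<sigma> t) - z (\<sigma> t)) / (1 - z' (\<sigma> t) / \<xi> t)) powi c
        / (ratio z z' (f t) - 1) powi c)"
      by (intro has_log_divide has_log_powi 3 4 5)
    moreover have "((z' (\<sigma> t) - z (\<sigma> t)) / (1 - z' (\<sigma> t) / \<xi> t)) powi c
        / (ratio z z' (f t) - 1) powi c = \<xi> t powi c" if t: "t \<in> sphere 0 1" for t
    proof -
      have x: "\<xi> t \<noteq> 0" "\<xi> t \<noteq> z' (\<sigma> t)" using big[OF t] by auto
      have r: "ratio z z' (f t) - 1 = (z' (\<sigma> t) - z (\<sigma> t)) / (\<xi> t - z' (\<sigma> t))"
        using x bd[OF t] by (simp add: ratio_J field_simps)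
      have "1 - z' (\<sigma> t) / \<xi> t = (\<xi> t - z' (\<sigma> t)) / \<xi> t" using x by (simp add: field_simps)
      then have "((z' (\<sigma> t) - z (\<sigma> t)) / (1 - z' (\<sigma> t) / \<xi> t)) / (ratio z z' (f t) - 1) = \<xi> t"
        unfolding r using x ne[of "\<sigma> t"] by simp
      then show ?thesis by (simp flip: power_int_divide_distrib)
    qed
    ultimately have "has_log (sphere 0 1) (\<lambda>t. \<xi> t powi c)"
      by (rule has_log_cong[THEN iffD1, rotated]) simp
    then show "c = 0" by (rule nolog)
  qed
  with log_c have "has_log ?D ?E" by simp
  moreover have "openin (top_of_set ?S) ?D"
  proof -
    obtain O' where "open O'" "range J = X \<inter> O'" using J_open by (auto simp: openin_open)
    then show ?thesis unfolding D by (auto simp: openin_open)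
  qed
  moreover have oS: "openin (top_of_set X) ?S"
  proof -
    have "?S = (X - graph z) \<inter> (X - graph z')" by auto
    then show ?thesis
      by (simp only:) (intro openin_Int openin_complement_graph z z')
  qed
  ultimately have "has_log ?S ?E"
  proof (intro has_log_extends[OF cE nE])
    fix p U assume p: "p \<in> ?S - ?D" "p \<in> U" and U: "openin (top_of_set ?S) U"
    have oU: "openin (top_of_set X) U" by (rule openin_trans[OF U oS])
    have pX: "p \<in> X - range J" using p by auto
    from local_end[OF pX oU p(2)] obtain V where V: "openin (top_of_set X) V" "p \<in> V" "V \<subseteq> U"
        "connected (V \<inter> range J)" "V \<inter> range J \<noteq> {}"
      by blast
    have VS: "V \<subseteq> ?S" by (rule subset_trans[OF V(3) openin_imp_subset[OF U]])
    then have VD: "V \<inter> ?D = V \<inter> range J" by auto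
    have oV: "openin (top_of_set ?S) V"
      using V(1) VS by (rule openin_subset_trans) auto
    show "\<exists>V. openin (top_of_set ?S) V \<and> p \<in> V \<and> V \<subseteq> U \<and> connected (V \<inter> ?D) \<and> V \<inter> ?D \<noteq> {}"
      by (intro exI[of _ V] conjI) (use V VD oV in auto)
  qed
  then show ?thesis by (rule that)
qed

end

section \<open>Linking differences of lines\<close>

context cyclic_cover begin

text \<open>
  The image of a line is connected and lies in a finite disjoint union of closed lines, so it lies in
  one of them.
\<close>

lemma homeo_matches_graphs:
  assumes I: "finite I" "finite I'"
    and zA: "\<And>i. i \<in> I \<Longrightarrow> continuous_on UNIV (zA i)"
    and zB: "\<And>j. j \<in> I' \<Longrightarrow> continuous_on UNIV (zB j)"
    and disj: "\<And>j j' s. j \<in> I' \<Longrightarrow> j' \<in> I' \<Longrightarrow> j \<noteq> j' \<Longrightarrow> zB j s \<noteq> zB j' s"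
    and \<Theta>: "continuous_on X \<Theta>" "\<Theta> ` (\<Union>i\<in>I. graph (zA i)) \<subseteq> (\<Union>j\<in>I'. graph (zB j))"
    and i: "i \<in> I"
  obtains j where "j \<in> I'" "\<Theta> ` graph (zA i) \<subseteq> graph (zB j)"
proof -
  define P where "P s = Ji (\<Theta> (J (s, zA i s)))" for s
  have ex: "\<exists>j\<in>I'. \<Theta> (J (s, zA i s)) \<in> graph (zB j)" for s
    using \<Theta>(2) i by (fastforce simp: graph_def)
  have in_range: "\<Theta> (J (s, zA i s)) \<in> range J" for s using ex[of s] graph_subset by blast
  have cP: "continuous_on UNIV P" unfolding P_def
  proof (intro continuous_Ji continuous_on_compose2[OF \<Theta>(1)] continuous_J continuous_intros zA i)
    show "range (\<lambda>s. J (s, zA i s)) \<subseteq> X" using J_in by auto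
    show "range (\<lambda>s. \<Theta> (J (s, zA i s))) \<subseteq> range J" using in_range by auto
  qed
  have mem: "\<Theta> (J (s, zA i s)) \<in> graph (zB j) \<longleftrightarrow> snd (P s) = zB j (fst (P s))" for s j
  proof -
    obtain t x where "\<Theta> (J (s, zA i s)) = J (t, x)" using in_range[of s] by auto
    then show ?thesis by (simp add: P_def)
  qed
  let ?C = "\<lambda>j. {s. snd (P s) = zB j (fst (P s))}"
  have cl: "closed (?C j)" if "j \<in> I'" for j
    by (intro closed_Collect_eq continuous_on_compose2[OF zB[OF that]] continuous_intros cP) auto
  obtain j where j: "j \<in> I'" "0 \<in> ?C j" using ex[of 0] mem by auto
  have un: "- ?C j = (\<Union>j'\<in>I' - {j}. ?C j')"
  proof (intro equalityI subsetI)
    fix s assume "s \<in> - ?C j"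
    then show "s \<in> (\<Union>j'\<in>I' - {j}. ?C j')" using ex[of s] mem by auto
  next
    fix s assume "s \<in> (\<Union>j'\<in>I' - {j}. ?C j')"
    then obtain j' where j': "j' \<in> I'" "j' \<noteq> j" "snd (P s) = zB j' (fst (P s))" by auto
    then show "s \<in> - ?C j" using disj[OF j'(1) j(1) j'(2), of "fst (P s)"] by auto
  qed
  have "closed (- ?C j)" unfolding un by (intro closed_UN) (use I cl in auto)
  then have "?C j = UNIV" using cl[OF j(1)] clopen[of "?C j"] j(2) by (auto simp: closed_def)
  then have "\<Theta> (J (s, zA i s)) \<in> graph (zB j)" for s using mem[of s j] by blast
  then have "\<Theta> ` graph (zA i) \<subseteq> graph (zB j)" by (auto simp: graph_def)
  with j(1) show ?thesis by (rule that)
qed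

lemma homeo_permutes_graphs:
  assumes I: "finite I" "finite I'"
    and zA: "\<And>i. i \<in> I \<Longrightarrow> continuous_on UNIV (zA i)"
      "\<And>i i' s. i \<in> I \<Longrightarrow> i' \<in> I \<Longrightarrow> i \<noteq> i' \<Longrightarrow> zA i s \<noteq> zA i' s"
    and zB: "\<And>j. j \<in> I' \<Longrightarrow> continuous_on UNIV (zB j)"
      "\<And>j j' s. j \<in> I' \<Longrightarrow> j' \<in> I' \<Longrightarrow> j \<noteq> j' \<Longrightarrow> zB j s \<noteq> zB j' s"
    and \<Theta>: "continuous_on X \<Theta>" "\<Theta> ` (\<Union>i\<in>I. graph (zA i)) \<subseteq> (\<Union>j\<in>I'. graph (zB j))"
      "\<And>q. q \<in> X \<Longrightarrow> \<Theta>' (\<Theta> q) = q"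
    and \<Theta>': "continuous_on X \<Theta>'" "\<Theta>' ` (\<Union>j\<in>I'. graph (zB j)) \<subseteq> (\<Union>i\<in>I. graph (zA i))"
      "\<And>q. q \<in> X \<Longrightarrow> \<Theta> (\<Theta>' q) = q"
  obtains \<sigma> where "bij_betw \<sigma> I I'" "\<And>i. i \<in> I \<Longrightarrow> \<Theta> ` graph (zA i) = graph (zB (\<sigma> i))"
proof -
  have "\<exists>j\<in>I'. \<Theta> ` graph (zA i) \<subseteq> graph (zB j)" if "i \<in> I" for i
    by (rule homeo_matches_graphs[OF I zA(1) zB \<Theta>(1,2) that]; (rule bexI)?; assumption)
  then obtain \<sigma> where \<sigma>: "\<And>i. i \<in> I \<Longrightarrow> \<sigma> i \<in> I' \<and> \<Theta> ` graph (zA i) \<subseteq> graph (zB (\<sigma> i))" by metis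
  have "\<exists>i\<in>I. \<Theta>' ` graph (zB j) \<subseteq> graph (zA i)" if "j \<in> I'" for j
    by (rule homeo_matches_graphs[OF I(2,1) zB(1) zA \<Theta>'(1,2) that]; (rule bexI)?; assumption)
  then obtain \<tau> where \<tau>: "\<And>j. j \<in> I' \<Longrightarrow> \<tau> j \<in> I \<and> \<Theta>' ` graph (zB j) \<subseteq> graph (zA (\<tau> j))" by metis
  have \<tau>\<sigma>: "\<tau> (\<sigma> i) = i" if i: "i \<in> I" for i
  proof (rule ccontr)
    assume ne: "\<tau> (\<sigma> i) \<noteq> i"
    have "J (0, zA i 0) \<in> graph (zA i)" by simp
    then have "\<Theta>' (\<Theta> (J (0, zA i 0))) \<in> graph (zA (\<tau> (\<sigma> i)))" using \<sigma>[OF i] \<tau>[of "\<sigma> i"] by blast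
    then have "zA i 0 = zA (\<tau> (\<sigma> i)) 0" using \<Theta>(3)[OF J_in] by simp
    then show False using zA(2)[of i "\<tau> (\<sigma> i)" 0] i \<sigma>[OF i] \<tau>[of "\<sigma> i"] ne by metis
  qed
  have \<sigma>\<tau>: "\<sigma> (\<tau> j) = j" if j: "j \<in> I'" for j
  proof (rule ccontr)
    assume ne: "\<sigma> (\<tau> j) \<noteq> j"
    have "J (0, zB j 0) \<in> graph (zB j)" by simp
    then have "\<Theta> (\<Theta>' (J (0, zB j 0))) \<in> graph (zB (\<sigma> (\<tau> j)))" using \<tau>[OF j] \<sigma>[of "\<tau> j"] by blast
    then have "zB j 0 = zB (\<sigma> (\<tau> j)) 0" using \<Theta>'(3)[OF J_in] by simp
    then show False using zB(2)[of j "\<sigma> (\<tau> j)" 0] j \<tau>[OF j] \<sigma>[of "\<tau> j"] ne by metis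
  qed
  have "bij_betw \<sigma> I I'"
    by (rule bij_betw_byWitness[of _ \<tau>]) (use \<tau>\<sigma> \<sigma>\<tau> \<sigma> \<tau> in auto)
  moreover have "\<Theta> ` graph (zA i) = graph (zB (\<sigma> i))" if i: "i \<in> I" for i
  proof
    show "\<Theta> ` graph (zA i) \<subseteq> graph (zB (\<sigma> i))" using \<sigma>[OF i] by blast
    show "graph (zB (\<sigma> i)) \<subseteq> \<Theta> ` graph (zA i)"
    proof
      fix q assume q: "q \<in> graph (zB (\<sigma> i))"
      then have "\<Theta>' q \<in> graph (zA i)" using \<tau>[of "\<sigma> i"] \<sigma>[OF i] \<tau>\<sigma>[OF i] by auto
      moreover have "q \<in> X" using q J_in by (auto simp: graph_def)
      then have "q = \<Theta> (\<Theta>' q)" using \<Theta>'(3) by simp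
      ultimately show "q \<in> \<Theta> ` graph (zA i)" by blast
    qed
  qed
  ultimately show ?thesis by (rule that)
qed

text \<open>
  The number \<open>W i j\<close> is \<open>2 * pi * \<i>\<close> times the winding number of two lines over one period. In the quotient
  of \<open>X\<close> by \<open>T\<close>, the equation for \<open>W\<close> says that the null-homologous links \<open>z 0 - z 1\<close> and \<open>z 2 - z 3\<close> have
  linking number zero. The proof pulls \<open>ratio\<close> for the lines \<open>zB 0\<close> and \<open>zB 1\<close> back along \<open>\<Theta>\<close>. The pull-back is
  \<open>exp h\<close> times \<open>ratio\<close> for \<open>zA 0\<close> and \<open>zA 1\<close> to a nonzero power. Consider the change of its logarithm
  over one period along \<open>zA 2\<close> and along \<open>zA 3\<close>. By \<open>WB\<close> it is the same for both lines, and the contribution of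
  \<open>h\<close> is the same as well, because \<open>h\<close> changes by a constant under \<open>T\<close>; this leaves the equation for \<open>WA\<close>.
\<close>

theorem homeo_preserves_linking_difference:
  fixes zA zB :: "nat \<Rightarrow> real \<Rightarrow> complex" and per :: real
  assumes per: "per > 0"
    and T: "\<And>q. q \<in> X \<Longrightarrow> T q \<in> X" "\<And>s x. T (J (s, x)) = J (s + per, x)"
      "\<And>q. q \<in> X \<Longrightarrow> T q \<in> range J \<Longrightarrow> q \<in> range J"
    and \<Theta>: "continuous_on X \<Theta>" "\<And>q. q \<in> X \<Longrightarrow> \<Theta> q \<in> X" "\<And>q. q \<in> X \<Longrightarrow> \<Theta> (T q) = T (\<Theta> q)"
    and \<Theta>': "continuous_on X \<Theta>'" "\<And>q. q \<in> X \<Longrightarrow> \<Theta>' q \<in> X" "\<And>q. q \<in> X \<Longrightarrow> \<Theta>' (\<Theta> q) = q"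
      "\<And>q. q \<in> X \<Longrightarrow> \<Theta> (\<Theta>' q) = q"
    and lines: "\<And>i. i < 4 \<Longrightarrow> \<Theta> ` graph (zA i) = graph (zB i)"
    and zA: "\<And>i. i < 4 \<Longrightarrow> continuous_on UNIV (zA i)" "\<And>i s. i < 4 \<Longrightarrow> zA i (s + per) = zA i s"
      "\<And>i. i < 4 \<Longrightarrow> bounded (range (zA i))"
    and zB: "\<And>i. i < 4 \<Longrightarrow> continuous_on UNIV (zB i)" "\<And>i s. i < 4 \<Longrightarrow> zB i (s + per) = zB i s"
      "\<And>i. i < 4 \<Longrightarrow> bounded (range (zB i))"
    and LA: "\<And>i j. i < 4 \<Longrightarrow> j < 4 \<Longrightarrow> i \<noteq> j \<Longrightarrow> continuous_on UNIV (LA i j)"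
      "\<And>i j s. i < 4 \<Longrightarrow> j < 4 \<Longrightarrow> i \<noteq> j \<Longrightarrow> exp (LA i j s) = zA i s - zA j s"
      "\<And>i j s. i < 4 \<Longrightarrow> j < 4 \<Longrightarrow> i \<noteq> j \<Longrightarrow> LA i j (s + per) = LA i j s + (WA i j :: complex)"
    and LB: "\<And>i j. i < 4 \<Longrightarrow> j < 4 \<Longrightarrow> i \<noteq> j \<Longrightarrow> continuous_on UNIV (LB i j)"
      "\<And>i j s. i < 4 \<Longrightarrow> j < 4 \<Longrightarrow> i \<noteq> j \<Longrightarrow> exp (LB i j s) = zB i s - zB j s"
      "\<And>i j s. i < 4 \<Longrightarrow> j < 4 \<Longrightarrow> i \<noteq> j \<Longrightarrow> LB i j (s + per) = LB i j s + (WB i j :: complex)"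
    and WB: "WB 2 0 - WB 2 1 = WB 3 0 - WB 3 1"
  shows "WA 2 0 - WA 2 1 = WA 3 0 - WA 3 1"
proof -
  have neA: "zA i s \<noteq> zA j s" if "i < 4" "j < 4" "i \<noteq> j" for i j s
    using LA(2)[OF that, of s] exp_not_eq_zero[of "LA i j s"] by auto
  have neB: "zB i s \<noteq> zB j s" if "i < 4" "j < 4" "i \<noteq> j" for i j s
    using LB(2)[OF that, of s] exp_not_eq_zero[of "LB i j s"] by auto
  let ?SA = "X - graph (zA 0) - graph (zA 1)" and ?SB = "X - graph (zB 0) - graph (zB 1)"
  let ?rA = "ratio (zA 0) (zA 1)" and ?rB = "ratio (zB 0) (zB 1)"
  have crB: "continuous_on ?SB ?rB" by (rule ratio_continuous) (use zB in auto)
  have gX: "graph z \<subseteq> X" for z using J_in by (auto simp: graph_def)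
  have \<Theta>S: "\<Theta> q \<in> ?SB" if q: "q \<in> ?SA" for q
  proof -
    have "\<Theta> q \<notin> graph (zB i)" if i: "i < 4" "q \<notin> graph (zA i)" for i
    proof
      assume "\<Theta> q \<in> graph (zB i)"
      then obtain r where r: "r \<in> graph (zA i)" "\<Theta> r = \<Theta> q" using lines[OF i(1)] by force
      then have "r = q" using \<Theta>'(3)[of r] \<Theta>'(3)[of q] gX q by auto
      then show False using r i by simp
    qed
    then show ?thesis using q \<Theta>(2) by auto
  qed
  have \<Theta>'S: "\<Theta>' q \<in> ?SA" if q: "q \<in> ?SB" for q
  proof -
    have "\<Theta>' q \<notin> graph (zA i)" if i: "i < 4" "q \<notin> graph (zB i)" for i
    proof
      assume "\<Theta>' q \<in> graph (zA i)"
      then have "\<Theta> (\<Theta>' q) \<in> graph (zB i)" using lines[OF i(1)] by blast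
      then show False using \<Theta>'(4)[of q] q i by simp
    qed
    then show ?thesis using q \<Theta>'(2) by auto
  qed
  define F where "F q = ?rB (\<Theta> q)" for q
  have cF: "continuous_on ?SA F" unfolding F_def
    by (rule continuous_on_compose2[OF crB continuous_on_subset[OF \<Theta>(1)]]) (use \<Theta>S in auto)
  have nF: "F q \<noteq> 0" if "q \<in> ?SA" for q
    unfolding F_def by (rule ratio_nonzero[OF \<Theta>S[OF that]])
  obtain a :: int where a: "has_log ?SA (\<lambda>q. F q * ?rA q powi a)"
    by (rule map_on_complement_is_ratio_power[of "zA 0" "zA 1" F, OF _ _ _ _ _ cF nF])
      (use zA neA in auto)
  then obtain h where h: "continuous_on ?SA h" "\<And>q. q \<in> ?SA \<Longrightarrow> F q * ?rA q powi a = exp (h q)"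
    unfolding has_log_def by blast
  \<comment> \<open>Otherwise \<open>ratio\<close> for the second family would have a logarithm; but it winds once around a small loop
      around the line \<open>zB 0\<close>.\<close>
  have a0: "a \<noteq> 0"
  proof
    assume "a = 0"
    then have "has_log ?SA F" using a by simp
    then have "has_log ?SB (\<lambda>q. F (\<Theta>' q))"
      by (rule has_log_compose[OF _ continuous_on_subset[OF \<Theta>'(1)] \<Theta>'S]) auto
    then have rB: "has_log ?SB ?rB"
      by (rule iffD1[OF has_log_cong, rotated]) (simp add: F_def \<Theta>'(4))
    define d where "d = zB 0 0 - zB 1 0"
    have d: "d \<noteq> 0" using neB[of 0 1 0] by (simp add: d_def)
    define \<gamma> where "\<gamma> t = J (0, zB 0 0 + d / 2 * t)" for t
    have half: "d + d / 2 * t \<noteq> 0" if "t \<in> sphere 0 1" for t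
    proof
      assume "d + d / 2 * t = 0"
      then have "d * (1 + t / 2) = 0" by (simp add: algebra_simps)
      then have "t / 2 = - 1" using d by (metis add_eq_0_iff mult_eq_0_iff)
      then have "cmod (t / 2) = 1" by simp
      then show False using that by (simp add: norm_divide)
    qed
    have c\<gamma>: "continuous_on (sphere 0 1) \<gamma>" unfolding \<gamma>_def by (intro continuous_J continuous_intros)
    have \<gamma>S: "\<gamma> t \<in> ?SB" if "t \<in> sphere 0 1" for t
      using that half[OF that] d J_in by (auto simp: \<gamma>_def d_def algebra_simps)
    have 1: "has_log (sphere 0 1) (\<lambda>t. ?rB (\<gamma> t))" by (rule has_log_compose[OF rB c\<gamma> \<gamma>S])
    have 2: "has_log (sphere 0 1) (\<lambda>t::complex. 1 + t / 2)"
      by (rule has_log_near_one) (auto intro!: continuous_intros simp: norm_divide)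
    have 3: "has_log (sphere 0 1) (\<lambda>t. ?rB (\<gamma> t) * (2 * (1 + t / 2)))"
      by (intro has_log_mult 1 2 has_log_const) auto
    have 4: "?rB (\<gamma> t) * (2 * (1 + t / 2)) = t powi 1" if t: "t \<in> sphere 0 1" for t
    proof -
      have e: "d + d / 2 * t = d * (1 + t / 2)" by (simp add: algebra_simps)
      then have u: "1 + t / 2 \<noteq> 0" using half[OF t] by auto
      have r: "?rB (\<gamma> t) = (d / 2 * t) / (d * (1 + t / 2))"
        unfolding e[symmetric] by (simp add: \<gamma>_def ratio_J d_def algebra_simps)
      have "(d / 2 * t) / (d * u) * (2 * u) = t" if "u \<noteq> 0" for u
        using that d by (simp add: field_simps)
      from this[OF u] show ?thesis unfolding r by simp
    qed
    show False
      using circle_power_with_log_is_trivial[OF iffD1[OF has_log_cong[OF 4] 3]] by simp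
  qed
  have D: "range J - graph (zA 0) - graph (zA 1) \<subseteq> ?SA" using J_in by auto
  let ?D = "{p. snd p \<noteq> zA 0 (fst p) \<and> snd p \<noteq> zA 1 (fst p)}"
  have JD: "J ` ?D = range J - graph (zA 0) - graph (zA 1)" by force
  have conD: "connected (J ` ?D)" unfolding JD
    by (rule complement_graphs_connected) (use zA neA in auto)
  have JDS: "J p \<in> ?SA" if "p \<in> ?D" for p using JD D that by blast
  have TD: "T q \<in> J ` ?D" if q: "q \<in> J ` ?D" for q
  proof -
    obtain s x where sx: "q = J (s, x)" "(s, x) \<in> ?D" using q by auto
    then have "(s + per, x) \<in> ?D" by (simp add: zA(2))
    then show ?thesis unfolding sx(1) T(2) by (rule imageI)
  qed
  have expT: "exp (h (T q)) = exp (h q)" if q: "q \<in> J ` ?D" for q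
  proof -
    obtain s x where sx: "q = J (s, x)" "(s, x) \<in> ?D" using q by auto
    have S: "q \<in> ?SA" "T q \<in> ?SA" using q TD[OF q] JDS by auto
    have "?rA (T q) = ?rA q" using sx by (simp add: T(2) ratio_J zA(2))
    moreover have "F (T q) = F q"
    proof -
      have r: "\<Theta> q \<in> X" using \<Theta>(2) S by auto
      have "?rB (T (\<Theta> q)) = ?rB (\<Theta> q)"
      proof (cases "\<Theta> q \<in> range J")
        case True
        then obtain t y where "\<Theta> q = J (t, y)" by auto
        then show ?thesis by (simp add: T(2) ratio_J zB(2))
      next
        case False
        then have "T (\<Theta> q) \<notin> range J" using T(3) r by blast
        then show ?thesis using False by (simp add: ratio_def)
      qed
      then show ?thesis using \<Theta>(3) S by (simp add: F_def)
    qed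
    ultimately show ?thesis using h(2)[OF S(1)] h(2)[OF S(2)] by simp
  qed
  have chJ: "continuous_on ?D (\<lambda>p. h (J p))"
    by (rule continuous_on_compose2[OF h(1) continuous_J[OF continuous_on_id]]) (use JDS in auto)
  have ch: "continuous_on (J ` ?D) h" by (rule continuous_on_subset[OF h(1)]) (use JDS in auto)
  have chT: "continuous_on (J ` ?D) (\<lambda>q. h (T q))"
  proof (rule continuous_on_via_J)
    have "continuous_on ?D (\<lambda>p. h (J (fst p + per, snd p)))"
      by (rule continuous_on_compose2[OF chJ]) (auto intro!: continuous_intros simp: zA(2))
    then show "continuous_on ?D (\<lambda>p. h (T (J p)))"
    proof (rule continuous_on_eq)
      show "h (J (fst p + per, snd p)) = h (T (J p))" for p
        using T(2)[of "fst p" "snd p"] by simp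
    qed
  qed
  obtain b :: int where b: "\<And>q. q \<in> J ` ?D \<Longrightarrow> h (T q) = h q + 2 * pi * \<i> * b"
    using logs_differ_by_period[OF conD chT ch expT] by blast
  \<comment> \<open>Both sides are the change over one period of a logarithm of the pulled-back function along \<open>zA i\<close>.\<close>
  have key: "2 * pi * \<i> * b = (WB i 0 - WB i 1) + of_int a * (WA i 0 - WA i 1)"
    if i: "i < 4" "i \<noteq> 0" "i \<noteq> 1" for i
  proof -
    define \<gamma> where "\<gamma> s = J (s, zA i s)" for s
    have \<gamma>D: "\<gamma> s \<in> J ` ?D" for s
      unfolding \<gamma>_def by (rule imageI) (use neA[of i 0] neA[of i 1] i in simp)
    have \<gamma>S: "\<gamma> s \<in> ?SA" for s using \<gamma>D[of s] D unfolding JD by (rule rev_subsetD)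
    have T\<gamma>: "\<gamma> (s + per) = T (\<gamma> s)" for s by (simp add: \<gamma>_def T(2) zA(2) i)
    have c\<gamma>: "continuous_on UNIV \<gamma>" unfolding \<gamma>_def by (intro continuous_J continuous_intros zA i)
    have on: "\<exists>t. \<Theta> (\<gamma> s) = J (t, zB i t)" for s
      using lines[OF i(1)] unfolding \<gamma>_def graph_def by blast
    define t where "t s = fst (Ji (\<Theta> (\<gamma> s)))" for s
    have t: "\<Theta> (\<gamma> s) = J (t s, zB i (t s))" for s using on[of s] by (auto simp: t_def)
    have in_r: "\<Theta> (\<gamma> s) \<in> range J" for s using on[of s] by auto
    have ct: "continuous_on UNIV t" unfolding t_def
      by (intro continuous_intros continuous_Ji continuous_on_compose2[OF \<Theta>(1) c\<gamma>])
        (use \<gamma>S in_r in auto)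
    have tper: "t (s + per) = t s + per" for s
    proof -
      have "J (t (s + per), zB i (t (s + per))) = T (\<Theta> (\<gamma> s))"
        using \<Theta>(3)[of "\<gamma> s"] \<gamma>S[of s] by (simp add: T\<gamma> flip: t)
      then show ?thesis by (simp add: t T(2))
    qed
    define g where "g s = LB i 0 (t s) - LB i 1 (t s) + of_int a * (LA i 0 s - LA i 1 s)" for s
    have cg: "continuous_on UNIV g" unfolding g_def
      by (intro continuous_intros continuous_on_compose2[OF LB(1) ct] LA(1)) (use i in auto)
    have ch\<gamma>: "continuous_on UNIV (\<lambda>s. h (\<gamma> s))"
      by (rule continuous_on_compose2[OF h(1) c\<gamma>]) (use \<gamma>S in auto)
    obtain n :: int where n: "\<And>s. h (\<gamma> s) = g s + 2 * pi * \<i> * n"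
    proof (rule logs_differ_by_period[OF connected_UNIV ch\<gamma> cg])
      fix s
      have "F (\<gamma> s) = exp (LB i 0 (t s) - LB i 1 (t s))"
        using LB(2)[of i 0 "t s"] LB(2)[of i 1 "t s"] i by (simp add: F_def t ratio_J exp_diff)
      moreover have "?rA (\<gamma> s) = exp (LA i 0 s - LA i 1 s)"
        using LA(2)[of i 0 s] LA(2)[of i 1 s] i by (simp add: \<gamma>_def ratio_J exp_diff)
      ultimately show "exp (h (\<gamma> s)) = exp (g s)"
        using h(2)[OF \<gamma>S[of s]] by (simp add: g_def exp_add exp_power_int)
    qed (use that in blast)
    have "h (\<gamma> (0 + per)) = h (\<gamma> 0) + 2 * pi * \<i> * b" unfolding T\<gamma> by (rule b[OF \<gamma>D])
    then have "2 * pi * \<i> * b = g (0 + per) - g 0"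
      using n[of "0 + per"] n[of 0] by (simp add: algebra_simps)
    moreover have "g (0 + per) = g 0 + (WB i 0 - WB i 1) + of_int a * (WA i 0 - WA i 1)"
      unfolding g_def tper using LA(3)[of i 0 0] LA(3)[of i 1 0] LB(3)[of i 0 "t 0"] LB(3)[of i 1 "t 0"] i
      by (simp add: algebra_simps)
    ultimately show ?thesis by simp
  qed
  have "of_int a * (WA 2 0 - WA 2 1) = of_int a * (WA 3 0 - WA 3 1)"
    using key[of 2] key[of 3] WB by simp
  then show ?thesis using a0 by simp
qed

end

section \<open>Null-homologous loops have winding number zero\<close>

text \<open>
  The total change of a logarithm along a path. On singular 1-simplices this is a cocycle, the
  winding cocycle of the punctured plane.
\<close>

definition log_change :: "(real \<Rightarrow> complex) \<Rightarrow> complex" where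
  "log_change P = (SOME d. \<exists>l. continuous_on {0..1} l \<and> (\<forall>t\<in>{0..1}. P t = exp (l t)) \<and> d = l 1 - l 0)"

lemma log_change_eq:
  assumes l: "continuous_on {0..1} l" "\<And>t. t \<in> {0..1} \<Longrightarrow> P t = exp (l t)"
  shows "log_change P = l 1 - l 0"
proof -
  have "\<exists>d l. continuous_on {0..1} l \<and> (\<forall>t\<in>{0..1}. P t = exp (l t)) \<and> d = l 1 - l 0"
    using l by blast
  then have "\<exists>l. continuous_on {0..1} l \<and> (\<forall>t\<in>{0..1}. P t = exp (l t)) \<and> log_change P = l 1 - l 0"
    unfolding log_change_def by (rule someI_ex)
  then obtain k where k: "continuous_on {0..1} k" "\<forall>t\<in>{0..1}. P t = exp (k t)" "log_change P = k 1 - k 0"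
    by blast
  obtain n :: int where n: "\<And>t. t \<in> {0..1} \<Longrightarrow> k t = l t + 2 * pi * \<i> * n"
    by (rule logs_differ_by_period[of "{0..1}" k l]) (use k l in auto)
  show ?thesis using n[of 0] n[of 1] k(3) by simp
qed

definition edge_point :: "real \<Rightarrow> nat \<Rightarrow> real" where
  "edge_point t = (\<lambda>i. if i = 0 then 1 - t else if i = 1 then t else 0)"

definition triangle_point :: "real \<times> real \<Rightarrow> nat \<Rightarrow> real" where
  "triangle_point = (\<lambda>(a, b) i. if i = 0 then 1 - a - b else if i = 1 then a else if i = 2 then b else 0)"

definition triangle :: "(real \<times> real) set" where
  "triangle = {p. 0 \<le> fst p \<and> 0 \<le> snd p \<and> fst p + snd p \<le> 1}"

lemma edge_point_continuous:
  "continuous_map (top_of_set {0..1}) (subtopology (powertop_real UNIV) (standard_simplex 1)) edge_point"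
  unfolding continuous_map_in_subtopology continuous_map_componentwise_UNIV
proof (intro conjI allI)
  show "continuous_map (top_of_set {0..1}) euclideanreal (\<lambda>x. edge_point x k)" for k
    by (cases "k = 0"; cases "k = 1") (auto simp: edge_point_def intro!: continuous_intros)
qed (auto simp: edge_point_def standard_simplex_def)

lemma triangle_point_continuous:
  "continuous_map (top_of_set triangle) (subtopology (powertop_real UNIV) (standard_simplex 2)) triangle_point"
  unfolding continuous_map_in_subtopology continuous_map_componentwise_UNIV
proof (intro conjI allI)
  show "continuous_map (top_of_set triangle) euclideanreal (\<lambda>x. triangle_point x k)" for k
    by (cases "k = 0"; cases "k = 1"; cases "k = 2")
      (auto simp: triangle_point_def case_prod_unfold intro!: continuous_intros)
  show "triangle_point \<in> topspace (top_of_set triangle) \<rightarrow> standard_simplex 2"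
    by (auto simp: triangle_point_def triangle_def standard_simplex_def atMost_Suc numeral_2_eq_2)
qed

lemma triangle_convex: "convex triangle"
proof -
  have eq: "triangle = fst -` {0..} \<inter> snd -` {0..} \<inter> (\<lambda>p. fst p + snd p) -` {..1}" by (auto simp: triangle_def)
  have "linear (\<lambda>p::real \<times> real. fst p + snd p)"
    by (auto intro!: linearI simp: algebra_simps)
  then show ?thesis
    unfolding eq by (intro convex_Int convex_linear_vimage linear_fst linear_snd convex_real_interval)
qed

definition edge_log_change :: "('a \<Rightarrow> complex) \<Rightarrow> ((nat \<Rightarrow> real) \<Rightarrow> 'a) \<Rightarrow> complex" where
  "edge_log_change g \<sigma> = log_change (\<lambda>t. g (\<sigma> (edge_point t)))"

definition chain_log_change :: "('a \<Rightarrow> complex) \<Rightarrow> 'a chain \<Rightarrow> complex" where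
  "chain_log_change g c = (\<Sum>\<sigma>\<in>Poly_Mapping.keys c. of_int (poly_mapping.lookup c \<sigma>) * edge_log_change g \<sigma>)"

lemma chain_log_change_superset:
  assumes "finite A" "Poly_Mapping.keys c \<subseteq> A"
  shows "chain_log_change g c = (\<Sum>\<sigma>\<in>A. of_int (poly_mapping.lookup c \<sigma>) * edge_log_change g \<sigma>)"
  unfolding chain_log_change_def
  by (rule sum.mono_neutral_left) (use assms in \<open>auto simp: in_keys_iff\<close>)

lemma chain_log_change_linear:
  "chain_log_change g (a + b) = chain_log_change g a + chain_log_change g b"
  "chain_log_change g (a - b) = chain_log_change g a - chain_log_change g b"
  "chain_log_change g 0 = 0"
  "chain_log_change g (frag_of \<sigma>) = edge_log_change g \<sigma>"
proof -
  let ?A = "Poly_Mapping.keys a \<union> Poly_Mapping.keys b"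
  have A: "finite ?A" "Poly_Mapping.keys a \<subseteq> ?A" "Poly_Mapping.keys b \<subseteq> ?A"
    "Poly_Mapping.keys (a + b) \<subseteq> ?A" "Poly_Mapping.keys (a - b) \<subseteq> ?A"
    by (simp_all add: Poly_Mapping.keys_add keys_diff)
  show "chain_log_change g (a + b) = chain_log_change g a + chain_log_change g b"
    unfolding chain_log_change_superset[OF A(1,2)] chain_log_change_superset[OF A(1,3)]
      chain_log_change_superset[OF A(1,4)]
    by (simp add: lookup_add algebra_simps sum.distrib)
  show "chain_log_change g (a - b) = chain_log_change g a - chain_log_change g b"
    unfolding chain_log_change_superset[OF A(1,2)] chain_log_change_superset[OF A(1,3)]
      chain_log_change_superset[OF A(1,5)]
    by (simp add: lookup_minus algebra_simps sum_subtractf)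
qed (simp_all add: chain_log_change_def)

text \<open>
  A logarithm exists on the whole triangle, so the changes along the three edges cancel.
\<close>

lemma log_change_boundary_simplex:
  assumes g: "continuous_map X euclidean g" "\<And>x. x \<in> topspace X \<Longrightarrow> g x \<noteq> 0"
    and \<sigma>: "singular_simplex 2 X \<sigma>"
  shows "chain_log_change g (chain_boundary 2 (frag_of \<sigma>)) = 0"
proof -
  have c: "continuous_map (top_of_set triangle) X (\<sigma> \<circ> triangle_point)"
    using \<sigma> continuous_map_compose[OF triangle_point_continuous] by (auto simp: singular_simplex_def)
  then have cg: "continuous_on triangle (\<lambda>p. g (\<sigma> (triangle_point p)))"
    using continuous_map_compose[OF c g(1)] by (simp add: comp_def)
  have ne: "g (\<sigma> (triangle_point p)) \<noteq> 0" if "p \<in> triangle" for p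
    using continuous_map_image_subset_topspace[OF c] that by (intro g(2)) auto
  have "has_log triangle (\<lambda>p. g (\<sigma> (triangle_point p)))"
    by (rule has_log_contractible[OF cg convex_imp_contractible[OF triangle_convex] ne])
  then obtain l where l: "continuous_on triangle l" "\<And>p. p \<in> triangle \<Longrightarrow> g (\<sigma> (triangle_point p)) = exp (l p)"
    unfolding has_log_def by blast
  have in1: "edge_point t \<in> standard_simplex (Suc 0)" if "t \<in> {0..1}" for t
    using that by (auto simp: edge_point_def standard_simplex_def)
  have face: "edge_log_change g (singular_face 2 k \<sigma>) = l (f 1) - l (f 0)"
    if f: "continuous_on {0..1} f" "\<And>t. t \<in> {0..1} \<Longrightarrow> f t \<in> triangle"
      "\<And>t. t \<in> {0..1} \<Longrightarrow> simplical_face k (edge_point t) = triangle_point (f t)" for k f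
    unfolding edge_log_change_def
  proof (rule log_change_eq)
    show "continuous_on {0..1} (\<lambda>t. l (f t))"
      by (rule continuous_on_compose2[OF l(1) f(1)]) (use f(2) in auto)
    show "g (singular_face 2 k \<sigma> (edge_point t)) = exp (l (f t))" if "t \<in> {0..1}" for t
      using that in1[OF that] f(2,3)[OF that] l(2) by (simp add: singular_face_def)
  qed
  have 0: "edge_log_change g (singular_face 2 0 \<sigma>) = l (0, 1) - l (1, 0)"
    by (subst face[of "\<lambda>t. (1 - t, t)"])
      (auto intro!: continuous_intros simp: triangle_def edge_point_def triangle_point_def simplical_face_def fun_eq_iff)
  have 1: "edge_log_change g (singular_face 2 1 \<sigma>) = l (0, 1) - l (0, 0)"
    by (subst face[of "\<lambda>t. (0, t)"])
      (auto intro!: continuous_intros simp: triangle_def edge_point_def triangle_point_def simplical_face_def fun_eq_iff)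
  have 2: "edge_log_change g (singular_face 2 2 \<sigma>) = l (1, 0) - l (0, 0)"
    by (subst face[of "\<lambda>t. (t, 0)"])
      (auto intro!: continuous_intros simp: triangle_def edge_point_def triangle_point_def simplical_face_def fun_eq_iff)
  have "chain_boundary 2 (frag_of \<sigma>) = frag_of (singular_face 2 0 \<sigma>) - frag_of (singular_face 2 1 \<sigma>)
      + frag_of (singular_face 2 2 \<sigma>)"
    by (simp add: chain_boundary_of numeral_2_eq_2 atMost_Suc)
  then show ?thesis
    using 0 1 2 by (simp add: chain_log_change_linear)
qed

lemma log_change_boundary:
  assumes g: "continuous_map X euclidean g" "\<And>x. x \<in> topspace X \<Longrightarrow> g x \<noteq> 0"
    and c: "singular_chain 2 X c"
  shows "chain_log_change g (chain_boundary 2 c) = 0"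
  using c unfolding singular_chain_def
proof (induction c rule: frag_induction)
  case (one \<sigma>)
  then show ?case using log_change_boundary_simplex[OF g] by simp
qed (simp_all add: chain_log_change_linear chain_boundary_diff)

text \<open>
  The loop \<open>t \<mapsto> cis (2 * pi * t)\<close> is a singular cycle of the circle. Its image under \<open>f\<close> bounds a
  singular chain, so the winding cocycle vanishes on it. This says that the winding number of
  \<open>g \<circ> f\<close> is zero, which is the exponent provided by \<open>punctured_map_is_power\<close>.
\<close>

proposition null_homologous_has_log:
  assumes f: "null_homologous X f"
    and g: "continuous_map X euclidean g" "\<And>x. x \<in> topspace X \<Longrightarrow> g x \<noteq> 0"
  shows "has_log circle (\<lambda>a. g (f a))"
proof -
  let ?C = "top_of_set circle"
  have fc: "continuous_map ?C X f" using f by (simp add: null_homologous_def)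
  have fX: "f a \<in> topspace X" if "a \<in> circle" for a
    using continuous_map_image_subset_topspace[OF fc] that by auto
  have cgf: "continuous_on circle (\<lambda>a. g (f a))"
    using continuous_map_compose[OF fc g(1)] by (simp add: comp_def)
  define \<sigma> :: "(nat \<Rightarrow> real) \<Rightarrow> complex" where
    "\<sigma> = restrict (\<lambda>x. cis (2 * pi * x 1)) (standard_simplex 1)"
  have s\<sigma>: "singular_simplex 1 ?C \<sigma>"
    unfolding singular_simplex_def continuous_map_in_subtopology
  proof (intro conjI)
    have "continuous_map (powertop_real UNIV) euclideanreal (\<lambda>x. x (1::nat))"
      by (intro continuous_map_product_projection) auto
    then have "continuous_map (subtopology (powertop_real UNIV) (standard_simplex 1)) euclidean
        ((\<lambda>t. cis (2 * pi * t)) \<circ> (\<lambda>x. x 1))"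
      by (intro continuous_map_compose[of _ euclideanreal] continuous_map_from_subtopology)
        (auto intro!: continuous_intros)
    then show "continuous_map (subtopology (powertop_real UNIV) (standard_simplex 1)) euclidean \<sigma>"
      by (rule continuous_map_eq) (simp add: \<sigma>_def)
  qed (auto simp: \<sigma>_def mem_circle)
  have face: "singular_face 1 k \<sigma> = restrict (\<lambda>_. 1) (standard_simplex 0)" if "k \<le> 1" for k
  proof -
    have "\<sigma> (simplical_face k x) = 1" if x: "x \<in> standard_simplex 0" for x
    proof -
      have "simplical_face k x \<in> standard_simplex 1"
        using simplical_face_in_standard_simplex[of 1 k x] \<open>k \<le> 1\<close> x by simp
      moreover have "simplical_face k x 1 \<in> {0, 1}"
        using x \<open>k \<le> 1\<close> by (auto simp: simplical_face_def standard_simplex_0)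
      ultimately show ?thesis by (auto simp: \<sigma>_def)
    qed
    then show ?thesis by (auto simp: singular_face_def fun_eq_iff restrict_def)
  qed
  have bd: "chain_boundary 1 (frag_of \<sigma>) = 0"
    using face[of 0] face[of 1] by (simp add: chain_boundary_of atMost_Suc)
  have cyc: "singular_relcycle 1 ?C {} (frag_of \<sigma>)"
    using s\<sigma> bd by (simp add: singular_relcycle_def singular_chain_of)
  have "homologous_rel_set 1 ?C {} (frag_of \<sigma>) \<in> carrier (homology_group (int 1) ?C)"
    using cyc carrier_relative_homology_group by blast
  then have "hom_induced (int 1) ?C {} X {} f (homologous_rel_set 1 ?C {} (frag_of \<sigma>)) = \<one>\<^bsub>homology_group (int 1) X\<^esub>"
    using f by (simp add: null_homologous_def trivial_homomorphism_def)
  moreover have "hom_induced (int 1) ?C {} X {} f (homologous_rel_set 1 ?C {} (frag_of \<sigma>))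
      = homologous_rel_set 1 X {} (chain_map 1 f (frag_of \<sigma>))"
    by (rule hom_induced_chain_map[OF fc _ cyc]) auto
  ultimately have "homologous_rel_set 1 X {} (chain_map 1 f (frag_of \<sigma>)) = singular_relboundary_set 1 X {}"
    by (simp only: one_relative_homology_group)
  then have "singular_relboundary 1 X {} (frag_of (simplex_map 1 f \<sigma>))"
    by (simp add: homologous_rel_set_eq_relboundary)
  then obtain c where "singular_chain 2 X c" "chain_boundary 2 c = frag_of (simplex_map 1 f \<sigma>)"
    unfolding singular_boundary by (auto simp: numeral_2_eq_2)
  then have zero: "edge_log_change g (simplex_map 1 f \<sigma>) = 0"
    using log_change_boundary[OF g] by (metis chain_log_change_linear(4))
  let ?Q = "{0::real} \<times> circle"
  obtain a :: int where a: "has_log ?Q (\<lambda>p. g (f (snd p)) * snd p powi a)"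
  proof (rule punctured_map_is_power[of ?Q "\<lambda>p. g (f (snd p))"])
    show "continuous_on ?Q (\<lambda>p. g (f (snd p)))"
      by (rule continuous_on_compose2[OF cgf]) (auto intro!: continuous_intros)
    have eq: "{(y, \<zeta>). (y, exp \<zeta>) \<in> ?Q} = {0} \<times> Re -` {0}" by (auto simp: mem_circle)
    show "convex {(y, \<zeta>). (y, exp \<zeta>) \<in> ?Q}"
      unfolding eq by (intro convex_Times convex_singleton convex_linear_vimage)
        (simp add: bounded_linear.linear bounded_linear_Re)
  qed (use g(2) fX in \<open>auto simp: mem_circle\<close>)
  have "has_log circle (\<lambda>a'. g (f (snd (0::real, a'))) * snd (0::real, a') powi a)"
    by (rule has_log_compose[OF a]) (auto intro!: continuous_intros)
  then have a: "has_log circle (\<lambda>t. g (f t) * t powi a)" by simp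
  then obtain h where h: "continuous_on circle h" "\<And>t. t \<in> circle \<Longrightarrow> g (f t) * t powi a = exp (h t)"
    unfolding has_log_def by blast
  have "edge_log_change g (simplex_map 1 f \<sigma>)
      = (h (cis (2 * pi * 1)) - \<i> * of_int a * of_real (2 * pi * 1)) - (h (cis (2 * pi * 0)) - \<i> * of_int a * of_real (2 * pi * 0))"
    unfolding edge_log_change_def
  proof (rule log_change_eq)
    have "continuous_on {0..1} (\<lambda>t. h (cis (2 * pi * t)))"
      by (rule continuous_on_compose2[OF h(1)]) (auto intro!: continuous_intros simp: mem_circle)
    then show "continuous_on {0..1} (\<lambda>t. h (cis (2 * pi * t)) - \<i> * of_int a * of_real (2 * pi * t))"
      by (intro continuous_intros)
    fix t :: real assume t: "t \<in> {0..1}"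
    have "edge_point t \<in> standard_simplex 1" using t by (auto simp: edge_point_def standard_simplex_def)
    then have v: "simplex_map 1 f \<sigma> (edge_point t) = f (cis (2 * pi * t))"
      by (simp add: simplex_map_def \<sigma>_def) (simp add: edge_point_def)
    have "g (f (cis (2 * pi * t))) * cis (2 * pi * t) powi a = exp (h (cis (2 * pi * t)))"
      by (rule h(2)) (simp add: mem_circle)
    moreover have "cis (2 * pi * t) powi a = exp (\<i> * of_int a * of_real (2 * pi * t))"
      unfolding cis_power_int by (simp add: cis_conv_exp algebra_simps)
    ultimately show "g (simplex_map 1 f \<sigma> (edge_point t))
        = exp (h (cis (2 * pi * t)) - \<i> * of_int a * of_real (2 * pi * t))"
      unfolding v exp_diff by (metis exp_not_eq_zero nonzero_eq_divide_eq)
  qed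
  then have "a = 0" using zero by (simp add: cis_2pi)
  with a show ?thesis by simp
qed

section \<open>Two solid tori glued along a longitude\<close>

lemma cis_image_interval:
  assumes "0 < \<delta>" "\<delta> < pi"
  shows "cis ` {\<beta> - \<delta><..<\<beta> + \<delta>} = {b \<in> circle. cos \<delta> < Re (b * cis (- \<beta>))}"
proof (intro equalityI subsetI)
  fix b assume "b \<in> cis ` {\<beta> - \<delta><..<\<beta> + \<delta>}"
  then obtain t where t: "b = cis t" "\<bar>t - \<beta>\<bar> < \<delta>" by auto
  then have bc: "b \<in> circle" by (simp add: mem_circle)
  have "cos \<delta> < cos \<bar>t - \<beta>\<bar>" by (rule cos_monotone_0_pi) (use t assms in auto)
  moreover have "b * cis (- \<beta>) = cis (t - \<beta>)" by (simp only: t cis_mult diff_conv_add_uminus)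
  ultimately show "b \<in> {b \<in> circle. cos \<delta> < Re (b * cis (- \<beta>))}"
    using bc by (simp only: mem_Collect_eq cis.sel cos_abs_real)
next
  fix b assume b: "b \<in> {b \<in> circle. cos \<delta> < Re (b * cis (- \<beta>))}"
  define t where "t = Arg (b * cis (- \<beta>))"
  have "cmod (b * cis (- \<beta>)) = 1" using b by (simp add: norm_mult mem_circle)
  then have e: "b * cis (- \<beta>) = cis t"
    using Arg_eq[of "b * cis (- \<beta>)"] by (force simp: t_def cis_conv_exp)
  have "\<bar>t\<bar> < \<delta>"
  proof (rule ccontr)
    assume "\<not> \<bar>t\<bar> < \<delta>"
    then have "cos \<bar>t\<bar> \<le> cos \<delta>"
      by (intro cos_monotone_0_pi_le) (use assms Arg_bounded[of "b * cis (- \<beta>)"] in \<open>auto simp: t_def\<close>)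
    moreover have "cos \<delta> < Re (cis t)" using b unfolding mem_Collect_eq e[symmetric] by (rule conjunct2)
    ultimately show False by simp
  qed
  moreover have "b = cis (\<beta> + t)"
  proof -
    have "b = (b * cis (- \<beta>)) * cis \<beta>" by (simp add: mult.assoc cis_mult)
    then show ?thesis unfolding e by (simp add: cis_mult add.commute)
  qed
  ultimately show "b \<in> cis ` {\<beta> - \<delta><..<\<beta> + \<delta>}" by (intro image_eqI[of _ _ "\<beta> + t"]) auto
qed

lemma circle_facts [simp]:
  "compact circle" "connected circle" "cis t \<in> circle" "1 \<in> circle"
  by (auto simp: circle_def connected_sphere)

text \<open>
  A space \<open>M\<close> covered by an open solid torus \<open>j\<close>, parametrised by \<open>S\<^sup>1 \<times> \<complex>\<close>, and a second one \<open>g\<close>,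
  parametrised by \<open>D\<^sup>2 \<times> S\<^sup>1\<close>, of which exactly the core lies outside the first one. The two
  conditions on the longitude \<open>g (\<cdot>, 1)\<close> say that it has winding number zero in the \<open>S\<^sup>1\<close>-direction of
  \<open>j\<close>, and that close to the core it has nonzero winding number around the origin of \<open>\<complex>\<close>.
\<close>

locale torus_filling =
  fixes M :: "'b::real_normed_vector set" and j g :: "complex \<times> complex \<Rightarrow> 'b"
    and ji gi :: "'b \<Rightarrow> complex \<times> complex"
  assumes j_cont: "continuous_on (circle \<times> UNIV) j"
    and ji_j [simp]: "\<And>u x. u \<in> circle \<Longrightarrow> ji (j (u, x)) = (u, x)"
    and ji_cont: "continuous_on (j ` (circle \<times> UNIV)) ji"
    and j_open: "openin (top_of_set M) (j ` (circle \<times> UNIV))"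
    and g_cont: "continuous_on (open_disc \<times> circle) g"
    and gi_g [simp]: "\<And>c b. c \<in> open_disc \<Longrightarrow> b \<in> circle \<Longrightarrow> gi (g (c, b)) = (c, b)"
    and gi_cont: "continuous_on (g ` (open_disc \<times> circle)) gi"
    and g_open: "openin (top_of_set M) (g ` (open_disc \<times> circle))"
    and cover: "M = j ` (circle \<times> UNIV) \<union> g ` (open_disc \<times> circle)"
    and core: "\<And>c b. c \<in> open_disc \<Longrightarrow> b \<in> circle \<Longrightarrow> g (c, b) \<in> j ` (circle \<times> UNIV) \<longleftrightarrow> c \<noteq> 0"
    and longitude_untwisted: "has_log circle (\<lambda>a. fst (ji (g (a / 2, 1))))"
    and longitude_degree: "\<exists>r0>0. \<forall>r c. 0 < r \<longrightarrow> r < r0 \<longrightarrow>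
      has_log circle (\<lambda>a. snd (ji (g (of_real r * a, 1))) powi c) \<longrightarrow> c = (0::int)"
begin

abbreviation outer :: "'b set" where "outer \<equiv> j ` (circle \<times> UNIV)"

lemma j_in [simp]: "u \<in> circle \<Longrightarrow> j (u, x) \<in> outer" by auto

lemma compact_part: "compact (j ` (circle \<times> cball 0 R))"
  by (intro compact_continuous_image compact_Times continuous_on_subset[OF j_cont]) auto

lemma g_in [simp]: "c \<in> open_disc \<Longrightarrow> b \<in> circle \<Longrightarrow> g (c, b) \<in> M"
  using cover by auto

text \<open>
  The angle of the solid torus \<open>j\<close> need not extend continuously to the core, since nothing is known
  about the behaviour of \<open>g\<close> there. However, on the second solid torus without its core the angle has
  winding number zero along the longitude, so it is \<open>b powi e * exp (\<i> * h)\<close> for an integer \<open>e\<close>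
  and a real function \<open>h\<close>. Extending \<open>h\<close> from a neighbourhood of the core to all of \<open>S\<^sup>1 \<times> \<complex>\<close> by Tietze's
  theorem and subtracting it from the angle gives a map that equals \<open>b powi e\<close> near the core.
\<close>

lemma theta_exists:
  obtains \<theta> :: "'b \<Rightarrow> complex" and \<eta> :: "complex \<times> complex \<Rightarrow> real" and e :: int
  where "continuous_on M \<theta>" "\<theta> ` M \<subseteq> circle" "continuous_on (circle \<times> UNIV) \<eta>"
    "\<And>u x. u \<in> circle \<Longrightarrow> \<theta> (j (u, x)) = u * cis (\<eta> (u, x))"
    "\<And>c b. cmod c \<le> 1 / 2 \<Longrightarrow> b \<in> circle \<Longrightarrow> \<theta> (g (c, b)) = b powi e"
proof -
  define U where "U = (\<lambda>(c, b). fst (ji (g (c, b))))"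
  have U_circle: "U (c, b) \<in> circle" if "c \<in> open_disc" "c \<noteq> 0" "b \<in> circle" for c b
    using core[OF that(1,3)] that by (auto simp: U_def)
  let ?D0 = "(open_disc - {0}) \<times> circle"
  have cU: "continuous_on ?D0 U" unfolding U_def case_prod_unfold
    by (intro continuous_intros continuous_on_compose2[OF ji_cont] continuous_on_compose2[OF g_cont])
      (use core in force)+
  let ?Q1 = "{\<zeta>. Re \<zeta> < 0} \<times> circle"
  have ex: "(exp \<zeta>, b) \<in> ?D0" if "(\<zeta>, b) \<in> ?Q1" for \<zeta> b
    using that by (auto simp: mem_open_disc)
  have cU1: "continuous_on ?Q1 (\<lambda>p. U (exp (fst p), snd p))"
    by (rule continuous_on_compose2[OF cU]) (use ex in \<open>auto intro!: continuous_intros\<close>)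
  obtain a :: int where a: "has_log ?Q1 (\<lambda>p. U (exp (fst p), snd p) * snd p powi a)"
  proof (rule punctured_map_is_power[OF cU1])
    show "U (exp (fst p), snd p) \<noteq> 0 \<and> snd p \<noteq> 0" if "p \<in> ?Q1" for p
      using that U_circle[of "exp (fst p)" "snd p"] by (auto simp: mem_open_disc mem_circle)
    have eq: "{(y, \<zeta>). (y, exp \<zeta>) \<in> ?Q1} = (Re -` {..<0}) \<times> (Re -` {0})" by (auto simp: mem_circle)
    show "convex {(y, \<zeta>). (y, exp \<zeta>) \<in> ?Q1}"
      unfolding eq by (intro convex_Times convex_real_interval convex_singleton convex_linear_vimage)
        (simp_all add: bounded_linear.linear bounded_linear_Re)
  qed
  then obtain l where l: "continuous_on ?Q1 l"
      "\<And>p. p \<in> ?Q1 \<Longrightarrow> U (exp (fst p), snd p) * snd p powi a = exp (l p)"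
    unfolding has_log_def by blast
  have con1: "connected ?Q1"
    using convex_connected[OF convex_halfspace_Re_lt[of 0]] by (simp add: connected_Times)
  have cls: "continuous_on ?Q1 (\<lambda>p. l (fst p + 2 * pi * \<i>, snd p))"
    by (rule continuous_on_compose2[OF l(1)]) (auto intro!: continuous_intros)
  obtain n :: int where n: "\<And>p. p \<in> ?Q1 \<Longrightarrow> l (fst p + 2 * pi * \<i>, snd p) = l p + 2 * pi * \<i> * n"
  proof (rule logs_differ_by_period[OF con1 cls l(1)])
    fix p :: "complex \<times> complex" assume p: "p \<in> ?Q1"
    then have "(fst p + 2 * pi * \<i>, snd p) \<in> ?Q1" by auto
    from l(2)[OF this] l(2)[OF p] show "exp (l (fst p + 2 * pi * \<i>, snd p)) = exp (l p)"
      by (simp add: exp_add)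
  qed (use that in blast)
  \<comment> \<open>The shift by \<open>2 * pi * \<i>\<close> runs once along the longitude of radius \<open>1/2\<close>.\<close>
  have "n = 0"
  proof -
    obtain k where k: "continuous_on circle k" "\<And>t. t \<in> circle \<Longrightarrow> fst (ji (g (t / 2, 1))) = exp (k t)"
      using longitude_untwisted unfolding has_log_def by blast
    have neg: "ln (1 / 2 :: real) < 0" by simp
    define z where "z s = complex_of_real (ln (1 / 2)) + \<i> * of_real s" for s :: real
    have z: "(z s, 1) \<in> ?Q1" "exp (z s) = cis s / 2" for s
      using neg by (auto simp: z_def exp_add cis_conv_exp exp_of_real)
    have c1: "continuous_on UNIV (\<lambda>s. l (z s, 1))"
      by (rule continuous_on_compose2[OF l(1)]) (use z in \<open>auto intro!: continuous_intros simp: z_def\<close>)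
    have c2: "continuous_on UNIV (\<lambda>s. k (cis s))"
      by (rule continuous_on_compose2[OF k(1)]) (auto intro!: continuous_intros)
    obtain n' :: int where n': "\<And>s. l (z s, 1) = k (cis s) + 2 * pi * \<i> * n'"
    proof (rule logs_differ_by_period[OF connected_UNIV c1 c2])
      show "exp (l (z s, 1)) = exp (k (cis s))" for s
        using l(2)[OF z(1), of s] k(2)[of "cis s"] by (simp add: z(2) U_def)
    qed (use that in blast)
    have "z (2 * pi) = z 0 + 2 * pi * \<i>" by (simp add: z_def)
    then have "l (z (2 * pi), 1) = l (z 0, 1) + 2 * pi * \<i> * n" using n[OF z(1)[of 0]] by simp
    then show ?thesis using n'[of 0] n'[of "2 * pi"] by (simp add: cis_2pi)
  qed
  let ?Q = "{(b, c). (c, b) \<in> ?D0}"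
  have Qeq: "{(b, \<zeta>). (b, exp \<zeta>) \<in> ?Q} = {(b, \<zeta>). (\<zeta>, b) \<in> ?Q1}" by (auto simp: mem_open_disc)
  obtain h where h: "continuous_on ?Q h" "\<And>b \<zeta>. (b, exp \<zeta>) \<in> ?Q \<Longrightarrow> h (b, exp \<zeta>) = l (\<zeta>, b)"
  proof (rule continuous_periodic_descends[of ?Q "\<lambda>(b, \<zeta>). l (\<zeta>, b)"])
    show "continuous_on {(b, \<zeta>). (b, exp \<zeta>) \<in> ?Q} (\<lambda>(b, \<zeta>). l (\<zeta>, b))"
      unfolding Qeq case_prod_unfold
      by (rule continuous_on_compose2[OF l(1)]) (auto intro!: continuous_intros simp: mem_open_disc)
    fix b \<zeta> assume "(b, exp \<zeta>) \<in> ?Q"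
    then have "(\<zeta>, b) \<in> ?Q1" by (auto simp: mem_open_disc)
    from n[OF this] \<open>n = 0\<close>
    show "(case (b, \<zeta> + 2 * pi * \<i>) of (b, \<zeta>) \<Rightarrow> l (\<zeta>, b)) = (case (b, \<zeta>) of (b, \<zeta>) \<Rightarrow> l (\<zeta>, b))"
      by simp
  qed (use that in auto)
  define e where "e = - a"
  have U_eq: "U (c, b) = b powi e * cis (Im (h (b, c)))" if D: "c \<in> open_disc" "c \<noteq> 0" "b \<in> circle" for c b
  proof -
    obtain \<zeta> where z: "c = exp \<zeta>" using D(2) by (metis exp_Ln)
    have Q: "(\<zeta>, b) \<in> ?Q1" using D z by (auto simp: mem_open_disc)
    have e1: "U (c, b) * b powi a = exp (h (b, c))"
      using l(2)[OF Q] h(2)[of b \<zeta>] D z by auto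
    have "cmod (U (c, b) * b powi a) = 1"
      using U_circle[OF D] D(3) by (simp add: norm_mult norm_power_int mem_circle)
    then have "Re (h (b, c)) = 0" using e1 by simp
    then have "exp (h (b, c)) = cis (Im (h (b, c)))" by (simp add: exp_eq_polar)
    moreover have "b powi a * b powi e = 1"
    proof -
      have "b \<noteq> 0" using D(3) by (auto simp: mem_circle)
      then have "b powi (a + e) = b powi a * b powi e" by (simp add: power_int_add)
      then show ?thesis by (simp add: e_def)
    qed
    ultimately show ?thesis using e1 by (metis mult.assoc mult.commute mult.right_neutral)
  qed
  let ?B = "g ` (cball 0 (1/2) \<times> circle)"
  have half: "cball 0 (1/2) \<subseteq> open_disc" by (auto simp: open_disc_def)
  have "compact ?B"
    by (intro compact_continuous_image compact_Times continuous_on_subset[OF g_cont])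
      (use half in auto)
  then have clB: "closed ?B" by (rule compact_imp_closed)
  let ?N = "circle \<times> (UNIV :: complex set)"
  let ?Z = "?N \<inter> j -` ?B"
  have clZ: "closedin (top_of_set ?N) ?Z" by (rule continuous_closedin_preimage[OF j_cont clB])
  have Zgi: "(snd (gi (j p)), fst (gi (j p))) \<in> ?Q \<and> j p = g (gi (j p))" if p: "p \<in> ?Z" for p
  proof -
    obtain c b where cb: "j p = g (c, b)" "cmod c \<le> 1/2" "b \<in> circle" using p by auto
    then have c: "c \<in> open_disc" by (simp add: mem_open_disc)
    have "j p \<in> outer" using p by auto
    then have "c \<noteq> 0" using core[OF c cb(3)] cb(1) by simp
    then show ?thesis using cb c by simp
  qed
  have cgi: "continuous_on ?Z (\<lambda>p. gi (j p))"
    by (rule continuous_on_compose2[OF gi_cont continuous_on_subset[OF j_cont]]) (use half in auto)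
  have "continuous_on ?Z (\<lambda>p. h (snd (gi (j p)), fst (gi (j p))))"
  proof (rule continuous_on_compose2[OF h(1)])
    show "continuous_on ?Z (\<lambda>p. (snd (gi (j p)), fst (gi (j p))))" by (intro continuous_intros cgi)
    show "(\<lambda>p. (snd (gi (j p)), fst (gi (j p)))) ` ?Z \<subseteq> ?Q"
      by (rule image_subsetI) (rule conjunct1[OF Zgi])
  qed
  then have cIm: "continuous_on ?Z (\<lambda>p. Im (h (snd (gi (j p)), fst (gi (j p)))))"
    by (intro continuous_intros)
  obtain \<eta>0 where \<eta>0: "continuous_on ?N \<eta>0"
      "\<And>p. p \<in> ?Z \<Longrightarrow> \<eta>0 p = Im (h (snd (gi (j p)), fst (gi (j p))))"
    using Tietze_unbounded[OF cIm clZ] by blast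
  \<comment> \<open>On the core \<open>ji\<close> is meaningless; the other formula is used there only.\<close>
  define \<theta> where "\<theta> y = (if y \<in> outer then fst (ji y) * cis (- \<eta>0 (ji y)) else snd (gi y) powi e)" for y
  have \<theta>g: "\<theta> (g (c, b)) = b powi e" if c: "cmod c \<le> 1 / 2" and b: "b \<in> circle" for c b
  proof (cases "c = 0")
    case True
    then show ?thesis using core[of 0 b] b by (simp add: \<theta>_def mem_open_disc)
  next
    case False
    have cD: "c \<in> open_disc" using c by (simp add: mem_open_disc)
    then obtain u x where ux: "g (c, b) = j (u, x)" "u \<in> circle" using core[OF cD b] False by auto
    have "(u, x) \<in> ?Z" using ux b c by (auto simp flip: ux(1))
    then have "\<eta>0 (u, x) = Im (h (b, c))" using \<eta>0(2)[of "(u, x)"] cD b by (simp flip: ux(1))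
    moreover have "U (c, b) = u" using ux by (simp add: U_def)
    moreover have "b powi e * cis k * cis (- k) = b powi e" for k
      by (simp only: mult.assoc cis_mult) simp
    ultimately have "u * cis (- \<eta>0 (u, x)) = b powi e"
      using U_eq[OF cD False b] by metis
    then show ?thesis
      using ux by (simp add: \<theta>_def)
  qed
  have c1: "continuous_on outer \<theta>"
  proof (rule continuous_on_eq)
    show "continuous_on outer (\<lambda>y. fst (ji y) * cis (- \<eta>0 (ji y)))"
      by (intro continuous_intros ji_cont continuous_on_compose2[OF \<eta>0(1) ji_cont]) auto
  qed (simp add: \<theta>_def)
  let ?V = "g ` (ball 0 (1/2) \<times> circle)"
  have hb: "ball 0 (1/2) \<times> circle \<subseteq> open_disc \<times> circle" by (auto simp: open_disc_def)
  have c2: "continuous_on ?V \<theta>"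
  proof (rule continuous_on_eq)
    show "continuous_on ?V (\<lambda>y. snd (gi y) powi e)"
    proof (rule continuous_on_power_int)
      show "continuous_on ?V (\<lambda>y. snd (gi y))"
        by (intro continuous_intros continuous_on_subset[OF gi_cont image_mono[OF hb]])
      have "snd (gi y) \<noteq> 0" if y: "y \<in> ?V" for y
      proof -
        obtain c b where "y = g (c, b)" "c \<in> open_disc" "b \<in> circle" using y hb by blast
        then show ?thesis by (auto simp: mem_circle)
      qed
      then show "0 \<le> e \<or> (\<forall>y\<in>?V. snd (gi y) \<noteq> 0)" by blast
    qed
    show "snd (gi y) powi e = \<theta> y" if "y \<in> ?V" for y
      using that \<theta>g by (auto simp: mem_open_disc)
  qed
  have oV: "openin (top_of_set M) ?V"
  proof -
    have "openin (top_of_set (g ` (open_disc \<times> circle))) (g ` (open_disc \<times> circle) \<inter> gi -` (ball 0 (1/2) \<times> UNIV))"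
      by (rule continuous_openin_preimage_gen[OF gi_cont]) (intro open_Times open_ball open_UNIV)
    moreover have "g ` (open_disc \<times> circle) \<inter> gi -` (ball 0 (1/2) \<times> UNIV) = ?V"
      using hb by (force simp: open_disc_def)
    ultimately show ?thesis using openin_trans[OF _ g_open] by metis
  qed
  have MV: "M = outer \<union> ?V"
  proof
    show "M \<subseteq> outer \<union> ?V"
    proof
      fix y assume y: "y \<in> M"
      show "y \<in> outer \<union> ?V"
      proof (cases "y \<in> outer")
        case False
        then obtain c b where cb: "y = g (c, b)" "c \<in> open_disc" "b \<in> circle" using y cover by auto
        then have "c = 0" using core[of c b] False by auto
        then show ?thesis using cb by auto
      qed simp
    qed
    show "outer \<union> ?V \<subseteq> M" using cover hb by blast
  qed
  have c\<theta>: "continuous_on M \<theta>"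
    using continuous_on_Un_local_open[of outer ?V \<theta>] j_open oV c1 c2 MV by metis
  have \<theta>j: "\<theta> (j (u, x)) = u * cis (- \<eta>0 (u, x))" if "u \<in> circle" for u x
    using that by (simp add: \<theta>_def)
  have \<theta>M: "\<theta> ` M \<subseteq> circle"
  proof (rule image_subsetI)
    fix y assume "y \<in> M"
    then consider u x where "y = j (u, x)" "u \<in> circle" | c b where "y = g (c, b)" "cmod c < 1/2" "b \<in> circle"
      unfolding MV by auto
    then show "\<theta> y \<in> circle"
    proof cases
      case 1 then show ?thesis using \<theta>j by (simp add: mem_circle norm_mult)
    next
      case 2 then show ?thesis using \<theta>g[of c b] by (simp add: mem_circle norm_power_int)
    qed
  qed
  show ?thesis
    by (rule that[of \<theta> "\<lambda>p. - \<eta>0 p" e]) (use c\<theta> \<theta>M \<theta>j \<theta>g in \<open>auto intro!: continuous_intros \<eta>0\<close>)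
qed

end

section \<open>The infinite cyclic cover\<close>

lemma cis_inj_near:
  assumes "cis s = cis t" "\<bar>s - t\<bar> < 2 * pi"
  shows "s = t"
proof -
  have "cis (s - t) = 1" using assms(1) by (simp flip: cis_divide)
  then have "cos (s - t) = 1" by (simp add: complex_eq_iff)
  then obtain n :: int where n: "s - t = of_int n * 2 * pi" using cos_one_2pi_int by blast
  have "\<bar>of_int n\<bar> * (2 * pi) < 1 * (2 * pi)" using assms(2) unfolding n by (simp add: abs_mult)
  then have "\<bar>of_int n\<bar> < (1::real)" by (rule mult_right_less_imp_less) simp
  then have "n = 0" by linarith
  then show ?thesis using n by simp
qed

locale filling_with_angle = torus_filling M j g ji gi
  for M :: "'b::real_normed_vector set" and j g ji gi +
  fixes \<theta> :: "'b \<Rightarrow> complex" and \<eta> :: "complex \<times> complex \<Rightarrow> real" and e :: int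
  assumes \<theta>_cont: "continuous_on M \<theta>" and \<theta>_circle: "\<theta> ` M \<subseteq> circle"
    and \<eta>_cont: "continuous_on (circle \<times> UNIV) \<eta>"
    and \<theta>_j: "\<And>u x. u \<in> circle \<Longrightarrow> \<theta> (j (u, x)) = u * cis (\<eta> (u, x))"
    and \<theta>_g: "\<And>c b. cmod c \<le> 1 / 2 \<Longrightarrow> b \<in> circle \<Longrightarrow> \<theta> (g (c, b)) = b powi e"
begin

text \<open>
  The pull-back of the cover \<open>cis\<close> of the circle along \<open>\<theta>\<close>, an infinite cyclic cover of \<open>M\<close>.
  As \<open>\<theta>\<close> is the angle only up to \<open>\<eta>\<close>, the lift \<open>J\<close> of the solid torus is sheared by \<open>\<eta>\<close>.
\<close>

definition unwound :: "(real \<times> 'b) set" where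
  "unwound = {(s, y). y \<in> M \<and> cis s = \<theta> y}"

definition J :: "real \<times> complex \<Rightarrow> real \<times> 'b" where
  "J = (\<lambda>(s, x). (s + \<eta> (cis s, x), j (cis s, x)))"

definition Ji :: "real \<times> 'b \<Rightarrow> real \<times> complex" where
  "Ji = (\<lambda>(s, y). (s - \<eta> (ji y), snd (ji y)))"

lemma outer_subset: "outer \<subseteq> M" using cover by auto

lemma J_unwound: "J p \<in> unwound"
  using outer_subset by (cases p) (auto simp: J_def unwound_def \<theta>_j cis_mult)

lemma Ji_J_eq: "Ji (J p) = p"
  by (cases p) (simp add: J_def Ji_def)

lemma range_J: "range J = {q \<in> unwound. snd q \<in> outer}"
proof (intro equalityI subsetI)
  fix q assume "q \<in> range J"
  then show "q \<in> {q \<in> unwound. snd q \<in> outer}" using J_unwound by (auto simp: J_def)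
next
  fix q assume "q \<in> {q \<in> unwound. snd q \<in> outer}"
  then obtain s u x where q: "q = (s, j (u, x))" "u \<in> circle" "cis s = u * cis (\<eta> (u, x))"
    by (auto simp: unwound_def \<theta>_j)
  have "cis (s - \<eta> (u, x)) = cis s * cis (- \<eta> (u, x))" by (simp add: cis_mult)
  also have "\<dots> = u * (cis (\<eta> (u, x)) * cis (- \<eta> (u, x)))" unfolding q(3) by (simp only: mult.assoc)
  also have "\<dots> = u" unfolding cis_mult by simp
  finally have "J (s - \<eta> (u, x), x) = q" using q(1) by (simp add: J_def)
  then show "q \<in> range J" by (metis rangeI)
qed

lemma J_continuous: "continuous_on UNIV J"
  unfolding J_def case_prod_unfold
  by (intro continuous_intros continuous_on_compose2[OF \<eta>_cont] continuous_on_compose2[OF j_cont]) auto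

lemma Ji_continuous: "continuous_on (range J) Ji"
proof -
  have c: "continuous_on (range J) (\<lambda>q. ji (snd q))"
    by (rule continuous_on_compose2[OF ji_cont]) (auto simp: range_J intro!: continuous_intros)
  show ?thesis
    unfolding Ji_def case_prod_unfold
    by (intro continuous_intros continuous_on_compose2[OF \<eta>_cont c] c) (auto simp: range_J)
qed

lemma openin_unwound_snd:
  assumes "openin (top_of_set M) W"
  shows "openin (top_of_set unwound) {q \<in> unwound. snd q \<in> W}"
proof -
  obtain O' where O': "open O'" "W = M \<inter> O'" using assms by (auto simp: openin_open)
  have eq: "{q \<in> unwound. snd q \<in> W} = unwound \<inter> snd -` O'" by (auto simp: O' unwound_def)
  show ?thesis unfolding eq by (intro openin_open_Int open_vimage_snd O')
qed

lemma core_point: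
  assumes "y \<in> M - outer"
  obtains b where "b \<in> circle" "y = g (0, b)"
proof -
  obtain c b where cb: "y = g (c, b)" "c \<in> open_disc" "b \<in> circle" using assms cover by auto
  then have "c = 0" using core assms by auto
  then show ?thesis using cb that by auto
qed

lemma zero_in_disc [simp]: "0 \<in> open_disc" by (simp add: mem_open_disc)

lemma far_near_core:
  assumes "q \<in> range J" "snd q \<notin> j ` (circle \<times> cball 0 R)"
  shows "R < cmod (snd (Ji q))"
proof -
  obtain u x where ux: "u \<in> circle" "snd q = j (u, x)" using assms(1) by (auto simp: range_J)
  then have "x \<notin> cball 0 R" using assms(2) by auto
  then show ?thesis using ux by (simp add: Ji_def case_prod_unfold)
qed

lemma unwound_escape:
  assumes p: "p \<in> unwound - range J"
  shows "eventually (\<lambda>q. q \<in> range J \<longrightarrow> R < cmod (snd (Ji q))) (at p within unwound)"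
proof -
  let ?K = "j ` (circle \<times> cball 0 R)"
  have cl: "closed ?K" by (rule compact_imp_closed[OF compact_part])
  have "snd p \<notin> ?K" using p by (auto simp: range_J)
  then show ?thesis
    unfolding eventually_at_topological
  proof (intro exI[of _ "snd -` (- ?K)"] conjI ballI impI)
    show "open (snd -` (- ?K) :: (real \<times> 'b) set)" using cl by (intro open_vimage_snd) auto
    show "R < cmod (snd (Ji q))" if "q \<in> snd -` (- ?K)" "q \<in> range J" for q
      by (rule far_near_core) (use that in auto)
  qed auto
qed

text \<open>
  On the meridian disc \<open>g (\<cdot>, 1)\<close> the map \<open>\<theta>\<close> is \<open>1\<close> near the core, so a small disc lifts to the level \<open>0\<close>.
\<close>

lemma unwound_meridian_disc:
  "\<exists>f \<sigma> \<xi>. continuous_on (cball 0 1) f \<and> f ` cball 0 1 \<subseteq> unwound \<and>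
      (\<forall>c\<in>cball 0 1. f c \<in> range J \<longrightarrow> R < cmod (snd (Ji (f c)))) \<and>
      (\<forall>a\<in>sphere (0::complex) 1. f a = J (\<sigma> a, \<xi> a)) \<and>
      (\<forall>c::int. has_log (sphere 0 1) (\<lambda>a. \<xi> a powi c) \<longrightarrow> c = 0)"
proof -
  let ?K = "j ` (circle \<times> cball 0 R)"
  have clK: "closed ?K" by (rule compact_imp_closed[OF compact_part])
  obtain r0 where r0: "r0 > 0" "\<And>r c. 0 < r \<Longrightarrow> r < r0 \<Longrightarrow>
      has_log circle (\<lambda>a. snd (ji (g (of_real r * a, 1))) powi c) \<Longrightarrow> c = (0::int)"
    using longitude_degree by blast
  have cg1: "continuous_on open_disc (\<lambda>c. g (c, 1))"
    by (rule continuous_on_compose2[OF g_cont]) (auto intro!: continuous_intros)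
  have op: "open (open_disc \<inter> (\<lambda>c. g (c, 1)) -` (- ?K))"
    by (rule continuous_open_preimage[OF cg1]) (use clK in \<open>auto simp: open_disc_def\<close>)
  have "0 \<in> open_disc \<inter> (\<lambda>c. g (c, 1)) -` (- ?K)" using core[of 0 1] by auto
  then obtain r1 where r1: "r1 > 0" "ball 0 r1 \<subseteq> open_disc \<inter> (\<lambda>c. g (c, 1)) -` (- ?K)"
    using op unfolding open_contains_ball by blast
  define r where "r = min (min r0 r1) 1 / 2"
  have r: "0 < r" "r < r0" "r < r1" "r \<le> 1/2" using r0(1) r1(1) by (auto simp: r_def)
  define f where "f c = (0 :: real, g (of_real r * c, 1))" for c
  have small: "of_real r * c \<in> ball 0 r1 \<and> cmod (of_real r * c) \<le> 1/2" if "c \<in> cball 0 1" for c :: complex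
  proof -
    have "cmod (of_real r * c) \<le> r * 1" unfolding norm_mult
      by (intro mult_mono) (use that r in auto)
    then show ?thesis using r by simp
  qed
  have disc: "of_real r * c \<in> open_disc" if "c \<in> cball 0 1" for c :: complex
    using small[OF that] by (simp add: mem_open_disc)
  have fX: "f c \<in> unwound" if "c \<in> cball 0 1" for c
    using small[OF that] disc[OF that] by (simp add: f_def unwound_def \<theta>_g)
  have far: "R < cmod (snd (Ji (f c)))" if c: "c \<in> cball 0 1" and J: "f c \<in> range J" for c
  proof (rule far_near_core[OF J])
    show "snd (f c) \<notin> ?K" using small[OF c] r1(2) unfolding f_def by auto
  qed
  have bd: "f a \<in> range J" if a: "a \<in> sphere 0 1" for a
    using fX[of a] core[OF disc, of a 1] a r by (auto simp: range_J f_def)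
  have cf: "continuous_on (cball 0 1) f"
    unfolding f_def by (intro continuous_intros continuous_on_compose2[OF cg1]) (use disc in auto)
  show ?thesis
  proof (intro exI[of _ f] exI[of _ "\<lambda>a. fst (Ji (f a))"] exI[of _ "\<lambda>a. snd (Ji (f a))"] conjI ballI allI impI)
    show "f a = J (fst (Ji (f a)), snd (Ji (f a)))" if "a \<in> sphere 0 1" for a
      using bd[OF that] Ji_J_eq by auto
    fix c :: int assume "has_log (sphere 0 1) (\<lambda>a. snd (Ji (f a)) powi c)"
    then have "has_log circle (\<lambda>a. snd (ji (g (of_real r * a, 1))) powi c)"
      by (simp add: f_def Ji_def circle_def)
    then show "c = 0" using r0(2) r by blast
  qed (use cf fX far in auto)
qed

text \<open>
  Near the core, \<open>\<theta> (g (c, b)) = b powi e\<close>, so the cover has the explicit local parametrisation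
  \<open>\<psi>\<close> below, in which the core is the set \<open>c = 0\<close>.
\<close>

lemma unwound_local_end:
  assumes p: "p \<in> unwound - range J" and U: "openin (top_of_set unwound) U" "p \<in> U"
  shows "\<exists>V. openin (top_of_set unwound) V \<and> p \<in> V \<and> V \<subseteq> U \<and> connected (V \<inter> range J) \<and> V \<inter> range J \<noteq> {}"
proof -
  obtain s0 y0 where sy: "p = (s0, y0)" by (cases p)
  have "y0 \<in> M - outer" using p sy by (auto simp: range_J unwound_def)
  then obtain b0 where b0: "b0 \<in> circle" "y0 = g (0, b0)" by (rule core_point)
  define \<beta> where "\<beta> = Arg b0"
  have b\<beta>: "b0 = cis \<beta>"
    using b0(1) Arg_eq[of b0] by (force simp: mem_circle \<beta>_def cis_conv_exp)
  have s0: "cis s0 = cis (of_int e * \<beta>)"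
    using p sy b0 by (auto simp: unwound_def \<theta>_g b\<beta> cis_power_int)
  define \<psi> where "\<psi> = (\<lambda>(c, t). (s0 + of_int e * (t - \<beta>), g (c, cis t)))"
  have \<psi>0: "\<psi> (0, \<beta>) = p" by (simp add: \<psi>_def sy b0 b\<beta>)
  have c\<psi>: "continuous_on (open_disc \<times> UNIV) \<psi>"
    unfolding \<psi>_def case_prod_unfold
    by (intro continuous_intros continuous_on_compose2[OF g_cont]) auto
  have cis_shift: "cis (s0 + of_int e * (t - \<beta>)) = cis t powi e" for t
  proof -
    have "cis (s0 + of_int e * (t - \<beta>)) = cis s0 * cis (of_int e * (t - \<beta>))" by (simp only: cis_mult)
    also have "\<dots> = cis (of_int e * t)" unfolding s0 cis_mult by (simp add: algebra_simps)
    finally show ?thesis by (simp add: cis_power_int)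
  qed
  have \<psi>X: "\<psi> (c, t) \<in> unwound" if "cmod c \<le> 1/2" for c t
    using that cis_shift by (simp add: \<psi>_def unwound_def \<theta>_g mem_open_disc)
  obtain O' where O': "open O'" "U = unwound \<inter> O'" using U(1) by (auto simp: openin_open)
  let ?W = "(open_disc \<times> UNIV) \<inter> \<psi> -` O'"
  have oW: "open ?W"
    by (rule continuous_open_preimage[OF c\<psi>]) (auto simp: open_disc_def O' open_Times)
  have "(0, \<beta>) \<in> ?W" using \<psi>0 U O' by simp
  with oW obtain A B where AB': "open A" "open B" "(0, \<beta>) \<in> A \<times> B" "A \<times> B \<subseteq> ?W"
    by (rule open_prod_elim)
  then have AB: "open A" "open B" "0 \<in> A" "\<beta> \<in> B" "A \<times> B \<subseteq> ?W" by auto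
  obtain d1 where d1: "d1 > 0" "ball 0 d1 \<subseteq> A" using AB open_contains_ball by blast
  obtain d2 where d2: "d2 > 0" "ball \<beta> d2 \<subseteq> B" using AB open_contains_ball by blast
  \<comment> \<open>The bound keeps \<open>e * (t - \<beta>)\<close> below 1 on the neighbourhood, so that the first coordinate is determined by its
      image under \<open>cis\<close>.\<close>
  define \<mu> :: real where "\<mu> = 1 / (2 + \<bar>of_int e\<bar>)"
  have \<mu>: "0 < \<mu>" "\<mu> \<le> 1 / 2" "\<bar>of_int e\<bar> * \<mu> < 1"
    unfolding \<mu>_def by (simp, rule divide_left_mono, auto simp: field_simps)
  define d where "d = min (min d1 d2) \<mu>"
  have "\<bar>of_int e\<bar> * d \<le> \<bar>of_int e\<bar> * \<mu>" by (rule mult_left_mono) (auto simp: d_def)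
  then have d: "d > 0" "d \<le> d1" "d \<le> d2" "d \<le> 1/2" "\<bar>of_int e\<bar> * d < 1"
    using d1(1) d2(1) \<mu> by (auto simp: d_def)
  let ?I = "{\<beta> - d<..<\<beta> + d}"
  define V where "V = \<psi> ` (ball 0 d \<times> ?I)"
  have sub: "ball 0 d \<times> ?I \<subseteq> A \<times> B"
  proof -
    have "?I \<subseteq> ball \<beta> d2" using d by (auto simp: dist_real_def)
    moreover have "ball 0 d \<subseteq> ball (0::complex) d1" using d by (simp add: subset_ball)
    ultimately show ?thesis using d1(2) d2(2) by (meson Sigma_mono order_trans)
  qed
  have VU: "V \<subseteq> U"
  proof
    fix q assume "q \<in> V"
    then obtain c t where ct: "q = \<psi> (c, t)" "(c, t) \<in> ball 0 d \<times> ?I" by (auto simp: V_def)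
    then have "\<psi> (c, t) \<in> O'" using sub AB(5) by blast
    moreover have "\<psi> (c, t) \<in> unwound" using ct d by (intro \<psi>X) auto
    ultimately show "q \<in> U" using ct O' by simp
  qed
  have pV: "p \<in> V" using \<psi>0 d by (force simp: V_def)
  have dsub: "ball 0 d \<subseteq> open_disc" using d by (auto simp: open_disc_def)
  have V_eq: "V = {q \<in> unwound. snd q \<in> g ` (ball 0 d \<times> cis ` ?I)} \<inter> {q. \<bar>fst q - s0\<bar> < pi}"
  proof (intro equalityI subsetI)
    fix q assume "q \<in> V"
    then obtain c t where ct: "q = \<psi> (c, t)" "c \<in> ball 0 d" "t \<in> ?I" by (auto simp: V_def)
    have "\<bar>of_int e * (t - \<beta>)\<bar> \<le> \<bar>of_int e\<bar> * d"
      unfolding abs_mult by (rule mult_left_mono) (use ct in auto)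
    then have "\<bar>fst q - s0\<bar> < pi" using d(5) pi_gt3 by (simp add: ct \<psi>_def)
    moreover have "q \<in> unwound" using VU O' \<open>q \<in> V\<close> by auto
    moreover have "snd q \<in> g ` (ball 0 d \<times> cis ` ?I)" using ct by (auto simp: \<psi>_def)
    ultimately show "q \<in> {q \<in> unwound. snd q \<in> g ` (ball 0 d \<times> cis ` ?I)} \<inter> {q. \<bar>fst q - s0\<bar> < pi}"
      by simp
  next
    fix q assume q: "q \<in> {q \<in> unwound. snd q \<in> g ` (ball 0 d \<times> cis ` ?I)} \<inter> {q. \<bar>fst q - s0\<bar> < pi}"
    then obtain c t where ct: "snd q = g (c, cis t)" "c \<in> ball 0 d" "t \<in> ?I" by auto
    have "cis (fst q) = cis (s0 + of_int e * (t - \<beta>))"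
      using q ct d by (auto simp: unwound_def \<theta>_g cis_shift)
    moreover have "\<bar>of_int e * (t - \<beta>)\<bar> \<le> \<bar>of_int e\<bar> * d"
      unfolding abs_mult by (rule mult_left_mono) (use ct in auto)
    ultimately have "fst q = s0 + of_int e * (t - \<beta>)"
    proof (intro cis_inj_near)
      assume a: "\<bar>of_int e * (t - \<beta>)\<bar> \<le> \<bar>of_int e\<bar> * d"
      then show "\<bar>fst q - (s0 + of_int e * (t - \<beta>))\<bar> < 2 * pi" using q d(5) pi_gt3 by auto
    qed
    then have "q = \<psi> (c, t)" using ct by (simp add: \<psi>_def prod_eq_iff)
    then show "q \<in> V" using ct by (auto simp: V_def)
  qed
  have oV: "openin (top_of_set unwound) V"
  proof -
    have "openin (top_of_set (g ` (open_disc \<times> circle)))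
        (g ` (open_disc \<times> circle) \<inter> gi -` (ball 0 d \<times> {b. cos d < Re (b * cis (- \<beta>))}))"
      by (rule continuous_openin_preimage_gen[OF gi_cont])
        (intro open_Times open_ball open_Collect_less continuous_intros)
    moreover have "g ` (open_disc \<times> circle) \<inter> gi -` (ball 0 d \<times> {b. cos d < Re (b * cis (- \<beta>))})
        = g ` (ball 0 d \<times> cis ` ?I)"
    proof -
      have I: "cis ` ?I = {b \<in> circle. cos d < Re (b * cis (- \<beta>))}"
        by (rule cis_image_interval) (use d pi_gt3 in auto)
      show ?thesis unfolding I
      proof (intro equalityI subsetI)
        fix y assume "y \<in> g ` (open_disc \<times> circle) \<inter> gi -` (ball 0 d \<times> {b. cos d < Re (b * cis (- \<beta>))})"
        then show "y \<in> g ` (ball 0 d \<times> {b \<in> circle. cos d < Re (b * cis (- \<beta>))})"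
          by (auto simp del: times_complex.sel)
      next
        fix y assume "y \<in> g ` (ball 0 d \<times> {b \<in> circle. cos d < Re (b * cis (- \<beta>))})"
        then obtain c b where "y = g (c, b)" "c \<in> ball 0 d" "b \<in> circle" "cos d < Re (b * cis (- \<beta>))" by blast
        moreover have "c \<in> open_disc" using calculation dsub by blast
        ultimately show "y \<in> g ` (open_disc \<times> circle) \<inter> gi -` (ball 0 d \<times> {b. cos d < Re (b * cis (- \<beta>))})"
          by (auto simp del: times_complex.sel)
      qed
    qed
    ultimately have "openin (top_of_set M) (g ` (ball 0 d \<times> cis ` ?I))"
      using openin_trans[OF _ g_open] by metis
    then have 1: "openin (top_of_set unwound) {q \<in> unwound. snd q \<in> g ` (ball 0 d \<times> cis ` ?I)}"
      by (rule openin_unwound_snd)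
    have "open {q :: real \<times> 'b. \<bar>fst q - s0\<bar> < pi}" by (intro open_Collect_less continuous_intros)
    then show ?thesis unfolding V_eq by (rule openin_Int_open[OF 1])
  qed
  have VJ: "V \<inter> range J = \<psi> ` ((ball 0 d - {0}) \<times> ?I)"
  proof (intro equalityI subsetI)
    fix q assume q: "q \<in> V \<inter> range J"
    have "q \<in> V" using q by simp
    then obtain c t where ct: "q = \<psi> (c, t)" "c \<in> ball 0 d" "t \<in> ?I" by (auto simp: V_def)
    have "g (c, cis t) \<in> outer" using q ct by (auto simp: range_J \<psi>_def)
    then have "c \<noteq> 0" using core[of c "cis t"] ct dsub by auto
    then show "q \<in> \<psi> ` ((ball 0 d - {0}) \<times> ?I)" using ct by auto
  next
    fix q assume "q \<in> \<psi> ` ((ball 0 d - {0}) \<times> ?I)"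
    then obtain c t where ct: "q = \<psi> (c, t)" "c \<in> ball 0 d" "c \<noteq> 0" "t \<in> ?I" by blast
    then have V: "q \<in> V" by (auto simp: V_def)
    have "g (c, cis t) \<in> outer" using core[of c "cis t"] ct dsub by auto
    then show "q \<in> V \<inter> range J" using V VU O' ct by (auto simp: range_J \<psi>_def)
  qed
  have "connected ((ball 0 d - {0 :: complex}) \<times> ?I)"
    unfolding connected_Times by (simp add: connected_punctured_ball)
  then have "connected (V \<inter> range J)" unfolding VJ
    by (rule connected_continuous_image[rotated]) (rule continuous_on_subset[OF c\<psi>], use dsub in auto)
  moreover have "V \<inter> range J \<noteq> {}"
  proof -
    have "(of_real (d / 2), \<beta>) \<in> (ball 0 d - {0 :: complex}) \<times> ?I" using d by auto
    then show ?thesis unfolding VJ by blast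
  qed
  ultimately show ?thesis
    using oV pV VU by blast
qed

lemma is_cyclic_cover: "cyclic_cover unwound J Ji"
proof
  show "continuous_on UNIV J" by (rule J_continuous)
  show "J p \<in> unwound" for p by (rule J_unwound)
  show "Ji (J p) = p" for p by (rule Ji_J_eq)
  show "continuous_on (range J) Ji" by (rule Ji_continuous)
  show "openin (top_of_set unwound) (range J)"
    unfolding range_J by (rule openin_unwound_snd[OF j_open])
qed (rule unwound_escape unwound_meridian_disc unwound_local_end; assumption)+

end

section \<open>The surgery on the braid axis\<close>

lemma open_embedding_inverse:
  assumes "open_embedding (top_of_set S) (top_of_set T) f"
  obtains f' where "continuous_on S f" "f ` S \<subseteq> T" "openin (top_of_set T) (f ` S)"
    "continuous_on (f ` S) f'" "\<And>x. x \<in> S \<Longrightarrow> f' (f x) = x"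
proof -
  have emb: "embedding_map (top_of_set S) (top_of_set T) f" and op: "openin (top_of_set T) (f ` S)"
    using assms by (auto simp: open_embedding_def)
  have ST: "f ` S \<subseteq> T" using op by (rule openin_imp_subset)
  have "homeomorphic_map (top_of_set S) (subtopology (top_of_set T) (f ` S)) f"
    using emb by (simp add: embedding_map_def)
  moreover have "subtopology (top_of_set T) (f ` S) = top_of_set (f ` S)"
    using ST by (simp add: subtopology_subtopology inf.absorb2)
  ultimately obtain f' where "homeomorphic_maps (top_of_set S) (top_of_set (f ` S)) f f'"
    using homeomorphic_map_maps by metis
  then have "continuous_on S f" "continuous_on (f ` S) f'" "\<And>x. x \<in> S \<Longrightarrow> f' (f x) = x"
    by (auto simp: homeomorphic_maps_def)
  then show ?thesis using ST op that by blast
qed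

definition solid_torus_inv :: "complex \<times> complex \<Rightarrow> complex \<times> complex" where
  "solid_torus_inv = (\<lambda>(z, w). (sgn z, w / of_real (cmod z)))"

lemma solid_torus_inv_left:
  assumes "u \<in> circle" shows "solid_torus_inv (solid_torus_map (u, t)) = (u, t)"
proof -
  define k where "k = 1 / sqrt (1 + (cmod t)\<^sup>2)"
  have k: "k > 0" using one_plus_pos[of t] by (simp add: k_def)
  have "solid_torus_map (u, t) = (k *\<^sub>R u, k *\<^sub>R t)" by (simp add: solid_torus_map_def k_def)
  then show ?thesis
    using k assms by (simp add: solid_torus_inv_def mem_circle sgn_scaleR sgn_div_norm scaleR_conv_of_real norm_mult)
qed

lemma solid_torus_inv_right:
  assumes "p \<in> S3 - braid_axis"
  shows "solid_torus_map (solid_torus_inv p) = p" "fst (solid_torus_inv p) \<in> circle"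
proof -
  obtain z w where p: "p = (z, w)" by (cases p)
  have z: "z \<noteq> 0" and n: "(cmod z)\<^sup>2 + (cmod w)\<^sup>2 = 1"
    using assms p by (auto simp: mem_braid_axis mem_S3)
  have "1 + (cmod (w / of_real (cmod z)))\<^sup>2 = ((cmod z)\<^sup>2 + (cmod w)\<^sup>2) / (cmod z)\<^sup>2"
    using z by (simp add: norm_divide power_divide add_divide_distrib)
  then have "sqrt (1 + (cmod (w / of_real (cmod z)))\<^sup>2) = 1 / cmod z"
    unfolding n by (simp add: real_sqrt_divide)
  then show "solid_torus_map (solid_torus_inv p) = p"
    using z by (simp add: p solid_torus_map_def solid_torus_inv_def scaleR_conv_of_real sgn_div_norm)
  show "fst (solid_torus_inv p) \<in> circle"
    using z by (simp add: p solid_torus_inv_def mem_circle norm_sgn)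
qed

lemma solid_torus_map_image: "solid_torus_map ` (circle \<times> UNIV) = S3 - braid_axis"
proof (intro equalityI subsetI)
  fix p assume "p \<in> S3 - braid_axis"
  from solid_torus_inv_right[OF this] show "p \<in> solid_torus_map ` (circle \<times> UNIV)"
    by (metis UNIV_I image_eqI mem_Times_iff)
qed (use solid_torus_map_in in auto)

lemma solid_torus_map_continuous: "continuous_on S solid_torus_map"
  unfolding solid_torus_map_def case_prod_unfold
  by (intro continuous_intros) (use one_plus_pos less_irrefl in \<open>metis real_sqrt_eq_zero_cancel_iff\<close>)

lemma solid_torus_inv_continuous: "continuous_on (S3 - braid_axis) solid_torus_inv"
  unfolding solid_torus_inv_def case_prod_unfold sgn_div_norm
  by (intro continuous_intros) (auto simp: braid_axis_def)

text \<open>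
  The framing enters twice. Its push-off is null-homologous in the complement of the axis, so the
  longitude has winding number zero in the \<open>S\<^sup>1\<close>-direction. Close to the axis the longitude follows the
  homeomorphism \<open>a \<mapsto> \<nu> (a, 0)\<close> from the circle to the axis; the latter has nonzero degree, as a power
  with nonzero exponent would otherwise acquire a logarithm.
\<close>

proposition zero_surgery_is_torus_filling:
  assumes "zero_surgery braid_axis S1xS2 \<iota>"
  obtains g ji gi where "torus_filling (circle \<times> sphere 0 1) (\<lambda>p. \<iota> (solid_torus_map p)) g ji gi"
proof -
  let ?M = "circle \<times> (sphere 0 1 :: (complex \<times> real) set)" and ?E = "S3 - braid_axis"
  obtain \<nu> g where \<iota>: "open_embedding (top_of_set ?E) (top_of_set ?M) \<iota>"
    and \<nu>: "zero_framing braid_axis \<nu>"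
    and g: "open_embedding (top_of_set (open_disc \<times> circle)) (top_of_set ?M) g"
    and M: "?M = \<iota> ` ?E \<union> g ` (open_disc \<times> circle)"
    and core: "\<And>b. b \<in> circle \<Longrightarrow> g (0, b) \<notin> \<iota> ` ?E"
    and glue: "\<And>a b r. a \<in> circle \<Longrightarrow> b \<in> circle \<Longrightarrow> r \<in> {0<..<1} \<Longrightarrow>
        g (of_real r * a, b) = \<iota> (\<nu> (a, of_real r * b))"
    using assms unfolding zero_surgery_def S1xS2_def by auto
  obtain \<iota>' where \<iota>': "continuous_on ?E \<iota>" "\<iota> ` ?E \<subseteq> ?M" "openin (top_of_set ?M) (\<iota> ` ?E)"
    "continuous_on (\<iota> ` ?E) \<iota>'" "\<And>x. x \<in> ?E \<Longrightarrow> \<iota>' (\<iota> x) = x"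
    by (rule open_embedding_inverse[OF \<iota>]) (rule that)
  obtain gi where gi: "continuous_on (open_disc \<times> circle) g" "g ` (open_disc \<times> circle) \<subseteq> ?M"
    "openin (top_of_set ?M) (g ` (open_disc \<times> circle))"
    "continuous_on (g ` (open_disc \<times> circle)) gi" "\<And>x. x \<in> open_disc \<times> circle \<Longrightarrow> gi (g x) = x"
    by (rule open_embedding_inverse[OF g]) (rule that)
  have \<nu>e: "open_embedding (top_of_set (circle \<times> open_disc)) (top_of_set S3) \<nu>"
    and \<nu>core: "(\<lambda>a. \<nu> (a, 0)) ` circle = braid_axis"
    and \<nu>null: "null_homologous (top_of_set ?E) (\<lambda>a. \<nu> (a, 1/2))"
    using \<nu> by (auto simp: zero_framing_def)
  obtain \<nu>' where \<nu>': "continuous_on (circle \<times> open_disc) \<nu>" "\<nu> ` (circle \<times> open_disc) \<subseteq> S3"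
    "openin (top_of_set S3) (\<nu> ` (circle \<times> open_disc))"
    "continuous_on (\<nu> ` (circle \<times> open_disc)) \<nu>'" "\<And>x. x \<in> circle \<times> open_disc \<Longrightarrow> \<nu>' (\<nu> x) = x"
    by (rule open_embedding_inverse[OF \<nu>e]) (rule that)
  have axis_pre: "\<exists>a\<in>circle. p = \<nu> (a, 0)" if "p \<in> braid_axis" for p
    using that unfolding \<nu>core[symmetric] by auto
  have off: "\<nu> (a, d) \<in> ?E" if ad: "a \<in> circle" "d \<in> open_disc" "d \<noteq> 0" for a d
  proof -
    have "\<nu> (a, d) \<notin> braid_axis"
    proof
      assume "\<nu> (a, d) \<in> braid_axis"
      then obtain a' where "a' \<in> circle" "\<nu> (a, d) = \<nu> (a', 0)" using axis_pre by blast
      then have "\<nu>' (\<nu> (a, d)) = (a', 0)" using \<nu>'(5)[of "(a', 0)"] by (simp add: mem_open_disc)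
      then have "(a, d) = (a', 0)" using \<nu>'(5)[of "(a, d)"] ad by simp
      then show False using ad by simp
    qed
    moreover have "\<nu> (a, d) \<in> S3" using \<nu>'(2) ad by blast
    ultimately show ?thesis by simp
  qed
  let ?j = "\<lambda>p. \<iota> (solid_torus_map p)" and ?ji = "\<lambda>y. solid_torus_inv (\<iota>' y)"
  have j_img: "?j ` (circle \<times> UNIV) = \<iota> ` ?E"
    by (simp only: image_image flip: solid_torus_map_image)
  have ji_glue: "?ji (g (of_real r * a, b)) = solid_torus_inv (\<nu> (a, of_real r * b))"
    if "a \<in> circle" "b \<in> circle" "r \<in> {0<..<1}" for a b r
  proof -
    have "of_real r * b \<in> open_disc" "of_real r * b \<noteq> 0"
      using that by (auto simp: mem_open_disc mem_circle norm_mult)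
    then show ?thesis using glue[OF that] \<iota>'(5)[OF off] that by simp
  qed
  have "torus_filling ?M ?j g ?ji gi"
  proof
    show "continuous_on (circle \<times> UNIV) ?j"
      by (rule continuous_on_compose2[OF \<iota>'(1) solid_torus_map_continuous])
        (use solid_torus_map_image in blast)
    show "?ji (?j (u, x)) = (u, x)" if "u \<in> circle" for u x
      using \<iota>'(5) solid_torus_map_in[OF that] solid_torus_inv_left[OF that] by simp
    show "continuous_on (?j ` (circle \<times> UNIV)) ?ji"
      unfolding j_img by (rule continuous_on_compose2[OF solid_torus_inv_continuous \<iota>'(4)]) (use \<iota>'(5) in auto)
    show "openin (top_of_set ?M) (?j ` (circle \<times> UNIV))" unfolding j_img by (rule \<iota>'(3))
    show "continuous_on (open_disc \<times> circle) g" "continuous_on (g ` (open_disc \<times> circle)) gi"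
      "openin (top_of_set ?M) (g ` (open_disc \<times> circle))" by (rule gi)+
    show "gi (g (c, b)) = (c, b)" if "c \<in> open_disc" "b \<in> circle" for c b using gi(5) that by simp
    show "?M = ?j ` (circle \<times> UNIV) \<union> g ` (open_disc \<times> circle)" unfolding j_img by (rule M)
    show "g (c, b) \<in> ?j ` (circle \<times> UNIV) \<longleftrightarrow> c \<noteq> 0" if cb: "c \<in> open_disc" "b \<in> circle" for c b
    proof (cases "c = 0")
      case True then show ?thesis using core[OF cb(2)] by (simp only: j_img) simp
    next
      case False
      have a: "sgn c \<in> circle" "c = of_real (cmod c) * sgn c" "cmod c \<in> {0<..<1}"
        using False cb by (auto simp: mem_circle norm_sgn mem_open_disc sgn_div_norm scaleR_conv_of_real norm_mult norm_inverse)
      have "g (c, b) = \<iota> (\<nu> (sgn c, of_real (cmod c) * b))" using glue[OF a(1) cb(2) a(3)] a(2) by simp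
      moreover have "\<nu> (sgn c, of_real (cmod c) * b) \<in> ?E"
        by (rule off) (use a cb False in \<open>auto simp: mem_open_disc mem_circle norm_mult\<close>)
      ultimately have "g (c, b) \<in> \<iota> ` ?E" by auto
      then show ?thesis using False by (simp only: j_img) simp
    qed
    show "has_log circle (\<lambda>a. fst (?ji (g (a / 2, 1))))"
    proof -
      have 1: "has_log circle (\<lambda>a. sgn (fst (\<nu> (a, 1/2))))"
      proof (rule null_homologous_has_log[OF \<nu>null])
        show "continuous_map (top_of_set ?E) euclidean (\<lambda>p. sgn (fst p))"
          unfolding sgn_div_norm
          by (auto intro!: continuous_intros simp: braid_axis_def)
        show "sgn (fst p) \<noteq> 0" if "p \<in> topspace (top_of_set ?E)" for p
          using that by (cases p) (auto simp: mem_braid_axis sgn_zero_iff)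
      qed
      have eq: "sgn (fst (\<nu> (a, 1/2))) = fst (?ji (g (a / 2, 1)))" if "a \<in> circle" for a
        using ji_glue[of a 1 "1/2"] that by (simp add: solid_torus_inv_def case_prod_unfold)
      show ?thesis using iffD1[OF has_log_cong[OF eq] 1] .
    qed
    show "\<exists>r0>0. \<forall>r c. 0 < r \<longrightarrow> r < r0 \<longrightarrow>
      has_log circle (\<lambda>a. snd (?ji (g (of_real r * a, 1))) powi c) \<longrightarrow> c = (0::int)"
    proof -
      have half: "circle \<times> cball 0 (1/2) \<subseteq> circle \<times> open_disc" by (auto simp: open_disc_def)
      have "uniformly_continuous_on (circle \<times> cball 0 (1/2)) \<nu>"
        by (intro compact_uniformly_continuous continuous_on_subset[OF \<nu>'(1) half] compact_Times) auto
      then obtain \<delta> where \<delta>: "\<delta> > 0" "\<And>p p'. p \<in> circle \<times> cball 0 (1/2) \<Longrightarrow>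
          p' \<in> circle \<times> cball 0 (1/2) \<Longrightarrow> dist p' p < \<delta> \<Longrightarrow> dist (\<nu> p') (\<nu> p) < 1"
        unfolding uniformly_continuous_on_def by (metis zero_less_one)
      show ?thesis
      proof (intro exI[of _ "min \<delta> (1/2)"] conjI allI impI)
        show "0 < min \<delta> (1/2)" using \<delta>(1) by simp
        fix r :: real and c :: int
        assume r: "0 < r" "r < min \<delta> (1/2)"
          and log: "has_log circle (\<lambda>a. snd (?ji (g (of_real r * a, 1))) powi c)"
        let ?v = "\<lambda>a. snd (\<nu> (a, of_real r))" and ?z = "\<lambda>a. fst (\<nu> (a, of_real r))" and ?k = "\<lambda>a. snd (\<nu> (a, 0))"
        have rd: "of_real r \<in> open_disc" "of_real r \<in> cball (0::complex) (1/2)" "(of_real r :: complex) \<noteq> 0"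
          using r by (auto simp: mem_open_disc)
        have w0: "cmod (?k a) = 1" "\<nu> (a, 0) = (0, ?k a)" if "a \<in> circle" for a
        proof -
          have "\<nu> (a, 0) \<in> braid_axis" unfolding \<nu>core[symmetric] by (rule imageI[OF that])
          moreover obtain z w where zw: "\<nu> (a, 0) = (z, w)" by (cases "\<nu> (a, 0)")
          ultimately have "z = 0" "cmod w = 1" by (auto simp: mem_braid_axis mem_S3 abs_square_eq_1)
          then show "cmod (?k a) = 1" "\<nu> (a, 0) = (0, ?k a)" by (simp_all add: zw)
        qed
        have near: "cmod (?v a - ?k a) < 1" if "a \<in> circle" for a
        proof -
          have "dist (\<nu> (a, of_real r)) (\<nu> (a, 0)) < 1"
            by (rule \<delta>(2)) (use that rd r in \<open>auto simp: dist_Pair_Pair\<close>)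
          then show ?thesis using dist_snd_le[of "\<nu> (a, of_real r)" "\<nu> (a, 0)"] by (simp add: dist_norm)
        qed
        have c\<nu>: "continuous_on circle (\<lambda>a. \<nu> (a, d))" if "d \<in> open_disc" for d
          by (rule continuous_on_compose2[OF \<nu>'(1)]) (use that in \<open>auto intro!: continuous_intros\<close>)
        have cw: "continuous_on circle ?v" "continuous_on circle ?z" "continuous_on circle ?k"
          using c\<nu>[OF rd(1)] c\<nu>[of 0] by (auto intro!: continuous_intros simp: mem_open_disc)
        have z0: "?z a \<noteq> 0" if "a \<in> circle" for a
          using off[OF that rd(1,3)] by (cases "\<nu> (a, of_real r)") (auto simp: mem_braid_axis)
        \<comment> \<open>Close to the axis the second coordinate of \<open>\<nu>\<close> has nearly its value on the axis, which has modulus 1.\<close>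
        have L1: "has_log circle (\<lambda>a. ?v a / ?k a)"
        proof (rule has_log_near_one)
          show "continuous_on circle (\<lambda>a. ?v a / ?k a)"
            using w0 by (intro continuous_intros cw) force
          show "cmod (?v a / ?k a - 1) < 1" if "a \<in> circle" for a
          proof -
            have "?k a \<noteq> 0" using w0(1)[OF that] by auto
            then have "?v a / ?k a - 1 = (?v a - ?k a) / ?k a" by (simp add: diff_divide_distrib)
            then show ?thesis using near[OF that] w0(1)[OF that] by (simp add: norm_divide)
          qed
        qed
        have L2: "has_log circle (\<lambda>a. of_real (cmod (?z a)))"
        proof (rule has_log_slit_plane)
          show "continuous_on circle (\<lambda>a. complex_of_real (cmod (?z a)))"
            by (intro continuous_intros cw)
          show "complex_of_real (cmod (?z a)) \<notin> \<real>\<^sub>\<le>\<^sub>0" if "a \<in> circle" for a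
            using z0[OF that] by (simp add: complex_nonpos_Reals_iff)
        qed
        have L3: "has_log circle (\<lambda>a. (?v a / of_real (cmod (?z a))) powi c)"
        proof -
          have "snd (?ji (g (of_real r * a, 1))) powi c = (?v a / of_real (cmod (?z a))) powi c" if "a \<in> circle" for a
            using ji_glue[of a 1 r] that r by (simp add: solid_torus_inv_def case_prod_unfold)
          from iffD1[OF has_log_cong[OF this] log] show ?thesis .
        qed
        have "has_log circle (\<lambda>a. (?v a / of_real (cmod (?z a))) powi c * of_real (cmod (?z a)) powi c / (?v a / ?k a) powi c)"
          by (intro has_log_divide has_log_mult has_log_powi L1 L2 L3)
        moreover have "(?v a / of_real (cmod (?z a))) powi c * of_real (cmod (?z a)) powi c / (?v a / ?k a) powi c
            = ?k a powi c" if a: "a \<in> circle" for a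
        proof -
          have "?v a \<noteq> 0"
          proof
            assume "?v a = 0"
            then show False using near[OF a] w0(1)[OF a] by simp
          qed
          then have "(?v a / of_real (cmod (?z a))) * of_real (cmod (?z a)) / (?v a / ?k a) = ?k a"
            using z0[OF a] by simp
          then show ?thesis by (metis power_int_divide_distrib power_int_mult_distrib)
        qed
        ultimately have L4: "has_log circle (\<lambda>a. ?k a powi c)"
          using has_log_cong[of circle] by (metis (no_types, lifting))
        have in_\<nu>: "(0, b) \<in> \<nu> ` (circle \<times> open_disc)" if "b \<in> circle" for b
        proof -
          have "(0, b) \<in> braid_axis" using that by (simp add: mem_braid_axis mem_S3 mem_circle)
          then obtain a where "a \<in> circle" "(0, b) = \<nu> (a, 0)" using axis_pre by blast
          then show ?thesis by (simp add: mem_open_disc)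
        qed
        have pre: "fst (\<nu>' (0, b)) \<in> circle \<and> ?k (fst (\<nu>' (0, b))) = b" if "b \<in> circle" for b
        proof -
          have "(0, b) \<in> braid_axis" using that by (simp add: mem_braid_axis mem_S3 mem_circle)
          then obtain a where a: "a \<in> circle" "\<nu> (a, 0) = (0, b)" using axis_pre by force
          then have "\<nu>' (0, b) = (a, 0)" using \<nu>'(5)[of "(a, 0)"] by (simp add: mem_open_disc)
          then show ?thesis using a by simp
        qed
        have "continuous_on circle (\<lambda>b. fst (\<nu>' (0, b)))"
          by (intro continuous_intros continuous_on_compose2[OF \<nu>'(4)]) (use in_\<nu> in auto)
        then have "has_log circle (\<lambda>b. ?k (fst (\<nu>' (0, b))) powi c)"
          by (rule has_log_compose[OF L4]) (use pre in blast)
        then have "has_log circle (\<lambda>b. b powi c)"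
          using has_log_cong[of circle "\<lambda>b. ?k (fst (\<nu>' (0, b))) powi c" "\<lambda>b. b powi c"] pre by simp
        then show "c = 0" by (intro circle_power_with_log_is_trivial) (simp add: circle_def)
      qed
    qed
  qed
  then show ?thesis by (rule that)
qed

section \<open>Closed braids as families of lines\<close>

definition strand_step :: "nat \<Rightarrow> nat \<Rightarrow> nat" where
  "strand_step i a = (if a = i then i + 1 else if a = i + 1 then i else a)"

definition strand_path :: "nat \<Rightarrow> nat \<Rightarrow> real \<Rightarrow> complex" where
  "strand_path i a s = (if a = i then of_nat i + 1/2 - cis (pi * s) / 2
     else if a = i + 1 then of_nat i + 1/2 + cis (pi * s) / 2 else of_nat a)"

fun end_pos :: "nat list \<Rightarrow> nat \<Rightarrow> nat" where
  "end_pos [] a = a"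
| "end_pos (i # w) a = end_pos w (strand_step i a)"

fun crossings :: "nat list \<Rightarrow> nat \<Rightarrow> nat \<Rightarrow> nat" where
  "crossings [] a b = 0"
| "crossings (i # w) a b = (if {a, b} = {i, i + 1} then 1 else 0) + crossings w (strand_step i a) (strand_step i b)"

lemma end_pos_append: "end_pos (u @ v) a = end_pos v (end_pos u a)"
  by (induction u arbitrary: a) auto

lemma crossings_append:
  "crossings (u @ v) a b = crossings u a b + crossings v (end_pos u a) (end_pos u b)"
  by (induction u arbitrary: a b) auto

lemma strand_step_involution [simp]: "strand_step i (strand_step i a) = a"
  by (auto simp: strand_step_def)

lemma end_pos_inj: "end_pos w a = end_pos w b \<longleftrightarrow> a = b"
  by (induction w arbitrary: a b) (auto, metis strand_step_involution)

lemma end_pos_bij: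
  assumes "\<And>i. i \<in> set w \<Longrightarrow> 1 \<le> i \<and> i < k"
  shows "end_pos w ` {1..k} = {1..k}"
proof -
  have "end_pos w a \<in> {1..k}" if "a \<in> {1..k}" for a
    using assms that
  proof (induction w arbitrary: a)
    case (Cons i w)
    have "strand_step i a \<in> {1..k}" using Cons.prems(1)[of i] Cons.prems(2) by (auto simp: strand_step_def)
    then show ?case using Cons by simp
  qed simp
  moreover have "inj_on (end_pos w) {1..k}" by (auto simp: inj_on_def end_pos_inj)
  ultimately show ?thesis by (intro endo_inj_surj) auto
qed

lemma strand_path_ends: "strand_path i a 0 = of_nat a" "strand_path i a 1 = of_nat (strand_step i a)"
  by (auto simp: strand_path_def strand_step_def)

lemma strand_path_continuous: "continuous_on S (strand_path i a)"
  by (cases "a = i"; cases "a = i + 1") (auto simp: strand_path_def intro!: continuous_intros)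

lemma sigma_strands_eq:
  assumes "1 \<le> i" "i < k"
  shows "sigma_strands k i s = (\<lambda>a. strand_path i a s) ` {1..k}"
proof -
  have "{1..k} = ({1..k} - {i, i + 1}) \<union> {i, i + 1}" using assms by auto
  then have "(\<lambda>a. strand_path i a s) ` {1..k}
      = (\<lambda>a. strand_path i a s) ` ({1..k} - {i, i + 1}) \<union> (\<lambda>a. strand_path i a s) ` {i, i + 1}"
    by (metis image_Un)
  moreover have "(\<lambda>a. strand_path i a s) ` ({1..k} - {i, i + 1}) = of_nat ` ({1..k} - {i, i + 1})"
    by (intro image_cong) (auto simp: strand_path_def)
  ultimately show ?thesis by (simp add: sigma_strands_def strand_path_def insert_commute)
qed

text \<open>
  If the two strands do not cross each other, the real part of their difference keeps its sign and
  the ends are real, so the argument does not change. If they do, the difference is a half-turn.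
\<close>

lemma strand_difference_log:
  assumes "a \<noteq> b"
  obtains l where "continuous_on {0..1} l" "\<And>s. s \<in> {0..1} \<Longrightarrow> strand_path i a s - strand_path i b s = exp (l s)"
    "Im (l 1) - Im (l 0) = pi * (if {a, b} = {i, i + 1} then 1 else 0)"
proof (cases "{a, b} = {i, i + 1}")
  case True
  then consider "a = i" "b = i + 1" | "a = i + 1" "b = i" by (auto simp: doubleton_eq_iff)
  then show ?thesis
  proof cases
    case 1
    show ?thesis
    proof (rule that[of "\<lambda>s. \<i> * of_real (pi * s + pi)"])
      show "strand_path i a s - strand_path i b s = exp (\<i> * of_real (pi * s + pi))" for s
        unfolding cis_conv_exp[symmetric] using 1 by (simp add: strand_path_def complex_eq_iff)
    qed (use True in \<open>auto intro!: continuous_intros\<close>)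
  next
    case 2
    show ?thesis
    proof (rule that[of "\<lambda>s. \<i> * of_real (pi * s)"])
      show "strand_path i a s - strand_path i b s = exp (\<i> * of_real (pi * s))" for s
        unfolding cis_conv_exp[symmetric] using 2 by (simp add: strand_path_def)
    qed (use True in \<open>auto intro!: continuous_intros\<close>)
  qed
next
  case False
  define d where "d s = strand_path i a s - strand_path i b s" for s
  have cd: "continuous_on S d" for S unfolding d_def by (intro continuous_intros strand_path_continuous)
  have ends: "d 0 = of_real (real a - real b)" "d 1 = of_real (real (strand_step i a) - real (strand_step i b))"
    by (simp_all add: d_def strand_path_ends)
  have Re_between: "real i \<le> Re (strand_path i c s) \<and> Re (strand_path i c s) \<le> real i + 1" if "c \<in> {i, i + 1}" for c s
  proof -
    obtain x where "cos (pi * s) = x" "- 1 \<le> x" "x \<le> 1" by simp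
    then show ?thesis using that by (auto simp: strand_path_def)
  qed
  have Re_const: "Re (strand_path i c s) = real c" if "c \<notin> {i, i + 1}" for c s
    using that by (simp add: strand_path_def)
  have sign: "if a < b then Re (d s) < 0 else Re (d s) > 0" for s
  proof -
    consider "a \<in> {i, i + 1}" "b \<notin> {i, i + 1}" | "a \<notin> {i, i + 1}" "b \<in> {i, i + 1}" | "a \<notin> {i, i + 1}" "b \<notin> {i, i + 1}"
      using False \<open>a \<noteq> b\<close> by auto
    then show ?thesis
    proof cases
      case 1
      have "b < i \<or> b > i + 1" using 1 by auto
      then show ?thesis using Re_between[OF 1(1), of s] Re_const[OF 1(2), of s] 1 by (auto simp: d_def)
    next
      case 2
      have "a < i \<or> a > i + 1" using 2 by auto
      then show ?thesis using Re_between[OF 2(2), of s] Re_const[OF 2(1), of s] 2 by (auto simp: d_def)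
    next
      case 3
      then show ?thesis using Re_const[OF 3(1), of s] Re_const[OF 3(2), of s] \<open>a \<noteq> b\<close> by (auto simp: d_def)
    qed
  qed
  show ?thesis
  proof (cases "a < b")
    case True
    have neg: "Re (d s) < 0" for s using sign[of s] True by simp
    have n0: "d s \<noteq> 0" for s using neg[of s] by auto
    have slit: "- d s \<notin> \<real>\<^sub>\<le>\<^sub>0" for s using neg[of s] by (simp add: complex_nonpos_Reals_iff)
    have im: "Im (Ln (- d 1)) = 0" "Im (Ln (- d 0)) = 0"
      using neg[of 1] neg[of 0] n0[of 1] n0[of 0] by (simp_all add: Im_Ln_eq_0 ends)
    show ?thesis
    proof (rule that[of "\<lambda>s. Ln (- d s) + \<i> * pi"])
      show "continuous_on {0..1} (\<lambda>s. Ln (- d s) + \<i> * pi)" by (intro continuous_intros cd slit)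
      show "strand_path i a s - strand_path i b s = exp (Ln (- d s) + \<i> * pi)" for s
        using n0[of s] by (simp add: exp_add d_def)
    qed (use False im in simp)
  next
    case F: False
    have pos: "Re (d s) > 0" for s using sign[of s] F by simp
    have n0: "d s \<noteq> 0" for s using pos[of s] by auto
    have slit: "d s \<notin> \<real>\<^sub>\<le>\<^sub>0" for s using pos[of s] by (simp add: complex_nonpos_Reals_iff)
    have im: "Im (Ln (d 1)) = 0" "Im (Ln (d 0)) = 0"
      using pos[of 1] pos[of 0] n0[of 1] n0[of 0] by (simp_all add: Im_Ln_eq_0 ends)
    show ?thesis
    proof (rule that[of "\<lambda>s. Ln (d s)"])
      show "continuous_on {0..1} (\<lambda>s. Ln (d s))" by (intro continuous_intros cd slit)
      show "strand_path i a s - strand_path i b s = exp (Ln (d s))" for s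
        using n0[of s] by (simp add: d_def)
    qed (use False im in simp)
  qed
qed

lemma continuous_on_reals_from_unit_intervals:
  fixes f :: "real \<Rightarrow> 'a::topological_space"
  assumes "\<And>m::int. continuous_on {of_int m..of_int m + 1} f"
  shows "continuous_on UNIV f"
  unfolding continuous_on_eq_continuous_at[OF open_UNIV]
proof
  fix x :: real
  define m where "m = \<lfloor>x\<rfloor>"
  have "continuous_on ({of_int (m - 1)..of_int (m - 1) + 1} \<union> {of_int m..of_int m + 1}) f"
    using assms[of "m - 1"] assms[of m] by (intro continuous_on_closed_Un) auto
  moreover have "{of_int (m - 1)..of_int (m - 1) + 1} \<union> {of_int m..of_int m + 1} = {of_int m - 1..of_int m + 1 :: real}"
    by auto
  ultimately have "continuous_on {of_int m - 1..of_int m + 1} f" by simp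
  moreover have "x \<in> interior {of_int m - 1..of_int m + 1}"
    unfolding m_def by simp linarith
  ultimately show "isCont f x" by (rule continuous_on_interior)
qed

text \<open>
  The strand from position \<open>a\<close> under periodic repetition of the word \<open>W\<close>, with one unit of time per
  letter and for all real times; it is meaningful if \<open>W\<close> returns \<open>a\<close> to itself.
\<close>

definition track :: "nat list \<Rightarrow> nat \<Rightarrow> real \<Rightarrow> complex" where
  "track W a T = (let n = nat (\<lfloor>T\<rfloor> mod int (length W))
     in strand_path (W ! n) (end_pos (take n W) a) (T - of_int \<lfloor>T\<rfloor>))"

locale closed_word =
  fixes W :: "nat list" and a :: nat
  assumes nonempty: "W \<noteq> []" and closes: "end_pos W a = a"
begin

lemma track_on_interval:
  assumes "n = nat (m mod int (length W))" "of_int m \<le> T" "T \<le> of_int m + 1"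
  shows "track W a T = strand_path (W ! n) (end_pos (take n W) a) (T - of_int m)"
proof (cases "T = of_int m + 1")
  case False
  then have "\<lfloor>T\<rfloor> = m" using assms by linarith
  then show ?thesis by (simp add: track_def Let_def assms(1))
next
  case True
  let ?L = "int (length W)"
  have L: "?L > 0" using nonempty by simp
  have n: "n < length W" "int n = m mod ?L"
    using L by (auto simp: assms(1) nat_less_iff)
  have fl: "\<lfloor>T\<rfloor> = m + 1" using True by simp
  define n' where "n' = nat ((m + 1) mod ?L)"
  have "(m + 1) mod ?L = (int n + 1) mod ?L" using n(2) by (metis mod_add_left_eq)
  then have n': "n' = (if n + 1 = length W then 0 else n + 1)"
  proof (cases "n + 1 = length W")
    case True
    then have "int n + 1 = int (length W)" by simp
    with \<open>(m + 1) mod ?L = _\<close> show ?thesis using True by (simp add: n'_def)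
  next
    case False
    then have "(int n + 1) mod ?L = int n + 1" using n(1) by (intro mod_pos_pos_trivial) auto
    with \<open>(m + 1) mod ?L = _\<close> show ?thesis using False by (simp add: n'_def)
  qed
  have step: "end_pos (take (n + 1) W) a = strand_step (W ! n) (end_pos (take n W) a)"
    using n(1) by (simp add: take_Suc_conv_app_nth end_pos_append)
  have "end_pos (take n' W) a = strand_step (W ! n) (end_pos (take n W) a)"
  proof (cases "n + 1 = length W")
    case e: True
    then show ?thesis using step closes n' by simp
  qed (use n' step in simp)
  then have "track W a T = of_nat (strand_step (W ! n) (end_pos (take n W) a))"
    using True by (simp add: track_def fl strand_path_ends flip: n'_def)
  then show ?thesis using True by (simp add: strand_path_ends)
qed

lemma track_continuous: "continuous_on UNIV (track W a)"
proof (rule continuous_on_reals_from_unit_intervals)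
  fix m :: int
  let ?n = "nat (m mod int (length W))"
  have "continuous_on {of_int m..of_int m + 1} (\<lambda>T. strand_path (W ! ?n) (end_pos (take ?n W) a) (T - of_int m))"
    by (rule continuous_on_compose2[OF strand_path_continuous[of UNIV]]) (auto intro!: continuous_intros)
  then show "continuous_on {of_int m..of_int m + 1} (track W a)"
  proof (rule continuous_on_eq)
    show "strand_path (W ! ?n) (end_pos (take ?n W) a) (T - of_int m) = track W a T"
      if "T \<in> {of_int m..of_int m + 1}" for T
      using that track_on_interval[OF refl, of m T] by simp
  qed
qed

lemma track_periodic: "track W a (T + real (length W)) = track W a T"
proof -
  have "\<lfloor>T + real (length W)\<rfloor> = \<lfloor>T\<rfloor> + int (length W)" by linarith
  then show ?thesis by (simp add: track_def)
qed

end

lemma track_distinct: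
  assumes "a \<noteq> b" "W \<noteq> []"
  shows "track W a T \<noteq> track W b T"
proof -
  define n s where "n = nat (\<lfloor>T\<rfloor> mod int (length W))" and "s = T - of_int \<lfloor>T\<rfloor>"
  have ne: "end_pos (take n W) a \<noteq> end_pos (take n W) b" using assms by (simp add: end_pos_inj)
  have "s \<in> {0..1}" unfolding s_def by (auto, linarith)
  obtain l where "strand_path (W ! n) (end_pos (take n W) a) s - strand_path (W ! n) (end_pos (take n W) b) s = exp (l s)"
    by (rule strand_difference_log[OF ne]) (use \<open>s \<in> {0..1}\<close> in blast)
  then show ?thesis unfolding track_def Let_def n_def[symmetric] s_def[symmetric]
    by (metis eq_iff_diff_eq_0 exp_not_eq_zero)
qed

text \<open>
  Each crossing adds a half-turn, and the modulus of the difference is periodic.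
\<close>

proposition track_difference_log:
  assumes ab: "a \<noteq> b" and W: "W \<noteq> []" "end_pos W a = a" "end_pos W b = b"
  obtains l where "continuous_on UNIV l" "\<And>T. exp (l T) = track W a T - track W b T"
    "\<And>T. l (T + real (length W)) = l T + \<i> * pi * of_nat (crossings W a b)"
proof -
  interpret A: closed_word W a by unfold_locales (use W in auto)
  interpret B: closed_word W b by unfold_locales (use W in auto)
  have cD: "continuous_on UNIV (\<lambda>T. track W a T - track W b T)"
    by (intro continuous_intros A.track_continuous B.track_continuous)
  have "has_log UNIV (\<lambda>T. track W a T - track W b T)"
    by (rule has_log_contractible[OF cD contractible_UNIV]) (use track_distinct[OF ab W(1)] in simp)
  then obtain l where l: "continuous_on UNIV l" "\<And>T. track W a T - track W b T = exp (l T)"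
    unfolding has_log_def by blast
  let ?L = "length W"
  have step: "Im (l (real (Suc n))) - Im (l (real n))
      = pi * (if {end_pos (take n W) a, end_pos (take n W) b} = {W ! n, W ! n + 1} then 1 else 0)"
    if n: "n < ?L" for n
  proof -
    have ne: "end_pos (take n W) a \<noteq> end_pos (take n W) b" using ab by (simp add: end_pos_inj)
    obtain k where k: "continuous_on {0..1} k"
        "\<And>s. s \<in> {0..1} \<Longrightarrow> strand_path (W ! n) (end_pos (take n W) a) s - strand_path (W ! n) (end_pos (take n W) b) s = exp (k s)"
        "Im (k 1) - Im (k 0) = pi * (if {end_pos (take n W) a, end_pos (take n W) b} = {W ! n, W ! n + 1} then 1 else 0)"
      by (rule strand_difference_log[OF ne, of "W ! n"]) (rule that)
    have nn: "n = nat (int n mod int ?L)" using n by simp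
    have cl: "continuous_on {0..1} (\<lambda>s. l (real n + s))"
      by (rule continuous_on_compose2[OF l(1)]) (auto intro!: continuous_intros)
    obtain c :: int where c: "\<And>s. s \<in> {0..1} \<Longrightarrow> l (real n + s) = k s + 2 * pi * \<i> * c"
    proof (rule logs_differ_by_period[OF _ cl k(1)])
      fix s :: real assume s: "s \<in> {0..1}"
      show "exp (l (real n + s)) = exp (k s)"
        using s A.track_on_interval[OF nn, of "real n + s"] B.track_on_interval[OF nn, of "real n + s"]
        by (simp flip: l(2) k(2))
    qed (use that in auto)
    show ?thesis using c[of 0] c[of 1] k(3) by (simp add: add.commute)
  qed
  have Im_n: "Im (l (real n)) - Im (l 0) = pi * real (crossings (take n W) a b)" if "n \<le> ?L" for n
    using that
  proof (induction n)
    case (Suc n)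
    have "crossings (take (Suc n) W) a b = crossings (take n W) a b
        + (if {end_pos (take n W) a, end_pos (take n W) b} = {W ! n, W ! n + 1} then 1 else 0)"
      using Suc.prems by (simp add: take_Suc_conv_app_nth crossings_append)
    then show ?case using Suc step[of n] by (simp add: algebra_simps split: if_splits)
  qed simp
  have cl: "continuous_on UNIV (\<lambda>T. l (T + real ?L))"
    by (rule continuous_on_compose2[OF l(1)]) (auto intro!: continuous_intros)
  obtain c :: int where c: "\<And>T. l (T + real ?L) = l T + 2 * pi * \<i> * c"
  proof (rule logs_differ_by_period[OF connected_UNIV cl l(1)])
    show "exp (l (T + real ?L)) = exp (l T)" for T
      by (simp add: A.track_periodic B.track_periodic flip: l(2))
  qed (use that in blast)
  have "2 * pi * of_int c = pi * real (crossings W a b)"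
    using Im_n[of ?L] c[of 0] by simp
  then have "2 * pi * \<i> * c = \<i> * pi * of_nat (crossings W a b)"
    by (simp add: complex_eq_iff)
  then show ?thesis using that[of l] l c by simp
qed

lemma nth_concat_replicate:
  assumes "n < N * length w"
  shows "concat (replicate N w) ! n = w ! (n mod length w)"
  using assms
proof (induction N arbitrary: n)
  case (Suc N)
  show ?case
  proof (cases "n < length w")
    case False
    then have "n - length w < N * length w" using Suc.prems by auto
    from Suc.IH[OF this] show ?thesis using False by (simp add: nth_append le_mod_geq)
  qed (simp add: nth_append)
qed simp

text \<open>
  In the cyclic cover, the closed braid of \<open>w\<close> unrolls into \<open>k\<close> lines. The parameter \<open>s\<close> is the
  angle around the axis, one turn being one passage through \<open>w\<close>, and \<open>N\<close> is a number of turns after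
  which every strand is back at its place.
\<close>

definition line :: "nat \<Rightarrow> nat list \<Rightarrow> nat \<Rightarrow> real \<Rightarrow> complex" where
  "line N w a s = track (concat (replicate N w)) a (s * real (length w) / (2 * pi))"

lemma solid_torus_map_eq_iff:
  assumes "u \<in> circle" "u' \<in> circle"
  shows "solid_torus_map (u, t) = solid_torus_map (u', t') \<longleftrightarrow> u = u' \<and> t = t'"
  using solid_torus_inv_left[OF assms(1), of t] solid_torus_inv_left[OF assms(2), of t']
  by (metis prod.inject)

text \<open>
  At each time the current positions of the \<open>k\<close> strands are a permutation of \<open>{1..k}\<close>, so the lines
  together fill the preimage of the closed braid.
\<close>

proposition closed_braid_lines:
  assumes w: "w \<noteq> []" "\<And>i. i \<in> set w \<Longrightarrow> 1 \<le> i \<and> i < k" and N: "N \<ge> 1"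
    and closes: "\<And>a. a \<in> {1..k} \<Longrightarrow> end_pos (concat (replicate N w)) a = a"
  shows "solid_torus_map (cis s, x) \<in> closed_braid k w \<longleftrightarrow> (\<exists>a\<in>{1..k}. x = line N w a s)"
proof -
  define W where "W = concat (replicate N w)"
  let ?l = "length w"
  have L: "length W = N * ?l" by (simp add: W_def length_concat sum_list_replicate)
  have l0: "?l > 0" using w by simp
  have W0: "W \<noteq> []" using L l0 N by (metis length_0_conv mult_eq_0_iff not_gr_zero not_one_le_zero)
  have cw: "closed_word W a" if "a \<in> {1..k}" for a
    using W0 closes[OF that] by (simp add: closed_word_def W_def)
  have letter: "W ! n = w ! (nat (m mod int ?l)) \<and> n < length W"
    if n: "n = nat (m mod int (length W))" for n and m :: int
  proof -
    have "int (length W) > 0" using W0 by simp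
    then have "n < length W" "int n = m mod int (length W)" using n by (auto simp: nat_less_iff)
    moreover have "int (n mod ?l) = m mod int ?l"
      using \<open>int n = _\<close> L by (simp add: zmod_int mod_mod_cancel)
    ultimately show ?thesis using nth_concat_replicate[of n N w] L
      by (metis W_def nat_int)
  qed
  have letters: "1 \<le> w ! n \<and> w ! n < k" if "n < ?l" for n using w(2) that by simp
  have bij: "end_pos (take n W) ` {1..k} = {1..k}" for n
    by (rule end_pos_bij) (use w(2) in \<open>auto simp: W_def dest!: in_set_takeD\<close>)
  let ?T = "s * real ?l / (2 * pi)"
  show ?thesis
  proof
    assume "solid_torus_map (cis s, x) \<in> closed_braid k w"
    then obtain j f t where jf: "j < ?l" "f \<in> {0..1}" "t \<in> sigma_strands k (w ! j) f"
      and e: "solid_torus_map (cis s, x) = solid_torus_map (cis (2 * pi * (real j + f) / real ?l), t)"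
      unfolding closed_braid_def by auto
    have x: "x = t" and c: "cis s = cis (2 * pi * (real j + f) / real ?l)"
      using e by (auto simp: solid_torus_map_eq_iff)
    obtain r :: int where r: "s = 2 * pi * (real j + f) / real ?l + of_int r * (2 * pi)"
    proof -
      have "cis (s - 2 * pi * (real j + f) / real ?l) = 1" using c by (simp flip: cis_divide)
      then have "cos (s - 2 * pi * (real j + f) / real ?l) = 1" by (metis cis.sel(1) one_complex.sel(1))
      then show ?thesis using that unfolding cos_one_2pi_int by (auto simp: algebra_simps)
    qed
    define m :: int where "m = int j + r * int ?l"
    have T: "?T = of_int m + f"
      using l0 by (simp add: r m_def field_simps)
    define n where "n = nat (m mod int (length W))"
    have "m mod int ?l = int j" using jf(1) by (simp add: m_def)
    then have Wn: "W ! n = w ! j" using letter[OF n_def] by simp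
    have "t \<in> (\<lambda>a. strand_path (w ! j) a f) ` {1..k}"
      using jf(3) sigma_strands_eq letters[OF jf(1)] by simp
    then obtain a' where a': "a' \<in> {1..k}" "t = strand_path (w ! j) a' f" by blast
    then obtain a where a: "a \<in> {1..k}" "a' = end_pos (take n W) a" using bij[of n] by (metis imageE)
    interpret closed_word W a by (rule cw[OF a(1)])
    have "line N w a s = strand_path (W ! n) (end_pos (take n W) a) (?T - of_int m)"
      unfolding line_def W_def[symmetric] by (rule track_on_interval[OF n_def]) (use T jf(2) in auto)
    then have "x = line N w a s" using T a' a x Wn by simp
    then show "\<exists>a\<in>{1..k}. x = line N w a s" using a(1) by blast
  next
    assume "\<exists>a\<in>{1..k}. x = line N w a s"
    then obtain a where a: "a \<in> {1..k}" "x = line N w a s" by blast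
    define m where "m = \<lfloor>?T\<rfloor>"
    define n where "n = nat (m mod int (length W))"
    define f where "f = ?T - of_int m"
    define j where "j = nat (m mod int ?l)"
    have f: "f \<in> {0..1}" unfolding f_def m_def by (auto, linarith)
    have j: "j < ?l" "int j = m mod int ?l" using l0 by (auto simp: j_def nat_less_iff)
    have x: "x = strand_path (w ! j) (end_pos (take n W) a) f"
      using letter[OF n_def] by (simp add: a(2) line_def track_def Let_def j_def f_def flip: W_def m_def n_def)
    have "x \<in> sigma_strands k (w ! j) f"
      unfolding x using sigma_strands_eq letters[OF j(1)] bij[of n] a(1) by blast
    moreover have "cis s = cis (2 * pi * (real j + f) / real ?l)"
    proof -
      have "m = int j + (m div int ?l) * int ?l" using j(2) by simp
      from arg_cong[OF this, of real_of_int]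
      have "real_of_int m = real j + of_int (m div int ?l) * real ?l"
        by (simp only: of_int_add of_int_mult of_int_of_nat_eq)
      then have "?T = real j + f + of_int (m div int ?l) * real ?l" by (simp add: f_def)
      then have "s = 2 * pi * (real j + f) / real ?l + of_int (m div int ?l) * (2 * pi)"
        using l0 by (simp add: field_simps)
      then have "cis s = cis (2 * pi * (real j + f) / real ?l) * cis (2 * pi * of_int (m div int ?l))"
        by (simp add: cis_mult algebra_simps)
      moreover have "cis (2 * pi * of_int (m div int ?l)) = 1" by (rule cis_multiple_2pi) simp
      ultimately show ?thesis by simp
    qed
    ultimately show "solid_torus_map (cis s, x) \<in> closed_braid k w"
      unfolding closed_braid_def using f j(1)
      by (intro CollectI exI[of _ j] exI[of _ f] exI[of _ x] conjI) auto
  qed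
qed

section \<open>Crossing numbers of the two braids\<close>

lemma line_log:
  assumes ab: "a \<noteq> b" and w: "w \<noteq> []" "N \<ge> 1"
    and closes: "end_pos (concat (replicate N w)) a = a" "end_pos (concat (replicate N w)) b = b"
  obtains l where "continuous_on UNIV l" "\<And>s. exp (l s) = line N w a s - line N w b s"
    "\<And>s. l (s + 2 * pi * real N) = l s + \<i> * pi * of_nat (crossings (concat (replicate N w)) a b)"
proof -
  let ?W = "concat (replicate N w)"
  have L: "length ?W = N * length w" by (simp add: length_concat sum_list_replicate)
  then have W: "?W \<noteq> []" using w by (metis length_0_conv mult_eq_0_iff not_one_le_zero)
  obtain l where l: "continuous_on UNIV l" "\<And>T. exp (l T) = track ?W a T - track ?W b T"
    "\<And>T. l (T + real (length ?W)) = l T + \<i> * pi * of_nat (crossings ?W a b)"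
    by (rule track_difference_log[OF ab W closes]) (rule that)
  show ?thesis
  proof (rule that[of "\<lambda>s. l (s * real (length w) / (2 * pi))"])
    show "continuous_on UNIV (\<lambda>s. l (s * real (length w) / (2 * pi)))"
      by (rule continuous_on_compose2[OF l(1)]) (auto intro!: continuous_intros)
    show "exp (l (s * real (length w) / (2 * pi))) = line N w a s - line N w b s" for s
      by (simp add: line_def l(2))
    have "(s + 2 * pi * real N) * real (length w) / (2 * pi) = s * real (length w) / (2 * pi) + real (length ?W)" for s
      unfolding L by (simp add: field_simps)
    then show "l ((s + 2 * pi * real N) * real (length w) / (2 * pi))
        = l (s * real (length w) / (2 * pi)) + \<i> * pi * of_nat (crossings ?W a b)" for s
      by (simp only: l(3))
  qed
qed

lemma line_properties:
  assumes w: "w \<noteq> []" "N \<ge> 1" and closes: "end_pos (concat (replicate N w)) a = a"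
  shows "continuous_on UNIV (line N w a)" "line N w a (s + 2 * pi * real N) = line N w a s"
    "bounded (range (line N w a))"
proof -
  let ?W = "concat (replicate N w)"
  have L: "length ?W = N * length w" by (simp add: length_concat sum_list_replicate)
  then have W: "?W \<noteq> []" using w by (metis length_0_conv mult_eq_0_iff not_one_le_zero)
  interpret closed_word ?W a by unfold_locales (use W closes in auto)
  show c: "continuous_on UNIV (line N w a)"
    unfolding line_def
    by (rule continuous_on_compose2[OF track_continuous]) (auto intro!: continuous_intros)
  have per: "line N w a (s + 2 * pi * real N) = line N w a s" for s
  proof -
    have "(s + 2 * pi * real N) * real (length w) / (2 * pi) = s * real (length w) / (2 * pi) + real (length ?W)"
      unfolding L by (simp add: field_simps)
    then show ?thesis unfolding line_def by (simp only: track_periodic)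
  qed
  then show "line N w a (s + 2 * pi * real N) = line N w a s" .
  define P where "P = 2 * pi * real N"
  have P: "P > 0" using w by (simp add: P_def)
  have perP: "line N w a (s + P) = line N w a s" for s unfolding P_def by (rule per)
  have shift: "line N w a (s + of_int n * P) = line N w a s" for s n
  proof (induction n rule: int_induct[where k = 0])
    case (step1 i)
    have "s + of_int (i + 1) * P = (s + of_int i * P) + P" by (simp add: algebra_simps)
    then have "line N w a (s + of_int (i + 1) * P) = line N w a (s + of_int i * P)" by (simp only: perP)
    then show ?case using step1 by simp
  next
    case (step2 i)
    have "s + of_int i * P = (s + of_int (i - 1) * P) + P" by (simp add: algebra_simps)
    then have "line N w a (s + of_int i * P) = line N w a (s + of_int (i - 1) * P)" by (simp only: perP)
    then show ?case using step2 by simp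
  qed simp
  have "range (line N w a) \<subseteq> line N w a ` {0..P}"
  proof (rule image_subsetI)
    fix s
    define n where "n = \<lfloor>s / P\<rfloor>"
    have "of_int n \<le> s / P" "s / P < of_int n + 1" unfolding n_def by linarith+
    then have "of_int n * P \<le> s" "s < (of_int n + 1) * P" using P by (simp_all add: field_simps)
    then have "s - of_int n * P \<in> {0..P}" by (simp add: algebra_simps)
    moreover have "line N w a s = line N w a (s - of_int n * P)"
      using shift[of "s - of_int n * P" n] by simp
    ultimately show "line N w a s \<in> line N w a ` {0..P}" by (metis imageI)
  qed
  moreover have "compact (line N w a ` {0..P})"
    by (intro compact_continuous_image continuous_on_subset[OF c]) auto
  ultimately show "bounded (range (line N w a))"
    using compact_imp_bounded bounded_subset by blast
qed

lemma crossings_commute: "crossings w a b = crossings w b a"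
  by (induction w arbitrary: a b) (auto simp: insert_commute)

lemma concat_replicate_Suc: "concat (replicate (Suc N) w) = concat (replicate N w) @ w"
  by (induction N) auto

lemma crossings_replicate:
  "crossings (concat (replicate N w)) a b
    = (\<Sum>r<N. crossings w (end_pos (concat (replicate r w)) a) (end_pos (concat (replicate r w)) b))"
  by (induction N) (simp_all only: concat_replicate_Suc crossings_append sum.lessThan_Suc, simp)

text \<open>
  Both braids of interest permute the positions by a rotation, here written with positions
  counted from \<open>0\<close>.
\<close>

lemma end_pos_replicate_rotation:
  assumes "\<And>x. x < k \<Longrightarrow> end_pos w (x + 1) = (x + d) mod k + 1" and "x < k"
  shows "end_pos (concat (replicate r w)) (x + 1) = (x + r * d) mod k + 1"
proof (induction r)
  case (Suc r)
  have "(x + r * d) mod k < k" using assms(2) by simp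
  then have "end_pos w ((x + r * d) mod k + 1) = ((x + r * d) mod k + d) mod k + 1"
    by (rule assms(1))
  then show ?case
    unfolding concat_replicate_Suc end_pos_append Suc by (simp add: mod_simps algebra_simps)
qed (use assms(2) in simp)

lemma bij_rotation:
  assumes "coprime d k" "k > (0::nat)"
  shows "bij_betw (\<lambda>r. (x + r * d) mod k) {..<k} {..<k}"
proof -
  have "inj_on (\<lambda>r. (x + r * d) mod k) {..<k}"
  proof (rule inj_onI)
    fix r r' assume r: "r \<in> {..<k}" "r' \<in> {..<k}" and eq: "(x + r * d) mod k = (x + r' * d) mod k"
    then have "[x + r * d = x + r' * d] (mod k)" by (simp add: cong_def)
    then have "[r * d = r' * d] (mod k)" by (simp add: cong_add_lcancel_nat)
    then have "[r = r'] (mod k)" using assms(1) by (simp add: cong_mult_rcancel_nat)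
    then show "r = r'" using r by (simp add: cong_def)
  qed
  moreover have "(\<lambda>r. (x + r * d) mod k) ` {..<k} \<subseteq> {..<k}" using assms(2) by auto
  ultimately show ?thesis
    by (simp add: bij_betw_def endo_inj_surj)
qed

lemma end_pos_row:
  "end_pos [j..<j + n] a = (if a = j then j + n else if j < a \<and> a \<le> j + n then a - 1 else a)"
proof (induction n)
  case (Suc n)
  have "[j..<j + Suc n] = [j..<j + n] @ [j + n]" by simp
  then show ?case unfolding end_pos_append \<open>[j..<j + Suc n] = _\<close> Suc
    by (auto simp: strand_step_def)
qed simp

lemma crossings_row:
  assumes "a \<noteq> b"
  shows "crossings [j..<j + n] a b = (if a = j \<and> j < b \<and> b \<le> j + n \<or> b = j \<and> j < a \<and> a \<le> j + n then 1 else 0)"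
proof (induction n)
  case (Suc n)
  have e: "[j..<j + Suc n] = [j..<j + n] @ [j + n]" by simp
  let ?e = "end_pos [j..<j + n]"
  consider "a = j" "b \<noteq> j" | "b = j" "a \<noteq> j" | "a \<noteq> j" "b \<noteq> j" using assms by blast
  then have "{?e a, ?e b} = {j + n, j + n + 1} \<longleftrightarrow> a = j \<and> b = j + n + 1 \<or> b = j \<and> a = j + n + 1"
  proof cases
    case 1
    then have "?e a = j + n" "?e b = j + n + 1 \<longleftrightarrow> b = j + n + 1" by (auto simp: end_pos_row)
    then show ?thesis using 1 by (auto simp: doubleton_eq_iff)
  next
    case 2
    then have "?e b = j + n" "?e a = j + n + 1 \<longleftrightarrow> a = j + n + 1" by (auto simp: end_pos_row)
    then show ?thesis using 2 by (auto simp: doubleton_eq_iff)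
  next
    case 3
    then have "?e a \<noteq> j + n" "?e b \<noteq> j + n" by (auto simp: end_pos_row)
    then show ?thesis using 3 by (auto simp: doubleton_eq_iff)
  qed
  then show ?case unfolding e crossings_append Suc by auto
qed (use assms in auto)

lemma A_word_Suc_row: "A_word (Suc m) n = [Suc m..<Suc m + n] @ A_word m n"
  by (simp add: A_word_def)

lemma end_pos_A_word:
  assumes "1 \<le> a"
  shows "end_pos (A_word m n) a = (if a \<le> m then a + n else if a \<le> m + n then a - m else a)"
  using assms
proof (induction m arbitrary: a)
  case 0
  then show ?case by (simp add: A_word_def)
next
  case (Suc m)
  have "1 \<le> end_pos [Suc m..<Suc m + n] a" unfolding end_pos_row using Suc.prems by auto
  from Suc.IH[OF this] show ?case
    unfolding A_word_Suc_row end_pos_append end_pos_row using Suc.prems by auto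
qed

text \<open>
  The case distinction of the next induction, for positions \<open>a'\<close> and \<open>b'\<close> of the two strands after
  the first row.
\<close>

lemma row_then_block_crossing_count:
  fixes a b a' b' m n :: nat
  assumes "a \<noteq> b" "1 \<le> a" "1 \<le> b"
   and "a = Suc m \<and> a' = Suc m + n \<or> Suc m < a \<and> a \<le> Suc m + n \<and> a = Suc a'
      \<or> a < Suc m \<and> a' = a \<or> Suc m + n < a \<and> a' = a"
   and "b = Suc m \<and> b' = Suc m + n \<or> Suc m < b \<and> b \<le> Suc m + n \<and> b = Suc b'
      \<or> b < Suc m \<and> b' = b \<or> Suc m + n < b \<and> b' = b"
 shows "(if a = Suc m \<and> Suc m < b \<and> b \<le> Suc m + n \<or> b = Suc m \<and> Suc m < a \<and> a \<le> Suc m + n then 1 else 0) +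
   (if a' \<le> m \<and> m < b' \<and> b' \<le> m + n \<or> b' \<le> m \<and> m < a' \<and> a' \<le> m + n then 1 else 0) =
   (if a \<le> Suc m \<and> Suc m < b \<and> b \<le> Suc m + n \<or> b \<le> Suc m \<and> Suc m < a \<and> a \<le> Suc m + n then 1 else (0::nat))"
  using assms by (elim disjE conjE) (simp_all)

text \<open>
  The row of index \<open>j\<close> carries the strand at position \<open>j\<close> across \<open>n\<close> others. Read from index \<open>m\<close> down to \<open>1\<close>,
  the rows carry the block of the first \<open>m\<close> strands, one after the other, across the block of the last \<open>n\<close>
  strands.
\<close>

lemma crossings_A_word:
  assumes "a \<noteq> b" "1 \<le> a" "1 \<le> b"
  shows "crossings (A_word m n) a b
    = (if a \<le> m \<and> m < b \<and> b \<le> m + n \<or> b \<le> m \<and> m < a \<and> a \<le> m + n then 1 else 0)"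
  using assms
proof (induction m arbitrary: a b)
  case 0
  then show ?case by (simp add: A_word_def)
next
  case (Suc m)
  let ?r = "[Suc m..<Suc m + n]"
  have "end_pos ?r a \<noteq> end_pos ?r b" using Suc.prems(1) end_pos_inj by blast
  moreover have "1 \<le> end_pos ?r a" "1 \<le> end_pos ?r b" unfolding end_pos_row using Suc.prems by auto
  ultimately have IH: "crossings (A_word m n) (end_pos ?r a) (end_pos ?r b)
    = (if end_pos ?r a \<le> m \<and> m < end_pos ?r b \<and> end_pos ?r b \<le> m + n
        \<or> end_pos ?r b \<le> m \<and> m < end_pos ?r a \<and> end_pos ?r a \<le> m + n then 1 else 0)"
    by (rule Suc.IH)
  have pos: "c = Suc m \<and> end_pos ?r c = Suc m + n
      \<or> Suc m < c \<and> c \<le> Suc m + n \<and> c = Suc (end_pos ?r c)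
      \<or> c < Suc m \<and> end_pos ?r c = c \<or> Suc m + n < c \<and> end_pos ?r c = c" for c
    unfolding end_pos_row by auto
  show ?case
    unfolding A_word_Suc_row crossings_append IH crossings_row[OF Suc.prems(1)]
    by (rule row_then_block_crossing_count[OF Suc.prems pos pos])
qed

lemma end_pos_A_word_rotation:
  assumes "x < m + n"
  shows "end_pos (A_word m n) (x + 1) = (x + n) mod (m + n) + 1"
proof (cases "x < m")
  case False
  then have "(x + n) mod (m + n) = x - m" using assms by (simp add: le_mod_geq)
  then show ?thesis using assms False by (simp add: end_pos_A_word)
qed (use assms in \<open>simp add: end_pos_A_word\<close>)

lemma A_word_closes:
  assumes "a \<in> {1..m + n}"
  shows "end_pos (concat (replicate (m + n) (A_word m n))) a = a"
proof -
  obtain x where x: "a = x + 1" "x < m + n" using assms by (metis Suc_eq_plus1 Suc_le_lessD atLeastAtMost_iff le_add_diff_inverse2)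
  show ?thesis
    unfolding x(1) by (subst end_pos_replicate_rotation[OF end_pos_A_word_rotation]) (use x in auto)
qed

text \<open>
  One turn rotates the positions by \<open>n\<close>, which is coprime to \<open>m + n\<close>. In the course of \<open>m + n\<close>
  turns a strand therefore visits each position once, and a second strand stays at a fixed cyclic
  distance \<open>d\<close>. They cross whenever exactly one of them is in the first block.
\<close>

lemma A_total_crossings:
  assumes "coprime m n" "x < m + n" "x + d < m + n" "0 < d"
  shows "crossings (concat (replicate (m + n) (A_word m n))) (x + 1) (x + d + 1)
    = card {z. z < m + n \<and> (z < m) \<noteq> ((z + d) mod (m + n) < m)}" (is "?L = card ?S")
proof -
  let ?k = "m + n"
  let ?pos = "\<lambda>r x. (x + r * n) mod ?k"
  have k0: "0 < ?k" using assms(2) by linarith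
  have "gcd n (n + m) = gcd n m" by (rule gcd_add2)
  then have cop: "coprime n ?k" using assms(1) by (simp add: coprime_iff_gcd_eq_1 gcd.commute add.commute)
  have pos: "end_pos (concat (replicate r (A_word m n))) (y + 1) = ?pos r y + 1" if "y < ?k" for r y
    by (rule end_pos_replicate_rotation[OF end_pos_A_word_rotation that])
  have "?L = (\<Sum>r<?k. crossings (A_word m n) (?pos r x + 1) (?pos r (x + d) + 1))"
    unfolding crossings_replicate by (simp only: pos assms)
  also have "\<dots> = (\<Sum>r<?k. (\<lambda>z. if (z < m) \<noteq> ((z + d) mod ?k < m) then 1 else 0) (?pos r x))"
  proof (rule sum.cong[OF refl])
    fix r assume "r \<in> {..<?k}"
    have "?pos r (x + d) = (?pos r x + d) mod ?k" by (simp add: mod_simps algebra_simps)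
    moreover have "?pos r x + 1 \<noteq> ?pos r (x + d) + 1"
      using assms(2-4) pos[of x r] pos[of "x + d" r]
      by (metis add_right_cancel end_pos_inj less_irrefl add.right_neutral add_left_cancel)
    moreover have "?pos r x < ?k" "?pos r (x + d) < ?k" by (rule mod_less_divisor[OF k0])+
    ultimately show "crossings (A_word m n) (?pos r x + 1) (?pos r (x + d) + 1)
        = (\<lambda>z. if (z < m) \<noteq> ((z + d) mod ?k < m) then 1 else 0) (?pos r x)"
      by (subst crossings_A_word) auto
  qed
  also have "\<dots> = (\<Sum>z<?k. if (z < m) \<noteq> ((z + d) mod ?k < m) then 1 else 0)"
    by (rule sum.reindex_bij_betw[OF bij_rotation[OF cop k0]])
  also have "\<dots> = card ?S"
    by (simp add: sum.If_cases Int_def)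
  finally show ?thesis .
qed

lemma A_crossings_1:
  assumes "coprime m n" "2 \<le> m" "2 \<le> n" "x + 1 < m + n"
  shows "crossings (concat (replicate (m + n) (A_word m n))) (x + 1) (x + 2) = 2"
proof -
  let ?k = "m + n"
  have "{z. z < ?k \<and> (z < m) \<noteq> ((z + 1) mod ?k < m)} = {m - 1, ?k - 1}"
  proof (intro equalityI subsetI)
    fix z assume z: "z \<in> {z. z < ?k \<and> (z < m) \<noteq> ((z + 1) mod ?k < m)}"
    show "z \<in> {m - 1, ?k - 1}"
    proof (cases "z + 1 = ?k")
      case False
      then have "(z + 1) mod ?k = z + 1" using z by simp
      then show ?thesis using z by auto
    qed auto
  next
    fix z assume z: "z \<in> {m - 1, ?k - 1}"
    then show "z \<in> {z. z < ?k \<and> (z < m) \<noteq> ((z + 1) mod ?k < m)}"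
      using assms(2,3) by auto
  qed
  moreover have "m - 1 \<noteq> ?k - 1" using assms by auto
  ultimately show ?thesis using A_total_crossings[of m n x 1] assms by (simp add: numeral_2_eq_2)
qed

lemma A_crossings_2:
  assumes "coprime m n" "2 \<le> m" "2 \<le> n" "x + 2 < m + n"
  shows "crossings (concat (replicate (m + n) (A_word m n))) (x + 1) (x + 3) = 4"
proof -
  let ?k = "m + n"
  have wrap: "(z + 2) mod ?k = (if z + 2 < ?k then z + 2 else z + 2 - ?k)" if "z < ?k" for z
    using that assms(2) by (auto simp: le_mod_geq)
  have "{z. z < ?k \<and> (z < m) \<noteq> ((z + 2) mod ?k < m)} = {m - 1, m - 2, ?k - 1, ?k - 2}"
  proof (intro equalityI subsetI)
    fix z assume "z \<in> {z. z < ?k \<and> (z < m) \<noteq> ((z + 2) mod ?k < m)}"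
    then have z: "z < ?k" "(z < m) \<noteq> ((z + 2) mod ?k < m)" by auto
    show "z \<in> {m - 1, m - 2, ?k - 1, ?k - 2}"
      using z(2) unfolding wrap[OF z(1)] using z(1) assms(2,3) by (auto split: if_splits)
  next
    fix z assume z: "z \<in> {m - 1, m - 2, ?k - 1, ?k - 2}"
    then have zk: "z < ?k" using assms(2,3) by auto
    have "(z < m) \<noteq> ((z + 2) mod ?k < m)"
      unfolding wrap[OF zk] using z assms(2,3) by auto
    then show "z \<in> {z. z < ?k \<and> (z < m) \<noteq> ((z + 2) mod ?k < m)}" using zk by simp
  qed
  moreover have "card {m - 1, m - 2, ?k - 1, ?k - 2} = 4" using assms by (simp add: card_insert_if) linarith
  ultimately show ?thesis using A_total_crossings[of m n x 2] assms by (simp add: numeral_3_eq_3)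
qed

lemma A_word_letters: "i \<in> set (A_word m n) \<Longrightarrow> 1 \<le> i \<and> i < m + n"
  by (auto simp: A_word_def)

lemma A_word_nonempty: "1 \<le> m \<Longrightarrow> 1 \<le> n \<Longrightarrow> A_word m n \<noteq> []"
  by (cases m) (simp_all add: A_word_Suc_row)

lemma end_pos_sweep:
  assumes "x < p"
  shows "end_pos [1..<p] (x + 1) = (x + (p - 1)) mod p + 1"
proof -
  have e: "[1..<p] = [1..<1 + (p - 1)]" using assms by simp
  show ?thesis
  proof (cases "x = 0")
    case False
    then have "(x + (p - 1)) mod p = x - 1" using assms by (simp add: le_mod_geq)
    then show ?thesis unfolding e end_pos_row using False assms by auto
  qed (unfold e end_pos_row, use assms in auto)
qed

lemma replicate_B_word: "concat (replicate N (B_word p q)) = concat (replicate (N * q) [1..<p])"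
  by (induction N) (simp_all add: B_word_def replicate_add)

lemma B_word_closes:
  assumes "a \<in> {1..p}"
  shows "end_pos (concat (replicate p (B_word p q))) a = a"
proof -
  obtain x where x: "a = x + 1" "x < p" using assms by (metis Suc_eq_plus1 Suc_le_lessD atLeastAtMost_iff le_add_diff_inverse2)
  show ?thesis
    unfolding x(1) replicate_B_word by (subst end_pos_replicate_rotation[OF end_pos_sweep]) (use x in \<open>auto simp: mult.assoc\<close>)
qed

lemma sum_lessThan_add:
  fixes f :: "nat \<Rightarrow> 'a::comm_monoid_add"
  shows "sum f {..<a + b} = sum f {..<a} + (\<Sum>r<b. f (a + r))"
  by (induction b) (simp_all add: add.assoc)

lemma visits_of_first_position:
  assumes "0 < p"
  shows "(\<Sum>r<p * q. if (x + r * (p - 1)) mod p = 0 then 1 else 0 :: nat) = q"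
proof (induction q)
  case (Suc q)
  let ?f = "\<lambda>r. if (x + r * (p - 1)) mod p = 0 then 1 else 0 :: nat"
  have "coprime (p - 1) p" using coprime_diff_one_left_nat[OF assms] .
  have "(\<Sum>r<p * Suc q. ?f r) = (\<Sum>r<p * q. ?f r) + (\<Sum>r<p. ?f (p * q + r))"
    using sum_lessThan_add[of ?f "p * q" p] by (simp add: add.commute[of p])
  also have "(\<Sum>r<p. ?f (p * q + r)) = (\<Sum>r<p. (\<lambda>z. if z = 0 then 1 else 0) ((x + r * (p - 1)) mod p))"
  proof (rule sum.cong[OF refl])
    fix r
    have "(x + (p * q + r) * (p - 1)) mod p = (x + r * (p - 1) + p * (q * (p - 1))) mod p"
      by (simp add: algebra_simps)
    then show "?f (p * q + r) = (\<lambda>z. if z = 0 then 1 else 0) ((x + r * (p - 1)) mod p)" by simp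
  qed
  also have "\<dots> = (\<Sum>z<p. if z = 0 then 1 else 0)"
    by (rule sum.reindex_bij_betw[OF bij_rotation]) (use assms \<open>coprime (p - 1) p\<close> in auto)
  also have "\<dots> = 1" using assms by simp
  finally show ?case using Suc by simp
qed simp

lemma crossings_sweep:
  assumes "x \<noteq> y" "x < p" "y < p"
  shows "crossings [1..<p] (x + 1) (y + 1) = (if x = 0 then 1 else 0) + (if y = 0 then 1 else 0)"
proof -
  have e: "[1..<p] = [1..<1 + (p - 1)]" using assms by simp
  have "x + 1 \<noteq> y + 1" using assms by simp
  then show ?thesis unfolding e crossings_row[OF \<open>x + 1 \<noteq> y + 1\<close>] using assms by auto
qed

text \<open>
  A sweep \<open>\<sigma>\<^sub>1 \<dots> \<sigma>\<^sub>p\<^sub>-\<^sub>1\<close> carries the strand in first position across all others and rotates the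
  positions. Two strands cross when one of them is in first position, and in \<open>p * q\<close> sweeps each of
  them is there \<open>q\<close> times. In particular all pairs of strands cross equally often.
\<close>

lemma B_crossings:
  assumes "a \<in> {1..p}" "b \<in> {1..p}" "a \<noteq> b"
  shows "crossings (concat (replicate p (B_word p q))) a b = 2 * q"
proof -
  obtain x y where x: "a = x + 1" "x < p" and y: "b = y + 1" "y < p"
    using assms by (metis Suc_eq_plus1 Suc_le_lessD atLeastAtMost_iff le_add_diff_inverse2)
  let ?pos = "\<lambda>r x. (x + r * (p - 1)) mod p"
  let ?f = "\<lambda>x r. if ?pos r x = 0 then 1 else 0 :: nat"
  have pos: "end_pos (concat (replicate r [1..<p])) (z + 1) = ?pos r z + 1" if "z < p" for r z
    by (rule end_pos_replicate_rotation[OF end_pos_sweep that])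
  have "crossings (concat (replicate p (B_word p q))) a b
      = (\<Sum>r<p * q. crossings [1..<p] (?pos r x + 1) (?pos r y + 1))"
    unfolding replicate_B_word crossings_replicate x(1) y(1) by (simp only: pos x(2) y(2))
  also have "\<dots> = (\<Sum>r<p * q. ?f x r + ?f y r)"
  proof (rule sum.cong[OF refl])
    fix r
    have ne: "?pos r x + 1 \<noteq> ?pos r y + 1"
      using assms(3) unfolding x(1) y(1) pos[OF x(2), symmetric] pos[OF y(2), symmetric] end_pos_inj .
    then show "crossings [1..<p] (?pos r x + 1) (?pos r y + 1) = ?f x r + ?f y r"
      using x by (intro crossings_sweep) auto
  qed
  also have "\<dots> = q + q"
    unfolding sum.distrib using visits_of_first_position[of p _ q] x by simp
  finally show ?thesis by simp
qed

lemma B_word_letters: "i \<in> set (B_word p q) \<Longrightarrow> 1 \<le> i \<and> i < p"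
  by (auto simp: B_word_def split: if_splits)

lemma B_word_nonempty: "2 \<le> p \<Longrightarrow> 1 \<le> q \<Longrightarrow> B_word p q \<noteq> []"
  by (cases q) (auto simp: B_word_def)

section \<open>The two knots are not isotopic\<close>

sublocale filling_with_angle \<subseteq> cyclic_cover unwound J Ji
  by (rule is_cyclic_cover)

context filling_with_angle begin

lemma graphs_of_lines:
  assumes j: "j = (\<lambda>p. \<iota> (solid_torus_map p))"
    and w: "w \<noteq> []" "\<And>i. i \<in> set w \<Longrightarrow> 1 \<le> i \<and> i < k" and N: "N \<ge> 1"
    and closes: "\<And>a. a \<in> {1..k} \<Longrightarrow> end_pos (concat (replicate N w)) a = a"
  shows "(\<Union>a\<in>{1..k}. graph (line N w a)) = {q \<in> unwound. snd q \<in> \<iota> ` closed_braid k w}"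
proof (intro equalityI subsetI)
  fix q assume "q \<in> (\<Union>a\<in>{1..k}. graph (line N w a))"
  then obtain a s where a: "a \<in> {1..k}" "q = J (s, line N w a s)" by (auto simp: graph_def)
  have "solid_torus_map (cis s, line N w a s) \<in> closed_braid k w"
    using closed_braid_lines[OF w N closes] a(1) by blast
  moreover have "snd q = \<iota> (solid_torus_map (cis s, line N w a s))"
    using fun_cong[OF j, of "(cis s, line N w a s)"] by (simp add: a J_def)
  ultimately have "snd q \<in> \<iota> ` closed_braid k w" by simp
  then show "q \<in> {q \<in> unwound. snd q \<in> \<iota> ` closed_braid k w}" using J_unwound a(2) by simp
next
  fix q assume q: "q \<in> {q \<in> unwound. snd q \<in> \<iota> ` closed_braid k w}"
  then obtain P where P: "P \<in> closed_braid k w" "snd q = \<iota> P" by auto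
  obtain u x where ux: "u \<in> circle" "P = solid_torus_map (u, x)"
    using P(1) closed_braid_subset[of k w] solid_torus_map_image by blast
  have y: "snd q = j (u, x)" using P ux fun_cong[OF j, of "(u, x)"] by simp
  then have "q \<in> range J" using q ux(1) unfolding range_J by auto
  then obtain s x' where sx: "q = J (s, x')" by auto
  have "j (cis s, x') = j (u, x)" using y sx by (simp add: J_def)
  then have "ji (j (cis s, x')) = ji (j (u, x))" by simp
  then have "cis s = u" "x' = x" using ux(1) by simp_all
  then have "solid_torus_map (cis s, x') \<in> closed_braid k w" using P(1) ux(2) by simp
  then obtain a where "a \<in> {1..k}" "x' = line N w a s"
    using closed_braid_lines[OF w N closes] by blast
  then show "q \<in> (\<Union>a\<in>{1..k}. graph (line N w a))" using sx by auto
qed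

text \<open>
  The quotient \<open>\<theta> \<circ> H t / \<theta>\<close> is a homotopy from the constant map \<open>1\<close> to \<open>\<theta> \<circ> H 1 / \<theta>\<close>, so the latter has
  a logarithm. Its imaginary part \<open>\<kappa>\<close> lifts \<open>H 1\<close> to the infinite cyclic cover.
\<close>

lemma angle_change_under_isotopy:
  assumes H: "continuous_map (prod_topology (top_of_set {0..1}) (top_of_set M)) (top_of_set M) (\<lambda>(t, x). H t x)"
    and H0: "\<And>y. y \<in> M \<Longrightarrow> H (0::real) y = y"
  obtains \<kappa> where "continuous_on M \<kappa>" "\<And>y. y \<in> M \<Longrightarrow> \<theta> (H 1 y) = \<theta> y * cis (\<kappa> y)"
proof -
  have cH: "continuous_on ({0..1} \<times> M) (\<lambda>(t, x). H t x)" and HM: "\<And>t y. t \<in> {0..1} \<Longrightarrow> y \<in> M \<Longrightarrow> H t y \<in> M"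
    using H by (auto simp: prod_topology_subtopology_eu Pi_iff)
  have nz: "cmod (\<theta> y) = 1" if "y \<in> M" for y
    using \<theta>_circle that by (auto simp: mem_circle)
  then have nz': "\<theta> y \<noteq> 0" if "y \<in> M" for y using that by force
  define K where "K = (\<lambda>(t, y). \<theta> (H t y) / \<theta> y)"
  have "homotopic_with_canon (\<lambda>h. True) M (sphere 0 1) (\<lambda>_. 1) (\<lambda>y. \<theta> (H 1 y) / \<theta> y)"
  proof (subst homotopic_with, simp, intro exI[of _ K] conjI)
    have c: "continuous_on ({0..1} \<times> M) (\<lambda>p. \<theta> (H (fst p) (snd p)))"
      by (rule continuous_on_compose2[OF \<theta>_cont]) (use cH HM in \<open>auto simp: case_prod_unfold\<close>)
    have "continuous_on ({0..1} \<times> M) K"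
      unfolding K_def case_prod_unfold
      by (intro continuous_intros c continuous_on_compose2[OF \<theta>_cont]) (use nz in force)+
    moreover have "K p \<in> sphere 0 1" if "p \<in> {0..1} \<times> M" for p
      using that nz HM by (auto simp: K_def norm_divide)
    ultimately show "continuous_map (prod_topology (top_of_set {0..1}) (top_of_set M)) (top_of_set (sphere 0 1)) K"
      by (auto simp: prod_topology_subtopology_eu)
  qed (use H0 nz' in \<open>auto simp: K_def\<close>)
  then have "\<exists>a. homotopic_with_canon (\<lambda>h. True) M (sphere 0 1) (\<lambda>y. \<theta> (H 1 y) / \<theta> y) (\<lambda>_. a)"
    using homotopic_with_symD by blast
  then obtain \<kappa> where \<kappa>: "continuous_on M \<kappa>" "\<And>y. y \<in> M \<Longrightarrow> \<theta> (H 1 y) / \<theta> y = exp (\<i> * of_real (\<kappa> y))"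
    unfolding inessential_eq_continuous_logarithm_circle by blast
  have "\<theta> (H 1 y) = \<theta> y * cis (\<kappa> y)" if "y \<in> M" for y
  proof -
    have "\<theta> y \<noteq> 0" using nz[OF that] by auto
    then show ?thesis using \<kappa>(2)[OF that] by (simp add: cis_conv_exp field_simps)
  qed
  with \<kappa>(1) show ?thesis by (rule that)
qed

lemma isotopy_lifts:
  assumes H: "continuous_map (prod_topology (top_of_set {0..1}) (top_of_set M)) (top_of_set M) (\<lambda>(t, x). H t x)"
      "homeomorphic_map (top_of_set M) (top_of_set M) (H 1)" "\<And>y. y \<in> M \<Longrightarrow> H (0::real) y = y"
  obtains \<Theta> \<Theta>' where "continuous_on unwound \<Theta>" "continuous_on unwound \<Theta>'"
    "\<And>q. q \<in> unwound \<Longrightarrow> \<Theta> q \<in> unwound" "\<And>q. q \<in> unwound \<Longrightarrow> \<Theta>' q \<in> unwound"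
    "\<And>q. q \<in> unwound \<Longrightarrow> \<Theta>' (\<Theta> q) = q" "\<And>q. q \<in> unwound \<Longrightarrow> \<Theta> (\<Theta>' q) = q"
    "\<And>q. snd (\<Theta> q) = H 1 (snd q)" "\<And>s t y. \<Theta> (s + t, y) = (fst (\<Theta> (s, y)) + t, snd (\<Theta> (s, y)))"
proof -
  obtain \<kappa> where \<kappa>: "continuous_on M \<kappa>" "\<And>y. y \<in> M \<Longrightarrow> \<theta> (H 1 y) = \<theta> y * cis (\<kappa> y)"
    using angle_change_under_isotopy[OF H(1,3)] by blast
  define \<Phi> where "\<Phi> = H 1"
  obtain \<Phi>' where "homeomorphic_maps (top_of_set M) (top_of_set M) \<Phi> \<Phi>'"
    using H(2) homeomorphic_map_maps unfolding \<Phi>_def by blast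
  then have \<Phi>: "continuous_on M \<Phi>" "\<And>y. y \<in> M \<Longrightarrow> \<Phi> y \<in> M" "continuous_on M \<Phi>'" "\<And>y. y \<in> M \<Longrightarrow> \<Phi>' y \<in> M"
      "\<And>y. y \<in> M \<Longrightarrow> \<Phi>' (\<Phi> y) = y" "\<And>y. y \<in> M \<Longrightarrow> \<Phi> (\<Phi>' y) = y"
    by (auto simp: homeomorphic_maps_def Pi_iff)
  define \<Theta> where "\<Theta> = (\<lambda>(s, y). (s + \<kappa> y, \<Phi> y))"
  define \<Theta>' where "\<Theta>' = (\<lambda>(s, y). (s - \<kappa> (\<Phi>' y), \<Phi>' y))"
  have sndX: "snd ` unwound \<subseteq> M" by (auto simp: unwound_def)
  have c\<Theta>: "continuous_on unwound \<Theta>"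
    unfolding \<Theta>_def case_prod_unfold
    by (intro continuous_intros continuous_on_compose2[OF \<kappa>(1) _ sndX] continuous_on_compose2[OF \<Phi>(1) _ sndX])
  have c\<Phi>': "continuous_on unwound (\<lambda>q. \<Phi>' (snd q))"
    by (rule continuous_on_compose2[OF \<Phi>(3) _ sndX]) (intro continuous_intros)
  have c\<Theta>': "continuous_on unwound \<Theta>'"
    unfolding \<Theta>'_def case_prod_unfold
    by (intro continuous_intros continuous_on_compose2[OF \<kappa>(1) c\<Phi>'] c\<Phi>') (use \<Phi>(4) sndX in auto)
  have \<Theta>X: "\<Theta> q \<in> unwound" if "q \<in> unwound" for q
    using that \<Phi>(2) \<kappa>(2) by (auto simp: \<Theta>_def unwound_def \<Phi>_def simp flip: cis_mult)
  have \<Theta>'X: "\<Theta>' q \<in> unwound" if qX: "q \<in> unwound" for q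
  proof -
    obtain s y where sy: "q = (s, y)" "y \<in> M" "cis s = \<theta> y" using qX by (auto simp: unwound_def)
    have "\<theta> y = \<theta> (\<Phi>' y) * cis (\<kappa> (\<Phi>' y))"
      using \<kappa>(2)[OF \<Phi>(4)[OF sy(2)]] \<Phi>(6)[OF sy(2)] by (simp add: \<Phi>_def)
    moreover have "cis (s - \<kappa> (\<Phi>' y)) = cis s / cis (\<kappa> (\<Phi>' y))" by (simp add: cis_divide)
    ultimately show ?thesis using sy \<Phi>(4) by (simp add: \<Theta>'_def unwound_def)
  qed
  have \<Theta>'\<Theta>: "\<Theta>' (\<Theta> q) = q" if "q \<in> unwound" for q
    using that \<Phi>(5) by (auto simp: \<Theta>'_def \<Theta>_def unwound_def)
  have \<Theta>\<Theta>': "\<Theta> (\<Theta>' q) = q" if "q \<in> unwound" for q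
    using that \<Phi>(6) by (auto simp: \<Theta>'_def \<Theta>_def unwound_def)
  show ?thesis
    by (rule that[of \<Theta> \<Theta>']) (use c\<Theta> c\<Theta>' \<Theta>X \<Theta>'X \<Theta>'\<Theta> \<Theta>\<Theta>' in \<open>auto simp: \<Theta>_def \<Phi>_def case_prod_unfold\<close>)
qed

text \<open>
  The lift \<open>\<Theta>\<close> of the final map of an isotopy matches the lines of the two closed braids bijectively, so
  \<open>p = m + n\<close>. For the second braid all crossing numbers agree, so every four-term combination vanishes.
  For the first one, the strands at positions \<open>1, 4, 2, 3\<close> violate this, since strands at distance one
  cross twice and strands at distance two cross four times.
\<close>

theorem braids_not_isotopic:
  assumes j: "j = (\<lambda>p. \<iota> (solid_torus_map p))"
    and mn: "coprime m n" "2 \<le> m" "m < n" and pq: "2 \<le> p" "1 \<le> q"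
  shows "\<not> ambient_isotopic (top_of_set M) (\<iota> ` closed_braid (m + n) (A_word m n)) (\<iota> ` closed_braid p (B_word p q))"
proof
  let ?k = "m + n" and ?KA = "\<iota> ` closed_braid (m + n) (A_word m n)" and ?KB = "\<iota> ` closed_braid p (B_word p q)"
  assume "ambient_isotopic (top_of_set M) ?KA ?KB"
  then obtain H :: "real \<Rightarrow> 'b \<Rightarrow> 'b" where H:
      "continuous_map (prod_topology (top_of_set {0..1}) (top_of_set M)) (top_of_set M) (\<lambda>(t, x). H t x)"
      "homeomorphic_map (top_of_set M) (top_of_set M) (H 1)" "\<And>y. y \<in> M \<Longrightarrow> H 0 y = y" "H 1 ` ?KA = ?KB"
    and KM: "?KA \<subseteq> M"
    unfolding ambient_isotopic_def by auto
  obtain \<Theta> \<Theta>' where c\<Theta>: "continuous_on unwound \<Theta>" and c\<Theta>': "continuous_on unwound \<Theta>'"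
    and \<Theta>X: "\<And>r. r \<in> unwound \<Longrightarrow> \<Theta> r \<in> unwound" and \<Theta>'X: "\<And>r. r \<in> unwound \<Longrightarrow> \<Theta>' r \<in> unwound"
    and \<Theta>'\<Theta>: "\<And>r. r \<in> unwound \<Longrightarrow> \<Theta>' (\<Theta> r) = r" and \<Theta>\<Theta>': "\<And>r. r \<in> unwound \<Longrightarrow> \<Theta> (\<Theta>' r) = r"
    and snd\<Theta>: "\<And>r. snd (\<Theta> r) = H 1 (snd r)"
    and \<Theta>shift: "\<And>s t y. \<Theta> (s + t, y) = (fst (\<Theta> (s, y)) + t, snd (\<Theta> (s, y)))"
    by (rule isotopy_lifts[OF H(1-3)]) (assumption | rule that)+
  define T where "T = (\<lambda>(s, y). (s + 2 * pi * real ?k, y :: 'b))"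
  let ?wA = "A_word m n" and ?wB = "B_word p q"
  have wA: "?wA \<noteq> []" and wB: "?wB \<noteq> []"
    using A_word_nonempty[of m n] B_word_nonempty[of p q] mn pq by auto
  have N: "?k \<ge> 1" "p \<ge> 1" using mn pq by auto
  define lA where "lA = line ?k ?wA"
  define lB where "lB = line p ?wB"
  have gA: "(\<Union>a\<in>{1..?k}. graph (lA a)) = {q \<in> unwound. snd q \<in> ?KA}"
    unfolding lA_def by (rule graphs_of_lines[OF j wA A_word_letters N(1) A_word_closes])
  have gB: "(\<Union>b\<in>{1..p}. graph (lB b)) = {q \<in> unwound. snd q \<in> ?KB}"
    unfolding lB_def by (rule graphs_of_lines[OF j wB B_word_letters N(2) B_word_closes])
  have lA: "continuous_on UNIV (lA a)" "\<And>s. lA a (s + 2 * pi * real ?k) = lA a s" "bounded (range (lA a))"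
    if "a \<in> {1..?k}" for a
    unfolding lA_def using line_properties[OF wA N(1) A_word_closes[OF that]] by auto
  have lB: "continuous_on UNIV (lB b)" "\<And>s. lB b (s + 2 * pi * real p) = lB b s" "bounded (range (lB b))"
    if "b \<in> {1..p}" for b
    unfolding lB_def using line_properties[OF wB N(2) B_word_closes[OF that]] by auto
  have dA: "lA a s \<noteq> lA a' s" if "a \<in> {1..?k}" "a' \<in> {1..?k}" "a \<noteq> a'" for a a' s
    using line_log[OF that(3) wA N(1) A_word_closes[OF that(1)] A_word_closes[OF that(2)]]
    unfolding lA_def by (metis eq_iff_diff_eq_0 exp_not_eq_zero)
  have dB: "lB b s \<noteq> lB b' s" if "b \<in> {1..p}" "b' \<in> {1..p}" "b \<noteq> b'" for b b' s
    using line_log[OF that(3) wB N(2) B_word_closes[OF that(1)] B_word_closes[OF that(2)]]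
    unfolding lB_def by (metis eq_iff_diff_eq_0 exp_not_eq_zero)
  have \<Theta>K: "\<Theta> ` (\<Union>a\<in>{1..?k}. graph (lA a)) \<subseteq> (\<Union>b\<in>{1..p}. graph (lB b))"
    unfolding gA gB using \<Theta>X H(4) by (auto simp: snd\<Theta>)
  have \<Theta>'K: "\<Theta>' ` (\<Union>b\<in>{1..p}. graph (lB b)) \<subseteq> (\<Union>a\<in>{1..?k}. graph (lA a))"
    unfolding gA gB
  proof (rule image_subsetI)
    fix r assume r: "r \<in> {r \<in> unwound. snd r \<in> ?KB}"
    then have "snd r \<in> H 1 ` ?KA" unfolding H(4) by simp
    then obtain y where y: "y \<in> ?KA" "H 1 y = snd r" by (metis imageE)
    have "H 1 (snd (\<Theta>' r)) = H 1 y" using r \<Theta>\<Theta>' y(2) by (simp flip: snd\<Theta>)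
    moreover have "snd (\<Theta>' r) \<in> M" "y \<in> M" using r \<Theta>'X y(1) KM by (force simp: unwound_def)+
    moreover have "inj_on (H 1) M" using H(2) using homeomorphic_imp_injective_map by fastforce
    ultimately have "snd (\<Theta>' r) = y" by (simp add: inj_on_eq_iff)
    then show "\<Theta>' r \<in> {r \<in> unwound. snd r \<in> ?KA}" using \<Theta>'X r y by auto
  qed
  obtain \<sigma> where \<sigma>: "bij_betw \<sigma> {1..?k} {1..p}"
    and lines: "\<And>a. a \<in> {1..?k} \<Longrightarrow> \<Theta> ` graph (lA a) = graph (lB (\<sigma> a))"
    by (rule homeo_permutes_graphs[OF finite_atLeastAtMost finite_atLeastAtMost lA(1) dA lB(1) dB
          c\<Theta> \<Theta>K \<Theta>'\<Theta> c\<Theta>' \<Theta>'K \<Theta>\<Theta>']) (assumption | rule that)+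
  have kp: "p = ?k" using bij_betw_same_card[OF \<sigma>] by simp
  \<comment> \<open>The positions of four strands for which the four-term combination does not vanish.\<close>
  define pa :: "nat \<Rightarrow> nat" where "pa i = [1, 4, 2, 3] ! i" for i
  have lt4: "i < 4 \<longleftrightarrow> i \<in> {0, 1, 2, 3}" for i :: nat by auto
  have pa: "pa i \<in> {1..?k}" if "i < 4" for i
    using that mn unfolding lt4 by (auto simp: pa_def numeral_2_eq_2 numeral_3_eq_3)
  have pa_ne: "pa i \<noteq> pa i'" if "i < 4" "i' < 4" "i \<noteq> i'" for i i'
    using that unfolding lt4 by (auto simp: pa_def numeral_2_eq_2 numeral_3_eq_3)
  define cA where "cA a b = \<i> * pi * of_nat (crossings (concat (replicate ?k ?wA)) a b)" for a b
  have exA: "\<exists>l. continuous_on UNIV l \<and> (\<forall>s. exp (l s) = lA (pa i) s - lA (pa i') s) \<and>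
      (\<forall>s. l (s + 2 * pi * real ?k) = l s + cA (pa i) (pa i'))" if "i < 4" "i' < 4" "i \<noteq> i'" for i i'
    using line_log[OF pa_ne[OF that] wA N(1) A_word_closes[OF pa] A_word_closes[OF pa]] that
    unfolding lA_def cA_def by metis
  have \<sigma>_ne: "\<sigma> (pa i) \<noteq> \<sigma> (pa i')" if "i < 4" "i' < 4" "i \<noteq> i'" for i i'
    using pa_ne[OF that] bij_betw_imp_inj_on[OF \<sigma>] pa that by (simp add: inj_on_eq_iff)
  have \<sigma>p: "\<sigma> (pa i) \<in> {1..p}" if "i < 4" for i using bij_betwE[OF \<sigma>] pa[OF that] by blast
  have exB: "\<exists>l. continuous_on UNIV l \<and> (\<forall>s. exp (l s) = lB (\<sigma> (pa i)) s - lB (\<sigma> (pa i')) s) \<and>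
      (\<forall>s. l (s + 2 * pi * real ?k) = l s + \<i> * pi * of_nat (2 * q))" if "i < 4" "i' < 4" "i \<noteq> i'" for i i'
    using line_log[OF \<sigma>_ne[OF that] wB N(2) B_word_closes[OF \<sigma>p] B_word_closes[OF \<sigma>p]] that
      B_crossings[OF \<sigma>p[OF that(1)] \<sigma>p[OF that(2)] \<sigma>_ne[OF that], of q]
    unfolding lB_def kp[symmetric] by metis
  from exA obtain LA where LA: "\<And>i i'. i < 4 \<Longrightarrow> i' < 4 \<Longrightarrow> i \<noteq> i' \<Longrightarrow> continuous_on UNIV (LA i i') \<and>
      (\<forall>s. exp (LA i i' s) = lA (pa i) s - lA (pa i') s) \<and>
      (\<forall>s. LA i i' (s + 2 * pi * real ?k) = LA i i' s + cA (pa i) (pa i'))" by metis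
  from exB obtain LB where LB: "\<And>i i'. i < 4 \<Longrightarrow> i' < 4 \<Longrightarrow> i \<noteq> i' \<Longrightarrow> continuous_on UNIV (LB i i') \<and>
      (\<forall>s. exp (LB i i' s) = lB (\<sigma> (pa i)) s - lB (\<sigma> (pa i')) s) \<and>
      (\<forall>s. LB i i' (s + 2 * pi * real ?k) = LB i i' s + \<i> * pi * of_nat (2 * q))" by metis
  have cisT: "cis (s + 2 * pi * real ?k) = cis s" for s
  proof -
    have "cis (2 * pi * real ?k) = 1" by (rule cis_multiple_2pi) simp
    then show ?thesis by (simp only: mult_1_right flip: cis_mult)
  qed
  have "cA (pa 2) (pa 0) - cA (pa 2) (pa 1) = cA (pa 3) (pa 0) - cA (pa 3) (pa 1)"
  proof (rule homeo_preserves_linking_difference[where per = "2 * pi * real ?k" and T = T and \<Theta> = \<Theta> and \<Theta>' = \<Theta>'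
        and zA = "\<lambda>i. lA (pa i)" and zB = "\<lambda>i. lB (\<sigma> (pa i))" and LA = LA and LB = LB
        and WA = "\<lambda>i i'. cA (pa i) (pa i')" and WB = "\<lambda>_ _. \<i> * pi * of_nat (2 * q)"])
    show "0 < 2 * pi * real ?k" using N by simp
    show "T r \<in> unwound" if "r \<in> unwound" for r using that
      by (auto simp: T_def unwound_def cisT simp del: of_nat_add)
    show "T (J (s, x)) = J (s + 2 * pi * real ?k, x)" for s x
      unfolding T_def J_def prod.case cisT by simp
    show "r \<in> range J" if "r \<in> unwound" "T r \<in> range J" for r
      using that unfolding range_J by (simp add: T_def case_prod_unfold)
    show "\<Theta> (T r) = T (\<Theta> r)" if "r \<in> unwound" for r by (cases r) (simp add: T_def \<Theta>shift case_prod_unfold)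
    show "lB (\<sigma> (pa i)) (s + 2 * pi * real ?k) = lB (\<sigma> (pa i)) s" if "i < 4" for i s
      using lB(2)[OF \<sigma>p[OF that]] unfolding kp .
    show "\<Theta> ` graph (lA (pa i)) = graph (lB (\<sigma> (pa i)))" if "i < 4" for i using lines[OF pa[OF that]] .
  qed (use c\<Theta> c\<Theta>' \<Theta>X \<Theta>'X \<Theta>'\<Theta> \<Theta>\<Theta>' lA[OF pa] lB(1,3)[OF \<sigma>p] LA LB in \<open>simp_all\<close>)
  then have "cA 2 1 - cA 2 4 = cA 3 1 - cA 3 4"
    by (simp add: pa_def numeral_2_eq_2 numeral_3_eq_3)
  moreover have "cA 2 1 = \<i> * pi * 2" "cA 2 4 = \<i> * pi * 4" "cA 3 1 = \<i> * pi * 4" "cA 3 4 = \<i> * pi * 2"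
    using A_crossings_1[of m n 0] A_crossings_2[of m n 1] A_crossings_2[of m n 0] A_crossings_1[of m n 2] mn
    unfolding cA_def crossings_commute[of _ 2 1] crossings_commute[of _ 3 1]
    by (simp_all add: numeral_eq_Suc)
  ultimately show False by (simp add: complex_eq_iff)
qed

end

theorem corollary1p10:
  fixes m n p q :: nat
    and K1 K1' K2 :: "(complex \<times> complex) set"
    and \<iota> :: "complex \<times> complex \<Rightarrow> complex \<times> complex \<times> real"
  assumes "coprime m n" and "2 \<le> m" and "m < n"
    and "coprime p q" and "2 \<le> p" and "1 \<le> q"
    and "A_link m n = (K1, K2)" and "B_link p q = (K1', K2)"
    and "zero_surgery K2 S1xS2 \<iota>"
  shows "\<not> ambient_isotopic S1xS2 (\<iota> ` K1) (\<iota> ` K1')"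
proof -
  have K: "K1 = closed_braid (m + n) (A_word m n)" "K1' = closed_braid p (B_word p q)" "K2 = braid_axis"
    using assms(7,8) by (auto simp: A_link_def B_link_def)
  obtain g ji gi where "torus_filling (circle \<times> sphere 0 1) (\<lambda>p. \<iota> (solid_torus_map p)) g ji gi"
    using zero_surgery_is_torus_filling assms(9) unfolding K(3) by blast
  then interpret F: torus_filling "circle \<times> sphere 0 1" "\<lambda>p. \<iota> (solid_torus_map p)" g ji gi .
  obtain \<theta> \<eta> e where "filling_with_angle (circle \<times> sphere 0 1) (\<lambda>p. \<iota> (solid_torus_map p)) g ji gi \<theta> \<eta> e"
  proof (rule F.theta_exists)
    fix \<theta> \<eta> e
    assume *: "continuous_on (circle \<times> sphere 0 1) \<theta>" "\<theta> ` (circle \<times> sphere 0 1) \<subseteq> circle"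
      "continuous_on (circle \<times> UNIV) \<eta>"
      "\<And>u x. u \<in> circle \<Longrightarrow> \<theta> (\<iota> (solid_torus_map (u, x))) = u * cis (\<eta> (u, x))"
      "\<And>c b. cmod c \<le> 1 / 2 \<Longrightarrow> b \<in> circle \<Longrightarrow> \<theta> (g (c, b)) = b powi e"
    show thesis
      by (rule that[of \<theta> \<eta> e]) (unfold_locales; use * in blast)
  qed
  then interpret G: filling_with_angle "circle \<times> sphere 0 1" "\<lambda>p. \<iota> (solid_torus_map p)" g ji gi \<theta> \<eta> e .
  show ?thesis
    unfolding K S1xS2_def by (rule G.braids_not_isotopic[OF refl assms(1-3,5,6)])
qed

end
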